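(* Let $\mathcal{A}$ be a Coxeter arrangement with no irreducible factor equivalent to $\mathsf{E}_8$, and let $\mathbb{F}$ be a field. Then $$\frac{\mathsf{cfHP}_{\mathcal{A}}(1,T)}{\pi_{\mathcal{A}}(1)}=\frac{E_{\mathrm{rk}(\mathcal{A})}(T)}{(1-T)^{\mathrm{rk}(\mathcal{A})}}=\mathrm{Hilb}\left(\mathbb{F}[\mathrm{sd}(\partial\Delta_{\mathrm{rk}(\mathcal{A})-1})],T\right).$$ In other words, $\mathcal{N}_{\mathcal{A}}(1,T)=\pi_{\mathcal{A}}(1)\,E_{\mathrm{rk}(\mathcal{A})}(T)$, and, equivalently, for $1\leq k\leq\mathrm{rk}(\mathcal{A})$, $$\sum_{\substack{F\in\Delta(\overline{\mathcal{L}}(\mathcal{A}))\\|F|=k-1}}\frac{\pi_F(1)}{\pi_{\mathcal{A}}(1)}=k!\;S(\mathrm{rk}(\mathcal{A}),k).$$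
   Context: A hyperplane arrangement over a field $\mathbb{K}$ is a finite set $\mathcal{A}$ of affine hyperplanes in $\mathbb{K}^d$. $\mathcal{L}(\mathcal{A})$ is the set of all nonempty intersections of subsets of $\mathcal{A}$ (including $\mathbb{K}^d=\hat{0}$), ordered by reverse inclusion; for central $\mathcal{A}$ (nonempty total intersection) it has a top element $\hat{1}$. $\widetilde{\mathcal{L}}(\mathcal{A})=\mathcal{L}(\mathcal{A})\setminus\{\hat{0}\}$, $\overline{\mathcal{L}}(\mathcal{A})=\mathcal{L}(\mathcal{A})\setminus\{\hat{0},\hat{1}\}$. $\mathrm{rk}(x)$ is the supremum of lengths of chains from $\hat{0}$ to $x$; $\mathrm{rk}(\mathcal{A})$ is the rank of a maximal element. $\Delta(P)$ is the set of finite flags $F=(x_1<\cdots<x_\ell)$ of a poset $P$, including the empty one; $|F|=\ell$. $\mathcal{A}_x=\{H\in\mathcal{A}\mid x\subseteq H\}$, $\mathcal{A}^x=\{x\cap H\mid H\in\mathcal{A}\setminus\mathcal{A}_x,\ x\cap H\neq\varnothing\}$, $\mathcal{A}_\emptyset:=\mathcal{A}$ ($\emptyset$ a formal symbol), $\mathcal{A}^x_y:=(\mathcal{A}_y)^x$. $\pi_{\mathcal{A}}(Y)=\sum_{x\in\mathcal{L}(\mathcal{A})}\mu(\hat{0},x)(-Y)^{\mathrm{rk}(x)}$ with $\mu$ the Möbius function, and $\pi_F(Y)=\prod_{k=0}^\ell\pi_{\mathcal{A}^{x_k}_{x_{k+1}}}(Y)$ for $F=(x_1<\cdots<x_\ell)$,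 with $x_0=\hat{0}$, $x_{\ell+1}=\emptyset$. The coarse flag Hilbert–Poincaré series is $\mathsf{cfHP}_{\mathcal{A}}(Y,T)=\sum_{F\in\Delta(\widetilde{\mathcal{L}}(\mathcal{A}))}\pi_F(Y)\left(\frac{T}{1-T}\right)^{|F|}$, and $\mathcal{N}_{\mathcal{A}}(Y,T)\in\mathbb{Q}[Y,T]$ is defined by $\mathsf{cfHP}_{\mathcal{A}}(Y,T)=\mathcal{N}_{\mathcal{A}}(Y,T)/(1-T)^{\mathrm{rk}(\mathcal{A})}$. A Coxeter arrangement is a real hyperplane arrangement $\mathcal{A}$ that is stable under the reflections across its hyperplanes and such that these reflections generate a finite Coxeter group. The direct product of arrangements $\mathcal{A}_1$ in $V_1$ and $\mathcal{A}_2$ in $V_2$ is $\{H\times V_2\mid H\in\mathcal{A}_1\}\cup\{V_1\times H\mid H\in\mathcal{A}_2\}$ in $V_1\times V_2$; an arrangement is irreducible if it is not a direct product of two nontrivial arrangements, and every Coxeter arrangement is a direct product of irreducible ones (its irreducible factors). Two arrangements are equivalent if their intersection posets are isomorphic. $\mathsf{E}_8$ denotes the Coxeter arrangement of type $\mathsf{E}_8$. $E_n(T)=\sum_{w\in S_n}T^{\mathrm{des}(w)}$, with $\mathrm{des}(w)=|\{i\in\{1,\dots,n-1\}\mid w(i)>w(i+1)\}|$, is the $n$th Eulerian polynomial. $S(n,k)$ is the Stirling number of the second kind. $\Delta_{n-1}$ is the $(n-1)$-dimensional simplex, $\partial\Delta_{n-1}$ its boundary, $\mathrm{sd}$ denotes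 the first barycentric subdivision, $\mathbb{F}[\cdot]$ the Stanley–Reisner ring over $\mathbb{F}$ and $\mathrm{Hilb}(\cdot,T)$ its (coarse) Hilbert series.
   Formalization: With r = rk(A), the printed Hilbert series equality is off by a factor 1/(1−T) (for r=2, Hilb is (1+T)/(1−T)); corrected to E_r/(1−T)^r = Hilb(F[sd(Δ_{r−1})]) for all r, and = Hilb(F[sd(∂Δ_{r−1})])/(1−T) for r ≥ 1. *)

theory Defs
  imports
    "HOL-Analysis.Analysis"
    "HOL-Library.Poly_Mapping"
    "HOL-Library.Numeral_Type"
    "HOL-Computational_Algebra.Polynomial_FPS"
    "HOL-Combinatorics.Permutations"
    "HOL-Combinatorics.Stirling"
    "HOL-Algebra.Bij"
    "HOL-Algebra.Elementary_Groups"
    "HOL-Algebra.Multiplicative_Group"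
    "HOL-Algebra.QuotRing"
    "HOL-Algebra.Embedded_Algebras"
begin

section \<open>Hyperplane arrangements and their intersection posets\<close>

text \<open>
  An arrangement \<open>A\<close> is always considered together with its ambient affine space \<open>V\<close>, a subset
  of a Euclidean space. This is needed because a restriction of an arrangement has a flat as its
  ambient space. All posets below are ordered by reverse inclusion.
\<close>

definition arrangement :: "'a::euclidean_space set \<Rightarrow> 'a set set \<Rightarrow> bool" where
  "arrangement V A \<longleftrightarrow> affine V \<and> V \<noteq> {} \<and> finite A \<and>
     (\<forall>H\<in>A. affine H \<and> H \<noteq> {} \<and> H \<subseteq> V \<and> aff_dim H = aff_dim V - 1)"

definition flats :: "'a set \<Rightarrow> 'a set set \<Rightarrow> 'a set set" where
  "flats V A = {V \<inter> \<Inter>B | B. B \<subseteq> A} - {{}}"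

definition flats_above_bottom :: "'a set \<Rightarrow> 'a set set \<Rightarrow> 'a set set" where
  "flats_above_bottom V A = flats V A - {V}"

text \<open>For a central arrangement the top element is the intersection of all hyperplanes.\<close>

definition proper_flats :: "'a set \<Rightarrow> 'a set set \<Rightarrow> 'a set set" where
  "proper_flats V A = flats V A - {V, V \<inter> \<Inter>A}"

text \<open>A flag \<open>x\<^sub>1 < \<dots> < x\<^sub>l\<close> is the strictly descending list of the sets \<open>x\<^sub>i\<close>.\<close>

definition flags :: "'a set set \<Rightarrow> 'a set list set" where
  "flags P = {F. set F \<subseteq> P \<and> sorted_wrt (\<lambda>x y. y \<subset> x) F}"

definition flat_rank :: "'a set \<Rightarrow> 'a set set \<Rightarrow> 'a set \<Rightarrow> nat" where
  "flat_rank V A x =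
     Sup {length C - 1 | C. C \<in> flags (flats V A) \<and> C \<noteq> [] \<and> hd C = V \<and> last C = x}"

definition arr_rank :: "'a set \<Rightarrow> 'a set set \<Rightarrow> nat" where
  "arr_rank V A = flat_rank V A (SOME x. x \<in> flats V A \<and> (\<forall>y\<in>flats V A. y \<subseteq> x \<longrightarrow> y = x))"

text \<open>
  The Moebius function of a finite family of sets \<open>P\<close> ordered by reverse inclusion; it is \<open>0\<close> by
  convention when \<open>x \<le> y\<close> fails in \<open>P\<close>.
\<close>

function mobius :: "'a set set \<Rightarrow> 'a set \<Rightarrow> 'a set \<Rightarrow> int" where
  "mobius P x y =
     (if finite P \<and> x \<in> P \<and> y \<in> P \<and> y \<subseteq> x
      then if x = y then 1 else - (\<Sum>z\<in>{z\<in>P. y \<subset> z \<and> z \<subseteq> x}. mobius P x z)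
      else 0)"
  by pat_completeness auto
termination
proof (relation "Wellfounded.measure (\<lambda>(P, x, y). card {z\<in>P. y \<subset> z})", goal_cases)
  case 1
  show ?case by simp
next
  case (2 P x y z)
  then have "z \<in> P" "y \<subset> z" "finite P" by auto
  then have "{w\<in>P. z \<subset> w} \<subset> {w\<in>P. y \<subset> w}" by blast
  with \<open>finite P\<close> show ?case by (simp add: psubset_card_mono)
qed

declare mobius.simps [simp del]

definition poincare_poly :: "'a set \<Rightarrow> 'a set set \<Rightarrow> rat poly" where
  "poincare_poly V A =
     (\<Sum>x\<in>flats V A. Polynomial.smult (of_int (mobius (flats V A) V x)) ((- [:0, 1:]) ^ flat_rank V A x))"

definition localization :: "'a set set \<Rightarrow> 'a set \<Rightarrow> 'a set set" where
  "localization A x = {H\<in>A. x \<subseteq> H}"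

text \<open>The ambient space of the restriction to \<open>x\<close> is \<open>x\<close>.\<close>

definition restriction :: "'a set set \<Rightarrow> 'a set \<Rightarrow> 'a set set" where
  "restriction A x = {x \<inter> H | H. H \<in> A - localization A x \<and> x \<inter> H \<noteq> {}}"

text \<open>
  The factor with index \<open>k\<close> belongs to the pair \<open>(x\<^sub>k, x\<^bsub>k+1\<^esub>)\<close>. The formal symbol that follows the
  last flat can be taken to be the empty set, since \<open>localization A {} = A\<close>.
\<close>

definition flag_poly :: "'a set \<Rightarrow> 'a set set \<Rightarrow> 'a set list \<Rightarrow> rat poly" where
  "flag_poly V A F =
     (let xs = V # F @ [{}]
      in \<Prod>k\<le>length F. poincare_poly (xs ! k) (restriction (localization A (xs ! Suc k)) (xs ! k)))"


section \<open>The coarse flag Hilbert--Poincare series\<close>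

text \<open>
  Rational functions in \<open>Y, T\<close> whose denominator is a power of \<open>1 - T\<close> are represented by their
  power series expansion in \<open>T\<close>, with coefficients that are polynomials in \<open>Y\<close>.
\<close>

definition inverse_one_minus_T :: "'r::comm_ring_1 fps" where
  "inverse_one_minus_T = Abs_fps (\<lambda>_. 1)"

lemma one_minus_T_times_inverse: "(1 - fps_X) * (inverse_one_minus_T :: 'r::comm_ring_1 fps) = 1"
proof (rule fps_ext)
  fix n
  show "fps_nth ((1 - fps_X) * (inverse_one_minus_T :: 'r fps)) n = fps_nth 1 n"
    by (cases n) (simp_all add: inverse_one_minus_T_def left_diff_distrib)
qed

definition cfHP :: "'a set \<Rightarrow> 'a set set \<Rightarrow> rat poly fps" where
  "cfHP V A = (\<Sum>F\<in>flags (flats_above_bottom V A).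
     fps_const (flag_poly V A F) * (fps_X * inverse_one_minus_T) ^ length F)"

text \<open>The outer variable is \<open>T\<close>, the inner one is \<open>Y\<close>.\<close>

definition cfHP_numerator :: "'a set \<Rightarrow> 'a set set \<Rightarrow> rat poly poly" where
  "cfHP_numerator V A =
     (THE N. cfHP V A = fps_of_poly N * inverse_one_minus_T ^ arr_rank V A)"

definition eval_Y_fps :: "rat \<Rightarrow> rat poly fps \<Rightarrow> rat fps" where
  "eval_Y_fps y f = Abs_fps (\<lambda>n. poly (fps_nth f n) y)"

definition eval_Y_poly :: "rat \<Rightarrow> rat poly poly \<Rightarrow> rat poly" where
  "eval_Y_poly y N = map_poly (\<lambda>p. poly p y) N"


section \<open>Products, irreducible factors and equivalence\<close>

definition direct_product :: "'a set \<Rightarrow> 'a set set \<Rightarrow> 'b set \<Rightarrow> 'b set set \<Rightarrow> ('a \<times> 'b) set set" where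
  "direct_product V1 A1 V2 A2 = (\<lambda>H. H \<times> V2) ` A1 \<union> (\<lambda>H. V1 \<times> H) ` A2"

text \<open>Being a direct product is understood up to an affine change of coordinates \<open>x \<mapsto> c + g x\<close>.\<close>

definition is_direct_product ::
  "'a::euclidean_space set \<Rightarrow> 'a set set \<Rightarrow> 'a set \<Rightarrow> 'a set set \<Rightarrow> 'a set \<Rightarrow> 'a set set \<Rightarrow> bool" where
  "is_direct_product V A V1 A1 V2 A2 \<longleftrightarrow>
     (\<exists>(c::'a) (g :: 'a \<times> 'a \<Rightarrow> 'a). linear g \<and> bij_betw (\<lambda>p. c + g p) (V1 \<times> V2) V \<and>
        A = (`) (\<lambda>p. c + g p) ` direct_product V1 A1 V2 A2)"

definition irreducible_arrangement :: "'a::euclidean_space set \<Rightarrow> 'a set set \<Rightarrow> bool" where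
  "irreducible_arrangement V A \<longleftrightarrow>
     \<not> (\<exists>V1 A1 V2 A2. arrangement V1 A1 \<and> A1 \<noteq> {} \<and> arrangement V2 A2 \<and> A2 \<noteq> {} \<and>
          is_direct_product V A V1 A1 V2 A2)"

definition irreducible_factor ::
  "'a::euclidean_space set \<Rightarrow> 'a set set \<Rightarrow> 'a set \<Rightarrow> 'a set set \<Rightarrow> bool" where
  "irreducible_factor V A W B \<longleftrightarrow>
     arrangement W B \<and> B \<noteq> {} \<and> irreducible_arrangement W B \<and>
     (\<exists>W' B'. arrangement W' B' \<and> is_direct_product V A W B W' B')"

definition equivalent_arrangements ::
  "'a set \<Rightarrow> 'a set set \<Rightarrow> 'b set \<Rightarrow> 'b set set \<Rightarrow> bool" where
  "equivalent_arrangements V A W B \<longleftrightarrow>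
     (\<exists>f. bij_betw f (flats V A) (flats W B) \<and>
        (\<forall>x\<in>flats V A. \<forall>y\<in>flats V A. x \<subseteq> y \<longleftrightarrow> f x \<subseteq> f y))"


section \<open>Coxeter arrangements\<close>

text \<open>The orthogonal reflection across the affine hyperplane \<open>H\<close>.\<close>

definition reflection :: "'a::euclidean_space set \<Rightarrow> 'a \<Rightarrow> 'a" where
  "reflection H x = 2 *\<^sub>R closest_point H x - x"

text \<open>
  Equality of words in the generators \<open>S\<close> modulo the relations \<open>(s t)\<^bsup>m(s,t)\<^esup> = 1\<close>, where \<open>m(s,t)\<close>
  is the order of \<open>s t\<close> in \<open>G\<close>. An infinite order is represented by \<open>0\<close> and yields a void relation.
\<close>

inductive coxeter_word_eq :: "('g, 'm) monoid_scheme \<Rightarrow> 'g set \<Rightarrow> 'g list \<Rightarrow> 'g list \<Rightarrow> bool"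
  for G S where
    refl: "u \<in> lists S \<Longrightarrow> coxeter_word_eq G S u u"
  | sym: "coxeter_word_eq G S u v \<Longrightarrow> coxeter_word_eq G S v u"
  | trans: "coxeter_word_eq G S u v \<Longrightarrow> coxeter_word_eq G S v w \<Longrightarrow> coxeter_word_eq G S u w"
  | rel: "u \<in> lists S \<Longrightarrow> v \<in> lists S \<Longrightarrow> s \<in> S \<Longrightarrow> t \<in> S \<Longrightarrow>
      coxeter_word_eq G S (u @ concat (replicate (group.ord G (s \<otimes>\<^bsub>G\<^esub> t)) [s, t]) @ v) (u @ v)"

definition coxeter_group :: "('g, 'm) monoid_scheme \<Rightarrow> bool" where
  "coxeter_group G \<longleftrightarrow> group G \<and>
     (\<exists>S\<subseteq>carrier G. generate G S = carrier G \<and> (\<forall>s\<in>S. group.ord G s = 2) \<and>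
        (\<forall>u\<in>lists S. \<forall>v\<in>lists S.
           foldr (mult G) u \<one>\<^bsub>G\<^esub> = foldr (mult G) v \<one>\<^bsub>G\<^esub> \<longrightarrow> coxeter_word_eq G S u v))"

definition reflection_group :: "'a::euclidean_space set set \<Rightarrow> ('a \<Rightarrow> 'a) monoid" where
  "reflection_group A = subgroup_generated (BijGroup UNIV) (reflection ` A)"

definition coxeter_arrangement :: "'a::euclidean_space set set \<Rightarrow> bool" where
  "coxeter_arrangement A \<longleftrightarrow> arrangement UNIV A \<and>
     (\<forall>H\<in>A. \<forall>K\<in>A. reflection H ` K \<in> A) \<and>
     finite (carrier (reflection_group A)) \<and> coxeter_group (reflection_group A)"

definition E8_roots :: "(real^8) set" where
  "E8_roots =
     {a *\<^sub>R axis i 1 + b *\<^sub>R axis j 1 | a b i j. a \<in> {1, -1} \<and> b \<in> {1, -1} \<and> i \<noteq> j} \<union>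
     {x. (\<forall>i. x $ i \<in> {1/2, -1/2}) \<and> even (card {i. x $ i = -1/2})}"

definition E8_arrangement :: "(real^8) set set" where
  "E8_arrangement = {{x. r \<bullet> x = 0} | r. r \<in> E8_roots}"


section \<open>Eulerian polynomials\<close>

definition des :: "nat \<Rightarrow> (nat \<Rightarrow> nat) \<Rightarrow> nat" where
  "des n w = card {i\<in>{1..<n}. w i > w (i + 1)}"

definition eulerian_poly :: "nat \<Rightarrow> rat poly" where
  "eulerian_poly n = (\<Sum>w | w permutes {1..n}. Polynomial.monom 1 (des n w))"


section \<open>Simplicial complexes and Stanley--Reisner rings\<close>

text \<open>
  A simplicial complex is the set of its faces, including the empty face. The complex
  \<open>simplex_on n\<close> is the simplex with vertices \<open>1, \<dots>, n\<close>, so its dimension is \<open>n - 1\<close>. Its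
  boundary has dimension \<open>n - 2\<close>: the Hilbert series of the subdivided boundary has denominator
  \<open>(1 - T)\<^bsup>n-1\<^esup>\<close>, that of the subdivided simplex, which is a cone over it, \<open>(1 - T)\<^bsup>n\<^esup>\<close>.
\<close>

definition simplex_on :: "nat \<Rightarrow> nat set set" where
  "simplex_on n = Pow {1..n}"

definition simplex_boundary :: "nat \<Rightarrow> nat set set" where
  "simplex_boundary n = simplex_on n - {{1..n}}"

text \<open>The faces of the subdivision are the finite chains of nonempty faces.\<close>

definition barycentric_subdivision :: "'v set set \<Rightarrow> 'v set set set" where
  "barycentric_subdivision D = {C \<in> chains (D - {{}}). finite C}"

definition poly_ring :: "'v set \<Rightarrow> (('v \<Rightarrow>\<^sub>0 nat) \<Rightarrow>\<^sub>0 'k::field) ring" where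
  "poly_ring X =
     \<lparr>carrier = {p. \<forall>m\<in>Poly_Mapping.keys p. Poly_Mapping.keys m \<subseteq> X},
      monoid.mult = (*), one = 1, zero = 0, add = (+)\<rparr>"

definition var :: "'v \<Rightarrow> ('v \<Rightarrow>\<^sub>0 nat) \<Rightarrow>\<^sub>0 'k::field" where
  "var v = Poly_Mapping.single (Poly_Mapping.single v 1) 1"

definition const_poly :: "'k::field \<Rightarrow> ('v \<Rightarrow>\<^sub>0 nat) \<Rightarrow>\<^sub>0 'k" where
  "const_poly c = Poly_Mapping.single 0 c"

definition homogeneous :: "nat \<Rightarrow> (('v \<Rightarrow>\<^sub>0 nat) \<Rightarrow>\<^sub>0 'k::field) \<Rightarrow> bool" where
  "homogeneous d p \<longleftrightarrow>
     (\<forall>m\<in>Poly_Mapping.keys p. (\<Sum>v\<in>Poly_Mapping.keys m. Poly_Mapping.lookup m v) = d)"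

definition stanley_reisner_ideal :: "'v set set \<Rightarrow> (('v \<Rightarrow>\<^sub>0 nat) \<Rightarrow>\<^sub>0 'k::field) set" where
  "stanley_reisner_ideal D =
     genideal (poly_ring (\<Union>D)) {\<Prod>v\<in>s. var v | s. finite s \<and> s \<subseteq> \<Union>D \<and> s \<notin> D}"

definition stanley_reisner_ring :: "'v set set \<Rightarrow> (('v \<Rightarrow>\<^sub>0 nat) \<Rightarrow>\<^sub>0 'k::field) set ring" where
  "stanley_reisner_ring D = poly_ring (\<Union>D) Quot stanley_reisner_ideal D"

definition sr_class :: "'v set set \<Rightarrow> (('v \<Rightarrow>\<^sub>0 nat) \<Rightarrow>\<^sub>0 'k::field) \<Rightarrow> (('v \<Rightarrow>\<^sub>0 nat) \<Rightarrow>\<^sub>0 'k) set" where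
  "sr_class D p = stanley_reisner_ideal D +>\<^bsub>poly_ring (\<Union>D)\<^esub> p"

text \<open>
  The coefficient of \<open>T\<^sup>d\<close> is the dimension of the graded component of degree \<open>d\<close> over the image
  of the coefficient field.
\<close>

definition stanley_reisner_hilbert :: "'k::field itself \<Rightarrow> 'v set set \<Rightarrow> rat fps" where
  "stanley_reisner_hilbert _ D = Abs_fps (\<lambda>d. of_nat
     (ring.dim (stanley_reisner_ring D :: (('v \<Rightarrow>\<^sub>0 nat) \<Rightarrow>\<^sub>0 'k) set ring)
        (range (\<lambda>c. sr_class D (const_poly c)))
        (sr_class D ` {p \<in> carrier (poly_ring (\<Union>D)). homogeneous d p})))"

end

theory Submission
  imports Defs "HOL-Combinatorics.Multiset_Permutations"
begin

text \<open>
  By Zaslavsky's theorem, \<open>\<pi>\<^sub>F(1)\<close> is a product of numbers of regions, and it counts the chains of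
  faces of the arrangement whose affine spans are the ambient space followed by the members of the
  flag \<open>F\<close>. A Coxeter arrangement is simplicial: the faces of a chamber form a Boolean lattice,
  because the simple roots are linearly independent. Hence each of the \<open>\<pi>\<^sub>A(1)\<close> chambers contributes
  as many chains as there are chains of proper subsets of a set with \<open>rk(A)\<close> elements. These
  chains are counted by surjections, by the Eulerian polynomial, and by the faces of the
  barycentric subdivision of a simplex.
\<close>

section \<open>Counting regions\<close>

text \<open>Why \<pi>_F(1) counts chains: the factor of two consecutive flats x and y is the number
  of regions that the hyperplanes containing y cut out in x, and this is the number of faces
  spanning x whose closure contains a given face spanning y. The count runs as a recursion along
  flags: if each face spanning x has as many faces of each dimension as a simplex cone, then summing
  weight times number of faces over the flats y below x of a fixed dimension gives a binomial
  coefficient times the number of faces spanning x. The obstacle is that restricting to a flat makes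
  different hyperplanes coincide. Arrangements are therefore handled through finite sets of normals,
  among which several may cut out the same hyperplane: Whitney's alternating sum and the set of sign
  patterns do not notice repetitions. All hyperplanes must share a point \<open>c\<close>; for a
  Coxeter arrangement it is a fixed point of the reflection group.\<close>

definition hyp :: "'a::euclidean_space \<Rightarrow> 'a \<Rightarrow> 'a set" where
  "hyp c a = {y. a \<bullet> (y - c) = 0}"

definition zeros :: "'a::euclidean_space \<Rightarrow> 'a set \<Rightarrow> 'a set \<Rightarrow> 'a set" where
  "zeros c V J = {y\<in>V. \<forall>a\<in>J. a \<bullet> (y - c) = 0}"

definition face :: "'a::euclidean_space \<Rightarrow> 'a set \<Rightarrow> 'a \<Rightarrow> 'a set" where
  "face c I y = {a\<in>I. a \<bullet> (y - c) > 0}"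

definition generic :: "'a::euclidean_space \<Rightarrow> 'a set \<Rightarrow> 'a set \<Rightarrow> 'a set" where
  "generic c V I = {y\<in>V. \<forall>a\<in>I. a \<bullet> (y - c) \<noteq> 0}"

text \<open>No normal vanishes at a generic point, so the set of positive normals is the full sign
  pattern. The points with a given pattern form a convex set, so for an affine \<open>V\<close> the
  patterns stand for the connected components of the complement.\<close>

definition regions :: "'a::euclidean_space \<Rightarrow> 'a set \<Rightarrow> 'a set \<Rightarrow> 'a set set" where
  "regions c V I = face c I ` generic c V I"

text \<open>Whitney's subset expansion of the Poincare polynomial, evaluated at Y = 1: the second
  summand of the exponent is the codimension in \<open>V\<close> of the intersection belonging to
  \<open>J\<close>.\<close>

definition whitney :: "'a::euclidean_space \<Rightarrow> 'a set \<Rightarrow> 'a set \<Rightarrow> int" where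
  "whitney c V I = (\<Sum>J\<in>Pow I. (-1) ^ (card J + nat (aff_dim V - aff_dim (zeros c V J))))"

lemma hyp_alt: "hyp c a = {y. a \<bullet> y = a \<bullet> c}"
  by (auto simp: hyp_def inner_diff_right)

lemma affine_hyp [intro]: "affine (hyp c a)"
  by (simp add: hyp_alt affine_hyperplane)

lemma center_in_hyp [simp]: "c \<in> hyp c a"
  by (simp add: hyp_def)

lemma zeros_eq: "zeros c V J = V \<inter> (\<Inter>a\<in>J. hyp c a)"
  by (auto simp: zeros_def hyp_def)

lemma zeros_empty [simp]: "zeros c V {} = V"
  by (simp add: zeros_def)

lemma zeros_insert: "zeros c V (insert a J) = zeros c (V \<inter> hyp c a) J"
  by (auto simp: zeros_def hyp_def)

lemma affine_zeros: "affine V \<Longrightarrow> affine (zeros c V J)"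
  unfolding zeros_eq by (auto intro!: affine_Int affine_Inter)

lemma center_in_zeros: "c \<in> V \<Longrightarrow> c \<in> zeros c V J"
  by (simp add: zeros_def)

lemma aff_dim_Int_hyp:
  assumes "affine V" "c \<in> V" "\<not> V \<subseteq> hyp c a"
  shows "aff_dim (V \<inter> hyp c a) = aff_dim V - 1"
  using assms aff_dim_affine_Int_hyperplane[of V a "a \<bullet> c"] unfolding hyp_alt by auto

text \<open>Pushing \<open>y\<close> a little in the direction of \<open>v\<close> keeps all nonzero signs and gives the sign at
  \<open>v\<close> to every vector that vanishes at \<open>y\<close>.\<close>

lemma perturbation:
  assumes V: "affine V" "c \<in> V" "y \<in> V" "v \<in> V" and I: "finite I"
  obtains z where "z \<in> V" "\<And>a. a \<in> I \<Longrightarrow> a \<bullet> (y - c) \<noteq> 0 \<Longrightarrow> sgn (a \<bullet> (z - c)) = sgn (a \<bullet> (y - c))"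
    "\<And>a. a \<in> I \<Longrightarrow> a \<bullet> (y - c) = 0 \<Longrightarrow> sgn (a \<bullet> (z - c)) = sgn (a \<bullet> (v - c))"
proof -
  define p where "p a = a \<bullet> (y - c)" for a
  define q where "q a = a \<bullet> (v - c)" for a
  have "\<forall>\<^sub>F e in at_right 0. \<forall>a\<in>I. p a \<noteq> 0 \<longrightarrow> sgn (p a + e * q a) = sgn (p a)"
  proof (subst eventually_ball_finite_distrib[OF I], intro ballI)
    fix a assume "a \<in> I"
    show "\<forall>\<^sub>F e in at_right 0. p a \<noteq> 0 \<longrightarrow> sgn (p a + e * q a) = sgn (p a)"
    proof (cases "p a = 0")
      case False
      have lim: "((\<lambda>e. p a + e * q a) \<longlongrightarrow> p a + 0 * q a) (at_right 0)"
        by (intro tendsto_intros)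
      show ?thesis
      proof (cases "p a > 0")
        case True
        then have "\<forall>\<^sub>F e in at_right 0. p a + e * q a > 0"
          using order_tendstoD(1)[OF lim, of 0] by simp
        then show ?thesis by eventually_elim (use True in simp)
      next
        case neg: False
        with False have "\<forall>\<^sub>F e in at_right 0. p a + e * q a < 0"
          using order_tendstoD(2)[OF lim, of 0] by simp
        then show ?thesis by eventually_elim (use neg False in simp)
      qed
    qed simp
  qed
  moreover have "\<forall>\<^sub>F e::real in at_right 0. 0 < e"
    by (simp add: eventually_at_right_less)
  ultimately have "\<forall>\<^sub>F e in at_right 0. 0 < e \<and> (\<forall>a\<in>I. p a \<noteq> 0 \<longrightarrow> sgn (p a + e * q a) = sgn (p a))"
    by eventually_elim auto
  then obtain e where e: "0 < e" "\<forall>a\<in>I. p a \<noteq> 0 \<longrightarrow> sgn (p a + e * q a) = sgn (p a)"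
    using eventually_happens'[OF trivial_limit_at_right_real] by blast
  define z where "z = y + e *\<^sub>R (v - c)"
  \<comment> \<open>The weights 1, e and -e add up to 1, so \<open>z\<close> stays in the affine
    space.\<close>
  have "z = 1 *\<^sub>R y + e *\<^sub>R v + (-e) *\<^sub>R c"
    by (simp add: z_def algebra_simps)
  then have "z \<in> V"
    using V mem_affine_3[of V y v c 1 e "-e"] by auto
  moreover have zc: "a \<bullet> (z - c) = p a + e * q a" for a
    by (simp add: z_def p_def q_def inner_simps algebra_simps)
  ultimately show thesis
    using that[of z] e by (auto simp: p_def q_def sgn_mult)
qed

text \<open>A point generic for \<open>I\<close> is pushed towards a point off the next hyperplane;
  the signs that are already nonzero survive.\<close>

lemma generic_point_exists:
  assumes V: "affine V" "c \<in> V" and I: "finite I" and a: "\<And>a. a \<in> I \<Longrightarrow> \<not> V \<subseteq> hyp c a"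
  shows "generic c V I \<noteq> {}"
  using I a
proof (induction I)
  case empty
  then show ?case using V by (auto simp: generic_def)
next
  case (insert a I)
  then obtain y where y: "y \<in> V" "\<forall>b\<in>I. b \<bullet> (y - c) \<noteq> 0"
    by (auto simp: generic_def)
  obtain v where v: "v \<in> V" "a \<bullet> (v - c) \<noteq> 0"
    using insert.prems[of a] by (auto simp: hyp_def)
  obtain z where z: "z \<in> V"
    "\<And>b. b \<in> insert a I \<Longrightarrow> b \<bullet> (y - c) \<noteq> 0 \<Longrightarrow> sgn (b \<bullet> (z - c)) = sgn (b \<bullet> (y - c))"
    "\<And>b. b \<in> insert a I \<Longrightarrow> b \<bullet> (y - c) = 0 \<Longrightarrow> sgn (b \<bullet> (z - c)) = sgn (b \<bullet> (v - c))"
    using perturbation[OF V y(1) v(1), of "insert a I"] insert.hyps by auto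
  have "b \<bullet> (z - c) \<noteq> 0" if "b \<in> insert a I" for b
    using z(2,3)[OF that] y(2) v(2) that by (metis insertE sgn_eq_0_iff)
  then show ?case
    using z(1) by (auto simp: generic_def)
qed

lemma finite_regions [simp]: "finite I \<Longrightarrow> finite (regions c V I)"
  by (rule finite_subset[of _ "Pow I"]) (auto simp: regions_def face_def)

lemma regions_subset_hyp:
  assumes "a \<in> I" "V \<subseteq> hyp c a"
  shows "regions c V I = {}"
  using assms by (auto simp: regions_def generic_def hyp_def)

section \<open>Deletion and restriction for Whitney's sum and for regions\<close>

lemma sum_Pow_insert:
  assumes "finite I" "a \<notin> I"
  shows "(\<Sum>J\<in>Pow (insert a I). f J) = (\<Sum>J\<in>Pow I. f J) + (\<Sum>J\<in>Pow I. f (insert a J))"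
proof -
  have "inj_on (insert a) (Pow I)"
    using assms(2) by (auto simp: inj_on_def)
  then show ?thesis
    unfolding Pow_insert using assms by (subst sum.union_disjoint) (auto simp: sum.reindex)
qed

lemma nat_diff_step: "(b::int) \<le> a \<Longrightarrow> nat (a + 1 - b) = Suc (nat (a - b))"
  by linarith

text \<open>If \<open>a\<close> vanishes on \<open>V\<close>, adjoining it to \<open>J\<close>
  changes only the cardinality, and the terms cancel in pairs. Otherwise the terms with
  \<open>a\<close> gain one in cardinality and, seen from \<open>V \<inter> hyp c a\<close>, one in
  codimension, so their sign is unchanged.\<close>

lemma whitney_insert:
  assumes V: "affine V" "c \<in> V" and I: "finite I" "a \<notin> I"
  shows "whitney c V (insert a I) =
    (if V \<subseteq> hyp c a then 0 else whitney c V I + whitney c (V \<inter> hyp c a) I)"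
proof (cases "V \<subseteq> hyp c a")
  case True
  then have "V \<inter> hyp c a = V" by blast
  then show ?thesis
    unfolding whitney_def sum_Pow_insert[OF I] zeros_insert using True I
    by (simp flip: sum.distrib)
      (rule sum.neutral, auto simp: card_insert_if finite_subset)
next
  case False
  have "(-1::int) ^ (card (insert a J) + nat (aff_dim V - aff_dim (zeros c V (insert a J))))
      = (-1) ^ (card J + nat (aff_dim (V \<inter> hyp c a) - aff_dim (zeros c (V \<inter> hyp c a) J)))"
    if "J \<in> Pow I" for J
  proof -
    have "finite J" "a \<notin> J" using that I by (auto intro: finite_subset)
    moreover have "aff_dim (zeros c (V \<inter> hyp c a) J) \<le> aff_dim (V \<inter> hyp c a)"
      by (rule aff_dim_subset) (auto simp: zeros_def)
    moreover have "aff_dim V = aff_dim (V \<inter> hyp c a) + 1"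
      using aff_dim_Int_hyp[OF V False] by simp
    ultimately show ?thesis
      by (simp add: zeros_insert nat_diff_step)
  qed
  then show ?thesis
    unfolding whitney_def sum_Pow_insert[OF I] using False by simp
qed

text \<open>Forgetting \<open>a\<close> sends the regions on its positive side and those on its
  negative side injectively to regions of \<open>I\<close>. The two images cover all regions of
  \<open>I\<close> and overlap exactly in those that the hyperplane of \<open>a\<close> cuts, which
  are the regions inside the hyperplane.\<close>

lemma card_regions_insert:
  assumes V: "affine V" "c \<in> V" and I: "finite I" "a \<notin> I" and nV: "\<not> V \<subseteq> hyp c a"
  shows "card (regions c V (insert a I)) = card (regions c V I) + card (regions c (V \<inter> hyp c a) I)"
proof -
  let ?P = "{P. P \<in> regions c V (insert a I) \<and> a \<in> P}"
  let ?N = "{P. P \<in> regions c V (insert a I) \<and> a \<notin> P}"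
  let ?p = "(\<lambda>P. P - {a}) ` ?P"
  obtain v where v: "v \<in> V" "a \<bullet> (v - c) \<noteq> 0"
    using nV by (auto simp: hyp_def)
  have v': "c + (-1) *\<^sub>R (v - c) \<in> V"
    using mem_affine_3[OF V(1) V(2) v(1) V(2), of 1 "-1" 1] by (simp add: algebra_simps)
  have face_a: "face c I y = face c (insert a I) y - {a}" for y
    using I by (auto simp: face_def)
  have sub: "P - {a} \<in> regions c V I" if "P \<in> regions c V (insert a I)" for P
    using that unfolding regions_def generic_def by (auto simp: face_a[symmetric])
  have pert: "\<exists>z\<in>generic c V (insert a I). face c I z = face c I y \<and> (a \<in> face c (insert a I) z \<longleftrightarrow> s)"
    if y: "y \<in> generic c V I" "a \<bullet> (y - c) = 0" for y s
  proof -
    \<comment> \<open>Of \<open>v\<close> and its mirror image through \<open>c\<close>, one lies on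
      each side of the hyperplane of \<open>a\<close>.\<close>
    define w where "w = (if (a \<bullet> (v - c) > 0) = s then v else c + (-1) *\<^sub>R (v - c))"
    have w: "w \<in> V" "a \<bullet> (w - c) \<noteq> 0" "a \<bullet> (w - c) > 0 \<longleftrightarrow> s"
      using v v' by (auto simp: w_def inner_diff_right inner_add_right)
    obtain z where z: "z \<in> V"
      "\<And>b. b \<in> insert a I \<Longrightarrow> b \<bullet> (y - c) \<noteq> 0 \<Longrightarrow> sgn (b \<bullet> (z - c)) = sgn (b \<bullet> (y - c))"
      "\<And>b. b \<in> insert a I \<Longrightarrow> b \<bullet> (y - c) = 0 \<Longrightarrow> sgn (b \<bullet> (z - c)) = sgn (b \<bullet> (w - c))"
      using perturbation[OF V _ w(1), of y "insert a I"] y(1) I by (auto simp: generic_def)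
    have "b \<bullet> (z - c) \<noteq> 0 \<and> (b \<bullet> (z - c) > 0 \<longleftrightarrow> b \<bullet> (y - c) > 0)" if "b \<in> I" for b
      using z(2)[of b] y(1) that by (auto simp: generic_def sgn_if split: if_splits)
    moreover have "a \<bullet> (z - c) \<noteq> 0 \<and> (a \<bullet> (z - c) > 0 \<longleftrightarrow> s)"
      using z(3)[of a] y(2) w by (auto simp: sgn_if split: if_splits)
    ultimately show ?thesis
      using z(1) by (intro bexI[of _ z]) (auto simp: generic_def face_def)
  qed
  have gen: "\<exists>z\<in>generic c V (insert a I). face c I z = P" if P: "P \<in> regions c V I" for P
  proof -
    from P obtain y where y: "y \<in> generic c V I" "P = face c I y"
      by (auto simp: regions_def)
    show ?thesis
    proof (cases "a \<bullet> (y - c) = 0")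
      case True
      then show ?thesis using pert[OF y(1), of True] y(2) by blast
    next
      case False
      then show ?thesis using y by (intro bexI[of _ y]) (auto simp: generic_def)
    qed
  qed
  have un: "?p \<union> ?N = regions c V I"
  proof
    show "?p \<union> ?N \<subseteq> regions c V I"
      using sub by force
    show "regions c V I \<subseteq> ?p \<union> ?N"
    proof
      fix P assume "P \<in> regions c V I"
      then obtain z where z: "z \<in> generic c V (insert a I)" "face c I z = P"
        using gen by blast
      then show "P \<in> ?p \<union> ?N"
        using face_a[of z] unfolding regions_def by (cases "a \<in> face c (insert a I) z") auto
    qed
  qed
  have int: "?p \<inter> ?N = regions c (V \<inter> hyp c a) I"
  proof
    show "regions c (V \<inter> hyp c a) I \<subseteq> ?p \<inter> ?N"
    proof
      fix P assume "P \<in> regions c (V \<inter> hyp c a) I"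
      then obtain y where y: "y \<in> generic c V I" "a \<bullet> (y - c) = 0" "P = face c I y"
        by (auto simp: regions_def generic_def hyp_def)
      obtain z z' where "z\<in>generic c V (insert a I)" "face c I z = P" "a \<in> face c (insert a I) z"
          "z'\<in>generic c V (insert a I)" "face c I z' = P" "a \<notin> face c (insert a I) z'"
        using pert[OF y(1,2), of True] pert[OF y(1,2), of False] y(3) by auto
      then show "P \<in> ?p \<inter> ?N"
        using face_a[of z] face_a[of z'] unfolding regions_def by auto
    qed
    show "?p \<inter> ?N \<subseteq> regions c (V \<inter> hyp c a) I"
    proof
      fix P assume "P \<in> ?p \<inter> ?N"
      then obtain y z where y: "y \<in> generic c V (insert a I)" "a \<in> face c (insert a I) y"
          "P = face c (insert a I) y - {a}"
        and z: "z \<in> generic c V (insert a I)" "a \<notin> P" "P = face c (insert a I) z"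
        unfolding regions_def by auto
      define p where "p b = b \<bullet> (y - c)" for b
      define q where "q b = b \<bullet> (z - c)" for b
      have "p a > 0" using y(2) by (simp add: face_def p_def)
      moreover have "q a < 0" using z by (auto simp: face_def q_def generic_def)
      ultimately have "p a - q a > 0" by simp
      \<comment> \<open>The weights locate the point where the segment from \<open>z\<close> to
        \<open>y\<close> crosses the hyperplane of \<open>a\<close>. Every other normal has the same
        sign at both ends, hence also at that point.\<close>
      then have "- q a / (p a - q a) + p a / (p a - q a) = 1"
          "- q a / (p a - q a) * p a + p a / (p a - q a) * q a = 0"
        by (simp_all add: diff_divide_distrib[symmetric])
      moreover have "- q a / (p a - q a) > 0" "p a / (p a - q a) > 0"
        using \<open>p a > 0\<close> \<open>q a < 0\<close> \<open>p a - q a > 0\<close> by (simp_all add: divide_pos_pos divide_neg_pos)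
      ultimately obtain u w where uw: "u > 0" "w > 0" "u + w = 1" "u * p a + w * q a = 0"
        by blast
      define x where "x = u *\<^sub>R y + w *\<^sub>R z"
      have xc: "b \<bullet> (x - c) = u * p b + w * q b" for b
      proof -
        have "x - c = u *\<^sub>R (y - c) + w *\<^sub>R (z - c)"
          using uw(3) by (simp add: x_def algebra_simps flip: scaleR_add_left)
        then show ?thesis by (simp add: inner_simps p_def q_def)
      qed
      have xV: "x \<in> V"
        unfolding x_def using y z uw V(1) by (intro mem_affine) (auto simp: generic_def)
      have *: "b \<bullet> (x - c) \<noteq> 0 \<and> (b \<bullet> (x - c) > 0 \<longleftrightarrow> b \<in> P)" if b: "b \<in> I" for b
      proof (cases "b \<in> P")
        case True
        then have "p b > 0" "q b > 0"
          using y(3) z(3) by (auto simp: face_def p_def q_def)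
        then show ?thesis using uw True by (simp add: xc add_pos_pos less_imp_neq[symmetric])
      next
        case False
        then have "p b < 0" "q b < 0"
          using y(1,3) z(1,3) b I(2) by (auto simp: face_def p_def q_def generic_def)
        then have "u * p b < 0" "w * q b < 0"
          using uw by (simp_all add: mult_pos_neg)
        then show ?thesis using False by (simp add: xc)
      qed
      have "P \<subseteq> I" using y(3) by (auto simp: face_def)
      then have "P = face c I x" using * by (auto simp: face_def)
      moreover have "x \<in> generic c (V \<inter> hyp c a) I"
        using xV * uw(4) xc[of a] by (auto simp: generic_def hyp_def)
      ultimately show "P \<in> regions c (V \<inter> hyp c a) I"
        by (auto simp: regions_def)
    qed
  qed
  have fin: "finite ?P" "finite ?N" using I by simp_all
  have "regions c V (insert a I) = ?P \<union> ?N" by blast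
  then have "card (regions c V (insert a I)) = card ?P + card ?N"
    using fin by (metis (no_types, lifting) card_Un_disjoint disjoint_iff mem_Collect_eq)
  also have "card ?P = card ?p"
    by (rule card_image[symmetric]) (auto simp: inj_on_def)
  also have "card ?p + card ?N = card (?p \<union> ?N) + card (?p \<inter> ?N)"
    using fin by (intro card_Un_Int) auto
  finally show ?thesis unfolding un int .
qed

text \<open>Both sides satisfy the deletion--restriction recursion.\<close>

theorem whitney_eq_card_regions:
  assumes "finite I" "affine V" "c \<in> V"
  shows "whitney c V I = int (card (regions c V I))"
  using assms
proof (induction I arbitrary: V)
  case empty
  then have "regions c V {} = {{}}" by (auto simp: regions_def face_def generic_def)
  then show ?case by (simp add: whitney_def)
next
  case (insert a I)
  then have "affine (V \<inter> hyp c a)" "c \<in> V \<inter> hyp c a"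
    by (auto intro: affine_Int)
  then show ?case
    using insert by (simp add: whitney_insert card_regions_insert regions_subset_hyp[of a])
qed

section \<open>Flats, ranks and the Moebius function in terms of normals\<close>

lemma flats_zeros:
  assumes "c \<in> V"
  shows "flats V ((\<lambda>a. V \<inter> hyp c a) ` I) = zeros c V ` Pow I"
proof -
  let ?h = "\<lambda>a. V \<inter> hyp c a"
  have *: "V \<inter> \<Inter>(?h ` J) = zeros c V J" for J
    by (auto simp: zeros_eq)
  have "{V \<inter> \<Inter>B | B. B \<subseteq> ?h ` I} = (\<lambda>B. V \<inter> \<Inter>B) ` Pow (?h ` I)"
    by auto
  also have "Pow (?h ` I) = (`) ?h ` Pow I"
    by (rule image_Pow_surj[OF HOL.refl, symmetric])
  also have "(\<lambda>B. V \<inter> \<Inter>B) ` (`) ?h ` Pow I = zeros c V ` Pow I"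
    unfolding image_image * ..
  finally have "flats V (?h ` I) = zeros c V ` Pow I - {{}}"
    unfolding flats_def by simp
  \<comment> \<open>All intersections contain \<open>c\<close>, so discarding the empty set in
    \<open>flats\<close> discards nothing.\<close>
  moreover have "{} \<noteq> zeros c V J" for J
    using center_in_zeros[OF assms, of J] by blast
  ultimately show ?thesis
    by (simp add: image_iff)
qed

lemma affine_psubset_aff_dim:
  "affine S \<Longrightarrow> affine T \<Longrightarrow> S \<subset> T \<Longrightarrow> aff_dim S < aff_dim T"
  using aff_dim_psubset[of S T] by (simp add: affine_hull_eq[THEN iffD2] hull_same)

lemma length_affine_chain:
  assumes "C \<noteq> []" "sorted_wrt (\<lambda>x y. y \<subset> x) C" "\<forall>x\<in>set C. affine x"
  shows "int (length C - 1) \<le> aff_dim (hd C) - aff_dim (last C)"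
  using assms
proof (induction C)
  case (Cons x C)
  show ?case
  proof (cases C)
    case (Cons y D)
    then have "aff_dim y < aff_dim x"
      using Cons.prems by (intro affine_psubset_aff_dim) auto
    then show ?thesis
      using Cons Cons.IH Cons.prems by simp
  qed simp
qed simp

text \<open>Imposing the normals of \<open>J\<close> one at a time lowers the dimension by at most
  one, so the strict steps form a chain whose length is the codimension. No chain is longer, by
  \<open>length_affine_chain\<close>.\<close>

lemma flat_rank_zeros:
  assumes V: "affine V" "c \<in> V" and I: "finite I" "J \<subseteq> I"
  shows "flat_rank V ((\<lambda>a. V \<inter> hyp c a) ` I) (zeros c V J) = nat (aff_dim V - aff_dim (zeros c V J))"
proof -
  let ?L = "flats V ((\<lambda>a. V \<inter> hyp c a) ` I)"
  let ?S = "\<lambda>J. {length C - 1 | C. C \<in> flags ?L \<and> C \<noteq> [] \<and> hd C = V \<and> last C = zeros c V J}"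
  have L: "?L = zeros c V ` Pow I" by (rule flats_zeros[OF V(2)])
  have "finite J" using I by (rule rev_finite_subset)
  then have "nat (aff_dim V - aff_dim (zeros c V J)) \<in> ?S J"
    using I(2)
  proof (induction J)
    case empty
    have "[V] \<in> flags ?L" unfolding L by (auto simp: flags_def intro!: image_eqI[of _ _ "{}"])
    then show ?case by (auto intro!: exI[of _ "[V]"])
  next
    case (insert a J)
    then obtain C where C: "nat (aff_dim V - aff_dim (zeros c V J)) = length C - 1" "C \<in> flags ?L" "C \<noteq> []"
        "hd C = V" "last C = zeros c V J"
      by auto
    have z: "zeros c V (insert a J) = zeros c V J \<inter> hyp c a"
      by (auto simp: zeros_def hyp_def)
    show ?case
    proof (cases "zeros c V J \<subseteq> hyp c a")
      case True
      then have "zeros c V (insert a J) = zeros c V J" unfolding z by blast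
      then show ?thesis using insert by auto
    next
      case False
      have dim: "aff_dim (zeros c V (insert a J)) = aff_dim (zeros c V J) - 1"
        unfolding z by (rule aff_dim_Int_hyp[OF affine_zeros[OF V(1)] center_in_zeros[OF V(2)] False])
      have le: "aff_dim (zeros c V J) \<le> aff_dim V"
        by (rule aff_dim_subset) (auto simp: zeros_def)
      define D where "D = C @ [zeros c V (insert a J)]"
      have "zeros c V J \<subseteq> x" if "x \<in> set C" for x
      proof -
        have "sorted_wrt (\<lambda>x y. y \<subset> x) (butlast C @ [last C])" "x \<in> set (butlast C @ [last C])"
          using C(2,3) that by (simp_all add: flags_def)
        then show ?thesis using C(5) by (auto simp: sorted_wrt_append)
      qed
      moreover have "zeros c V (insert a J) \<subset> zeros c V J"
        using False unfolding z by blast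
      moreover have "zeros c V (insert a J) \<in> ?L"
        unfolding L using insert.prems by blast
      ultimately have "D \<in> flags ?L"
        using C(2) unfolding flags_def D_def by (fastforce simp: sorted_wrt_append)
      moreover have "nat (aff_dim V - aff_dim (zeros c V (insert a J))) = length D - 1"
        using C(1,3) dim le by (simp add: D_def) (cases C, auto)
      ultimately show ?thesis
        using C by (auto simp: D_def intro!: exI[of _ D])
    qed
  qed
  moreover have "n \<le> nat (aff_dim V - aff_dim (zeros c V J))" if "n \<in> ?S J" for n
  proof -
    from that obtain C where C: "n = length C - 1" "C \<in> flags ?L" "C \<noteq> []" "hd C = V" "last C = zeros c V J"
      by auto
    have "\<forall>x\<in>set C. affine x"
      using C(2) unfolding flags_def L by (auto intro: affine_zeros V)
    then have "int n \<le> aff_dim V - aff_dim (zeros c V J)"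
      using length_affine_chain[OF C(3)] C by (auto simp: flags_def)
    then show ?thesis by linarith
  qed
  ultimately show ?thesis
    unfolding flat_rank_def by (rule cSup_eq_maximum)
qed

lemma sum_Pow_alternating:
  assumes "finite I" "I \<noteq> {}"
  shows "(\<Sum>J\<in>Pow I. (-1::int) ^ card J) = 0"
proof -
  obtain a where a: "a \<in> I" using assms(2) by blast
  define I' where "I' = I - {a}"
  have I': "finite I'" "a \<notin> I'" "I = insert a I'"
    using a assms(1) by (auto simp: I'_def)
  have "(-1::int) ^ card (insert a J) = - ((-1) ^ card J)" if "J \<in> Pow I'" for J
    using that I' by (subst card_insert_disjoint) (auto intro: finite_subset)
  then show ?thesis
    unfolding I'(3) sum_Pow_insert[OF I'(1,2)] by (simp add: sum_negf)
qed

text \<open>Rota's cross-cut argument: the right-hand side satisfies the recursion of the Moebius function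
  because the alternating sum over the subsets of a nonempty finite set is \<open>0\<close>.\<close>

lemma mobius_zeros:
  assumes I: "finite I" and nV: "\<And>a. a \<in> I \<Longrightarrow> \<not> V \<subseteq> hyp c a" and x: "x \<in> zeros c V ` Pow I"
  shows "mobius (zeros c V ` Pow I) V x = (\<Sum>J | J \<in> Pow I \<and> zeros c V J = x. (-1) ^ card J)"
    (is "_ = ?g x")
  using x
proof (induction "card {z \<in> zeros c V ` Pow I. x \<subset> z}" arbitrary: x rule: less_induct)
  case less
  let ?P = "zeros c V ` Pow I"
  have fin: "finite ?P" using I by simp
  have VP: "V \<in> ?P" by (rule image_eqI[of _ _ "{}"]) auto
  have sub: "zeros c V J \<subseteq> V" for J by (auto simp: zeros_def)
  then have xV: "x \<subseteq> V" using less.prems by auto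
  show ?case
  proof (cases "x = V")
    case True
    have "{J. J \<in> Pow I \<and> zeros c V J = V} = {{}}"
      using nV by (force simp: zeros_eq)
    then show ?thesis
      unfolding True by (subst mobius.simps) (use VP I in simp)
  next
    case False
    \<comment> \<open>The subsets of \<open>Ix\<close> are exactly the sets of normals whose flat
      contains \<open>x\<close>, so summing \<open>?g\<close> over the flats above \<open>x\<close>
      is a sum over \<open>Pow Ix\<close>.\<close>
    define Ix where "Ix = {a\<in>I. x \<subseteq> hyp c a}"
    obtain J where J: "J \<subseteq> I" "x = zeros c V J" using less.prems by auto
    then have "J \<noteq> {}" "J \<subseteq> Ix" using False by (auto simp: Ix_def zeros_eq)
    then have Ix: "finite Ix" "Ix \<noteq> {}" using I by (auto simp: Ix_def)
    have set_eq: "{z\<in>?P. x \<subset> z \<and> z \<subseteq> V} = {z\<in>?P. x \<subset> z}" using sub by auto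
    have "(\<Sum>z | z \<in> ?P \<and> x \<subset> z. mobius ?P V z) = (\<Sum>z | z \<in> ?P \<and> x \<subset> z. ?g z)"
    proof (rule sum.cong[OF HOL.refl])
      fix z assume z: "z \<in> {z. z \<in> ?P \<and> x \<subset> z}"
      then have "{w\<in>?P. z \<subset> w} \<subset> {w\<in>?P. x \<subset> w}" by blast
      then have "card {w\<in>?P. z \<subset> w} < card {w\<in>?P. x \<subset> w}"
        using fin by (simp add: psubset_card_mono)
      then show "mobius ?P V z = ?g z" using less.hyps[of z] z by simp
    qed
    also have "\<dots> = (\<Sum>z | z \<in> ?P \<and> x \<subseteq> z. ?g z) - ?g x"
    proof -
      have "{z. z \<in> ?P \<and> x \<subseteq> z} = insert x {z. z \<in> ?P \<and> x \<subset> z}" using less.prems by auto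
      then show ?thesis using fin by simp
    qed
    also have "(\<Sum>z | z \<in> ?P \<and> x \<subseteq> z. ?g z) = (\<Sum>J\<in>Pow Ix. (-1) ^ card J)"
    proof -
      have "(\<Sum>z | z \<in> ?P \<and> x \<subseteq> z. \<Sum>J | J \<in> Pow Ix \<and> zeros c V J = z. (-1::int) ^ card J)
          = (\<Sum>J\<in>Pow Ix. (-1) ^ card J)"
        by (rule sum.group) (use Ix(1) fin xV in \<open>auto simp: Ix_def zeros_eq\<close>)
      moreover have "{J. J \<in> Pow Ix \<and> zeros c V J = z} = {J. J \<in> Pow I \<and> zeros c V J = z}"
        if "x \<subseteq> z" for z
        using that by (auto simp: Ix_def zeros_eq)
      ultimately show ?thesis by simp
    qed
    also have "\<dots> = 0" by (rule sum_Pow_alternating[OF Ix])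
    finally show ?thesis
      by (subst mobius.simps) (use fin VP less.prems xV False in \<open>simp add: set_eq\<close>)
  qed
qed

text \<open>Zaslavsky's theorem for central arrangements. With rank equal to codimension, grouping
  the sets of normals by their flat turns the cross-cut formula for the Moebius function into
  \<open>whitney\<close>. Several normals may cut \<open>V\<close> in the same hyperplane.\<close>

theorem poincare_poly_at_1:
  assumes V: "affine V" "c \<in> V" and I: "finite I" and nV: "\<And>a. a \<in> I \<Longrightarrow> \<not> V \<subseteq> hyp c a"
  shows "poly (poincare_poly V ((\<lambda>a. V \<inter> hyp c a) ` I)) 1 = of_nat (card (regions c V I))"
proof -
  let ?A = "(\<lambda>a. V \<inter> hyp c a) ` I" and ?P = "zeros c V ` Pow I"
  let ?cd = "\<lambda>x. nat (aff_dim V - aff_dim x)"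
  have "poly (poincare_poly V ?A) 1 = (\<Sum>x\<in>?P. of_int (mobius ?P V x) * (-1) ^ flat_rank V ?A x)"
    unfolding poincare_poly_def poly_sum flats_zeros[OF V(2)] by simp
  also have "\<dots> = of_int (\<Sum>x\<in>?P. mobius ?P V x * (-1) ^ ?cd x)"
    unfolding of_int_sum using flat_rank_zeros[OF V I] by (intro sum.cong) auto
  also have "(\<Sum>x\<in>?P. mobius ?P V x * (-1) ^ ?cd x)
      = (\<Sum>x\<in>?P. \<Sum>J | J \<in> Pow I \<and> zeros c V J = x. (-1) ^ (card J + ?cd (zeros c V J)))"
    using mobius_zeros[OF I nV] by (intro sum.cong) (simp_all add: sum_distrib_right power_add)
  also have "\<dots> = whitney c V I"
    unfolding whitney_def by (rule sum.group) (use I in auto)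
  also have "\<dots> = int (card (regions c V I))"
    by (rule whitney_eq_card_regions[OF I V])
  finally show ?thesis by simp
qed

section \<open>Weighted sums over flags\<close>

fun flag_weight :: "('b \<Rightarrow> 'b \<Rightarrow> 'c::comm_monoid_mult) \<Rightarrow> 'b \<Rightarrow> 'b \<Rightarrow> 'b list \<Rightarrow> 'c" where
  "flag_weight g e x [] = g x e"
| "flag_weight g e x (y # F) = g x y * flag_weight g e y F"

lemma prod_consecutive:
  "(\<Prod>k\<le>length F. g ((x # F @ [e]) ! k) ((x # F @ [e]) ! Suc k)) = flag_weight g e x F"
proof (induction F arbitrary: x)
  case (Cons y F)
  show ?case
    by (simp add: prod.atMost_Suc_shift Cons.IH[symmetric] del: prod.atMost_Suc)
qed simp

definition flags_below :: "'a set set \<Rightarrow> nat \<Rightarrow> 'a set \<Rightarrow> 'a set list set" where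
  "flags_below P l x = {F \<in> flags P. length F = l \<and> (\<forall>y\<in>set F. y \<subset> x)}"

lemma flags_below_0 [simp]: "flags_below P 0 x = {[]}"
  by (auto simp: flags_below_def flags_def)

lemma flags_below_Suc:
  "flags_below P (Suc l) x = (\<Union>y\<in>{y\<in>P. y \<subset> x}. (#) y ` flags_below P l y)"
proof (intro equalityI subsetI)
  fix F assume "F \<in> flags_below P (Suc l) x"
  then show "F \<in> (\<Union>y\<in>{y\<in>P. y \<subset> x}. (#) y ` flags_below P l y)"
    by (cases F) (auto simp: flags_below_def flags_def)
next
  fix F assume "F \<in> (\<Union>y\<in>{y\<in>P. y \<subset> x}. (#) y ` flags_below P l y)"
  then show "F \<in> flags_below P (Suc l) x"
    by (fastforce simp: flags_below_def flags_def)
qed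

lemma finite_flags_below [simp]: "finite P \<Longrightarrow> finite (flags_below P l x)"
  by (induction l arbitrary: x) (auto simp: flags_below_Suc)

lemma sum_flags_below_Suc:
  assumes "finite P"
  shows "(\<Sum>F\<in>flags_below P (Suc l) x. f F) = (\<Sum>y | y \<in> P \<and> y \<subset> x. \<Sum>F\<in>flags_below P l y. f (y # F))"
proof -
  have "(\<Sum>F\<in>flags_below P (Suc l) x. f F) = (\<Sum>y\<in>{y\<in>P. y \<subset> x}. \<Sum>F\<in>(#) y ` flags_below P l y. f F)"
    unfolding flags_below_Suc by (rule sum.UNION_disjoint) (use assms in auto)
  also have "\<dots> = (\<Sum>y | y \<in> P \<and> y \<subset> x. \<Sum>F\<in>flags_below P l y. f (y # F))"
    by (intro sum.cong[OF HOL.refl], subst sum.reindex) (auto simp: inj_on_def)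
  finally show ?thesis .
qed

text \<open>\<open>chain_count m l n\<close> counts the chains of \<open>l\<close> proper subsets of an \<open>n\<close>-element set, all with at
  least \<open>m\<close> elements.\<close>

fun chain_count :: "nat \<Rightarrow> nat \<Rightarrow> nat \<Rightarrow> nat" where
  "chain_count m 0 n = 1"
| "chain_count m (Suc l) n = (\<Sum>i=m..<n. (n choose i) * chain_count m l i)"

text \<open>Removing the largest member \<open>y\<close> leaves a flag below \<open>y\<close>, and
  by induction these flags contribute a multiple of \<open>N y\<close>. After grouping by
  \<open>n y\<close>, the hypothesis \<open>step\<close> trades \<open>N y\<close> for
  \<open>N x\<close>, so that only binomial coefficients accumulate. It serves for flats, with
  \<open>N\<close> the number of faces, and with all weights 1 for subsets of a finite set.\<close>

lemma sum_flag_weight: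
  fixes g :: "'a set \<Rightarrow> 'a set \<Rightarrow> 'c::comm_semiring_1" and N :: "'a set \<Rightarrow> 'c"
  assumes P: "finite P" "P \<subseteq> Q"
    and last: "\<And>x. x \<in> Q \<Longrightarrow> g x e = N x"
    and rank: "\<And>x y. x \<in> Q \<Longrightarrow> y \<in> P \<Longrightarrow> y \<subset> x \<Longrightarrow> m \<le> n y \<and> n y < n x"
    and step: "\<And>x i. x \<in> Q \<Longrightarrow> m \<le> i \<Longrightarrow> i < n x \<Longrightarrow>
      (\<Sum>y | y \<in> P \<and> y \<subset> x \<and> n y = i. g x y * N y) = of_nat (n x choose i) * N x"
    and x: "x \<in> Q"
  shows "(\<Sum>F\<in>flags_below P l x. flag_weight g e x F) = of_nat (chain_count m l (n x)) * N x"
  using x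
proof (induction l arbitrary: x)
  case 0
  then show ?case by (simp add: last)
next
  case (Suc l)
  have "(\<Sum>F\<in>flags_below P (Suc l) x. flag_weight g e x F)
      = (\<Sum>y | y \<in> P \<and> y \<subset> x. g x y * (\<Sum>F\<in>flags_below P l y. flag_weight g e y F))"
    by (simp add: sum_flags_below_Suc P(1) sum_distrib_left)
  also have "\<dots> = (\<Sum>y | y \<in> P \<and> y \<subset> x. of_nat (chain_count m l (n y)) * (g x y * N y))"
    using Suc.IH P(2) by (intro sum.cong[OF HOL.refl]) (auto simp: ac_simps subset_iff)
  also have "\<dots> = (\<Sum>i=m..<n x. \<Sum>y | y \<in> {y\<in>P. y \<subset> x} \<and> n y = i.
      of_nat (chain_count m l (n y)) * (g x y * N y))"
    by (rule sum.group[symmetric]) (use P(1) rank[OF Suc.prems] in \<open>simp_all add: image_subset_iff\<close>)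
  also have "\<dots> = (\<Sum>i=m..<n x. of_nat (chain_count m l i) * (of_nat (n x choose i) * N x))"
  proof (rule sum.cong[OF HOL.refl])
    fix i assume i: "i \<in> {m..<n x}"
    have "(\<Sum>y | y \<in> {y\<in>P. y \<subset> x} \<and> n y = i. of_nat (chain_count m l (n y)) * (g x y * N y))
        = of_nat (chain_count m l i) * (\<Sum>y | y \<in> P \<and> y \<subset> x \<and> n y = i. g x y * N y)"
      unfolding sum_distrib_left by (rule sum.cong) auto
    then show "(\<Sum>y | y \<in> {y\<in>P. y \<subset> x} \<and> n y = i. of_nat (chain_count m l (n y)) * (g x y * N y))
        = of_nat (chain_count m l i) * (of_nat (n x choose i) * N x)"
      using step[OF Suc.prems] i by simp
  qed
  also have "\<dots> = of_nat (chain_count m (Suc l) (n x)) * N x"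
    by (simp add: sum_distrib_left sum_distrib_right mult.assoc mult.left_commute)
  finally show ?case .
qed


section \<open>Faces of a central arrangement\<close>

text \<open>As the set of normals is symmetric, a face is determined by the normals that are positive on
  it, and inclusion of these sets of normals is the order of faces.\<close>

locale central_arrangement =
  fixes c :: "'a::euclidean_space" and \<Phi> :: "'a set"
  assumes finite_normals: "finite \<Phi>"
    and uminus_normal: "a \<in> \<Phi> \<Longrightarrow> -a \<in> \<Phi>"
    and zero_not_normal: "0 \<notin> \<Phi>"
begin

abbreviation "hyps \<equiv> hyp c ` \<Phi>"

definition "L = zeros c UNIV ` Pow \<Phi>"

definition "nonvanishing x = {a\<in>\<Phi>. \<not> x \<subseteq> hyp c a}"

text \<open>The faces whose affine span is the flat \<open>x\<close>: they are the regions of the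
  arrangement induced on \<open>x\<close>.\<close>

definition "faces x = regions c x (nonvanishing x)"

text \<open>A normal vanishes on a face precisely if neither it nor its negative is positive there;
  hence this is the span of the face with positive set \<open>Q\<close>.\<close>

definition "flat_of Q = zeros c UNIV {a\<in>\<Phi>. a \<notin> Q \<and> -a \<notin> Q}"

text \<open>Dimension modulo the common intersection of all hyperplanes. For the ambient space it is
  the rank of the arrangement, and for the span of a face of a simplicial cone it is the number of
  generating rays.\<close>

definition dim0 :: "'a set \<Rightarrow> nat" where
  "dim0 x = nat (aff_dim x - aff_dim (zeros c UNIV \<Phi>))"

lemma hyps_eq: "hyps = (\<lambda>a. UNIV \<inter> hyp c a) ` \<Phi>"
  by simp

lemma flats_hyps: "flats UNIV hyps = L"
  unfolding hyps_eq L_def by (rule flats_zeros) simp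

lemma finite_L [simp]: "finite L"
  by (simp add: L_def finite_normals)

lemma affine_L: "x \<in> L \<Longrightarrow> affine x"
  by (auto simp: L_def intro: affine_zeros)

lemma center_L: "x \<in> L \<Longrightarrow> c \<in> x"
  by (auto simp: L_def intro: center_in_zeros)

lemma UNIV_L: "UNIV \<in> L"
  unfolding L_def by (rule image_eqI[of _ _ "{}"]) auto

lemma finite_nonvanishing [simp]: "finite (nonvanishing x)"
  by (simp add: nonvanishing_def finite_normals)

lemma finite_faces [simp]: "finite (faces x)"
  by (simp add: faces_def)

lemma L_eq_zeros: "x \<in> L \<Longrightarrow> x = zeros c UNIV {a\<in>\<Phi>. x \<subseteq> hyp c a}"
  by (auto simp: L_def zeros_def hyp_def)

lemma zeros_in_L: "J \<subseteq> \<Phi> \<Longrightarrow> zeros c UNIV J \<in> L"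
  by (auto simp: L_def)

lemma hyp_uminus [simp]: "hyp c (-a) = hyp c a"
  by (simp add: hyp_def)

lemma face_nonvanishing: "s \<in> x \<Longrightarrow> face c (nonvanishing x) s = face c \<Phi> s"
  by (auto simp: face_def nonvanishing_def hyp_def)

lemma face_in_faces: "face c \<Phi> s \<in> faces (flat_of (face c \<Phi> s))"
proof -
  let ?x = "flat_of (face c \<Phi> s)"
  have s: "s \<in> ?x"
    using uminus_normal by (auto simp: flat_of_def zeros_def face_def)
  have "a \<bullet> (s - c) \<noteq> 0" if "a \<in> nonvanishing ?x" for a
  proof
    assume "a \<bullet> (s - c) = 0"
    then have "?x \<subseteq> hyp c a"
      using that by (auto simp: nonvanishing_def flat_of_def zeros_def hyp_def face_def)
    then show False using that by (simp add: nonvanishing_def)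
  qed
  then have "s \<in> generic c ?x (nonvanishing ?x)"
    using s by (simp add: generic_def)
  then show ?thesis
    using face_nonvanishing[OF s] unfolding faces_def regions_def by force
qed

lemma flat_of_in_L: "flat_of Q \<in> L"
  unfolding flat_of_def by (rule zeros_in_L) auto

text \<open>With \<open>face_in_faces\<close> this shows that the sets \<open>faces x\<close>, for
  \<open>x\<close> in \<open>L\<close>, partition the set of all faces.\<close>

lemma flat_of_face:
  assumes x: "x \<in> L" and Q: "Q \<in> faces x"
  shows "flat_of Q = x" "\<exists>s\<in>x. Q = face c \<Phi> s"
proof -
  obtain s where s: "s \<in> generic c x (nonvanishing x)" "Q = face c (nonvanishing x) s"
    using Q by (auto simp: faces_def regions_def)
  then have sx: "s \<in> x" by (simp add: generic_def)
  show "\<exists>s\<in>x. Q = face c \<Phi> s"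
    using s(2) sx face_nonvanishing[OF sx] by auto
  have "{a\<in>\<Phi>. a \<notin> Q \<and> -a \<notin> Q} = {a\<in>\<Phi>. x \<subseteq> hyp c a}"
  proof (intro Collect_cong conj_cong HOL.refl)
    fix a assume a: "a \<in> \<Phi>"
    show "(a \<notin> Q \<and> -a \<notin> Q) = (x \<subseteq> hyp c a)"
    proof
      assume "a \<notin> Q \<and> -a \<notin> Q"
      then have "a \<bullet> (s - c) = 0"
        using a uminus_normal[OF a] unfolding s(2) face_nonvanishing[OF sx] by (auto simp: face_def)
      then show "x \<subseteq> hyp c a"
        using s(1) a by (auto simp: generic_def nonvanishing_def)
    next
      assume "x \<subseteq> hyp c a"
      then show "a \<notin> Q \<and> -a \<notin> Q"
        unfolding s(2) by (auto simp: face_def nonvanishing_def)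
    qed
  qed
  then show "flat_of Q = x"
    using L_eq_zeros[OF x] by (simp add: flat_of_def)
qed

lemma restriction_localization:
  assumes x: "x \<in> L"
  shows "restriction (localization hyps y) x = (\<lambda>a. x \<inter> hyp c a) ` {a\<in>nonvanishing x. y \<subseteq> hyp c a}"
proof -
  have "(x \<inter> hyp c a = {}) = False" for a
    using center_L[OF x] center_in_hyp[of c a] by blast
  then show ?thesis
    by (auto simp: restriction_def localization_def nonvanishing_def)
qed

text \<open>The value at Y = 1 of the factor of \<open>flag_poly\<close> for the pair
  \<open>x\<close>, \<open>y\<close>. For \<open>y = {}\<close> the condition on the normals is
  void, which matches the formal symbol at the end of a flag.\<close>

definition "weight x y = card (regions c x {a\<in>nonvanishing x. y \<subseteq> hyp c a})"

lemma poincare_restriction: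
  assumes x: "x \<in> L"
  shows "poly (poincare_poly x (restriction (localization hyps y) x)) 1 = of_nat (weight x y)"
  unfolding restriction_localization[OF x] weight_def
  by (rule poincare_poly_at_1) (use x in \<open>auto simp: affine_L center_L nonvanishing_def finite_normals\<close>)

lemma weight_empty: "weight x {} = card (faces x)"
  by (simp add: weight_def faces_def)

lemma flag_poly_at_1:
  assumes "set F \<subseteq> L"
  shows "poly (flag_poly UNIV hyps F) 1 = flag_weight (\<lambda>x y. of_nat (weight x y)) {} UNIV F"
proof -
  have "(UNIV # F @ [{}]) ! k \<in> L" if "k \<le> length F" for k
    using that assms UNIV_L by (cases k) (auto simp: nth_append)
  then show ?thesis
    unfolding flag_poly_def Let_def poly_prod
    by (simp add: poincare_restriction prod_consecutive[symmetric] del: nth_Cons_Suc flag_weight.simps)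
qed

lemma nonvanishing_UNIV: "nonvanishing UNIV = \<Phi>"
proof -
  have "\<not> UNIV \<subseteq> hyp c a" if "a \<in> \<Phi>" for a
  proof
    assume "UNIV \<subseteq> hyp c a"
    then have "c + a \<in> hyp c a" by blast
    then show False using that zero_not_normal by (simp add: hyp_def)
  qed
  then show ?thesis by (auto simp: nonvanishing_def)
qed

lemma poincare_at_1: "poly (poincare_poly UNIV hyps) 1 = of_nat (card (faces UNIV))"
proof -
  have "restriction (localization hyps {}) UNIV = hyps"
    by (simp add: restriction_localization[OF UNIV_L] nonvanishing_UNIV)
  then have "flag_poly UNIV hyps [] = poincare_poly UNIV hyps"
    by (simp add: flag_poly_def)
  then show ?thesis
    using flag_poly_at_1[of "[]"] by (simp add: weight_empty)
qed

text \<open>Near a face \<open>Q\<close> spanning \<open>y\<close> only the hyperplanes through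
  \<open>y\<close> separate points. A face \<open>P\<close> above \<open>Q\<close> is recovered from
  its normals vanishing on \<open>y\<close> by adding \<open>Q\<close>, since all other signs are
  those on \<open>Q\<close>. Conversely, every sign pattern of the vanishing normals arises by
  pushing a point of \<open>Q\<close>.\<close>

lemma card_faces_above:
  assumes x: "x \<in> L" and y: "y \<in> L" "y \<subseteq> x" and Q: "Q \<in> faces y"
  shows "card {P\<in>faces x. Q \<subseteq> P} = weight x y"
proof -
  let ?I = "{a\<in>nonvanishing x. y \<subseteq> hyp c a}"
  let ?f = "\<lambda>P. {a\<in>P. y \<subseteq> hyp c a}"
  obtain t where t: "t \<in> generic c y (nonvanishing y)" "Q = face c (nonvanishing y) t"
    using Q by (auto simp: faces_def regions_def)
  have ty: "t \<in> y" using t by (simp add: generic_def)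
  then have tx: "t \<in> x" using y by blast
  have Q': "Q = face c \<Phi> t" using t face_nonvanishing[OF ty] by simp
  have Qy: "\<not> y \<subseteq> hyp c a" if "a \<in> Q" for a
    using that t by (auto simp: face_def nonvanishing_def)
  have t0: "y \<subseteq> hyp c a" if "a \<in> \<Phi>" "a \<bullet> (t - c) = 0" for a
    using that t by (auto simp: generic_def nonvanishing_def)
  have inj: "inj_on ?f {P\<in>faces x. Q \<subseteq> P}"
  proof (rule inj_on_inverseI)
    fix P assume "P \<in> {P\<in>faces x. Q \<subseteq> P}"
    then obtain s where s: "s \<in> x" "P = face c \<Phi> s" "Q \<subseteq> P"
      using flat_of_face(2)[OF x] by blast
    have "a \<in> Q" if a: "a \<in> P" "\<not> y \<subseteq> hyp c a" for a
    proof (rule ccontr)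
      assume "a \<notin> Q"
      moreover have "a \<in> \<Phi>" using a s by (simp add: face_def)
      ultimately have "-a \<in> Q"
        using t0[of a] a(2) uminus_normal[of a] by (auto simp: Q' face_def)
      then have "-a \<in> P" using s by blast
      then show False using a(1) s(2) by (simp add: face_def)
    qed
    then show "?f P \<union> Q = P" using s(3) by blast
  qed
  have "?f ` {P\<in>faces x. Q \<subseteq> P} = regions c x ?I"
  proof (intro equalityI subsetI)
    fix R assume "R \<in> ?f ` {P\<in>faces x. Q \<subseteq> P}"
    then obtain s where s: "s \<in> generic c x (nonvanishing x)" "R = ?f (face c (nonvanishing x) s)"
      by (auto simp: faces_def regions_def)
    then have "R = face c ?I s" "s \<in> generic c x ?I"
      by (auto simp: face_def generic_def)
    then show "R \<in> regions c x ?I" by (simp add: regions_def)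
  next
    fix R assume "R \<in> regions c x ?I"
    then obtain q where q: "q \<in> generic c x ?I" "R = face c ?I q"
      by (auto simp: regions_def)
    obtain z where z: "z \<in> x"
      "\<And>a. a \<in> \<Phi> \<Longrightarrow> a \<bullet> (t - c) \<noteq> 0 \<Longrightarrow> sgn (a \<bullet> (z - c)) = sgn (a \<bullet> (t - c))"
      "\<And>a. a \<in> \<Phi> \<Longrightarrow> a \<bullet> (t - c) = 0 \<Longrightarrow> sgn (a \<bullet> (z - c)) = sgn (a \<bullet> (q - c))"
      using perturbation[OF affine_L[OF x] center_L[OF x] tx, of q \<Phi>] q(1) finite_normals
      by (auto simp: generic_def)
    have "a \<bullet> (z - c) \<noteq> 0" if a: "a \<in> nonvanishing x" for a
    proof (cases "a \<bullet> (t - c) = 0")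
      case True
      have "a \<in> \<Phi>" using a by (simp add: nonvanishing_def)
      with True have "a \<in> ?I" using a t0 by blast
      then have "a \<bullet> (q - c) \<noteq> 0" using q(1) by (simp add: generic_def)
      then show ?thesis using z(3)[OF \<open>a \<in> \<Phi>\<close> True] by (metis sgn_eq_0_iff)
    next
      case False
      have "a \<in> \<Phi>" using a by (simp add: nonvanishing_def)
      then show ?thesis using z(2)[OF _ False] False by (metis sgn_eq_0_iff)
    qed
    then have "z \<in> generic c x (nonvanishing x)"
      using z(1) by (simp add: generic_def)
    then have P: "face c (nonvanishing x) z \<in> faces x"
      by (simp add: faces_def regions_def)
    have QP: "Q \<subseteq> face c (nonvanishing x) z"
      unfolding face_nonvanishing[OF z(1)] Q'
    proof
      fix a assume "a \<in> face c \<Phi> t"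
      then show "a \<in> face c \<Phi> z"
        using z(2)[of a] by (auto simp: face_def sgn_if split: if_splits)
    qed
    have "a \<bullet> (z - c) > 0 \<longleftrightarrow> a \<bullet> (q - c) > 0" if a: "a \<in> ?I" for a
    proof -
      have "a \<in> \<Phi>" "a \<bullet> (t - c) = 0"
        using a ty by (auto simp: nonvanishing_def hyp_def)
      then show ?thesis
        using z(3)[of a] by (auto simp: sgn_if split: if_splits)
    qed
    then have "R = ?f (face c (nonvanishing x) z)"
      by (auto simp: q(2) face_def)
    then show "R \<in> ?f ` {P\<in>faces x. Q \<subseteq> P}" using P QP by blast
  qed
  then show ?thesis
    unfolding weight_def using card_image[OF inj] by simp
qed

section \<open>Dimensions of flats and double counting of nested faces\<close>

lemma affine_zeros_normals: "affine (zeros c UNIV \<Phi>)" "zeros c UNIV \<Phi> \<in> L"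
  by (auto intro: affine_zeros zeros_in_L)

lemma bottom_subset_L: "x \<in> L \<Longrightarrow> zeros c UNIV \<Phi> \<subseteq> x"
  by (auto simp: L_def zeros_def)

lemma dim0_mono: "x \<in> L \<Longrightarrow> y \<in> L \<Longrightarrow> y \<subset> x \<Longrightarrow> dim0 y < dim0 x"
  using affine_psubset_aff_dim[of y x] aff_dim_subset[OF bottom_subset_L, of y]
  by (simp add: dim0_def affine_L)

lemma dim0_eq_0: "x \<in> L \<Longrightarrow> dim0 x = 0 \<longleftrightarrow> x = zeros c UNIV \<Phi>"
  using dim0_mono[of x "zeros c UNIV \<Phi>"] bottom_subset_L[of x] affine_zeros_normals
  by (cases "x = zeros c UNIV \<Phi>") (simp_all add: psubset_eq dim0_def[of "zeros c UNIV \<Phi>"])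

text \<open>Double counting of the pairs of a face \<open>P\<close> spanning \<open>x\<close> and a
  face \<open>Q\<close> below it of dimension \<open>i\<close>: by the span of \<open>Q\<close> this
  gives the left side, by \<open>P\<close> the right side.\<close>

lemma sum_weight_faces:
  assumes x: "x \<in> L" and i: "i < dim0 x"
    and simplicial: "\<And>P. P \<in> faces x \<Longrightarrow>
      card {Q \<in> range (face c \<Phi>). Q \<subseteq> P \<and> dim0 (flat_of Q) = i} = dim0 x choose i"
  shows "(\<Sum>y | y \<in> L \<and> y \<subset> x \<and> dim0 y = i. weight x y * card (faces y)) = (dim0 x choose i) * card (faces x)"
proof -
  let ?Y = "{y. y \<in> L \<and> y \<subset> x \<and> dim0 y = i}"
  have "(\<Sum>y\<in>?Y. weight x y * card (faces y)) = (\<Sum>y\<in>?Y. \<Sum>Q\<in>faces y. card {P\<in>faces x. Q \<subseteq> P})"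
  proof (rule sum.cong[OF HOL.refl])
    fix y assume "y \<in> ?Y"
    then have "card {P\<in>faces x. Q \<subseteq> P} = weight x y" if "Q \<in> faces y" for Q
      using that x by (intro card_faces_above) auto
    then show "weight x y * card (faces y) = (\<Sum>Q\<in>faces y. card {P\<in>faces x. Q \<subseteq> P})"
      by simp
  qed
  also have "\<dots> = (\<Sum>y\<in>?Y. \<Sum>P\<in>faces x. card {Q\<in>faces y. Q \<subseteq> P})"
    by (intro sum.cong[OF HOL.refl] sum_multicount_gen) auto
  also have "\<dots> = (\<Sum>P\<in>faces x. \<Sum>y\<in>?Y. card {Q\<in>faces y. Q \<subseteq> P})"
    by (rule sum.swap)
  also have "\<dots> = (\<Sum>P\<in>faces x. dim0 x choose i)"
  proof (rule sum.cong[OF HOL.refl])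
    fix P assume P: "P \<in> faces x"
    have "(\<Sum>y\<in>?Y. card {Q\<in>faces y. Q \<subseteq> P}) = card (\<Union>y\<in>?Y. {Q\<in>faces y. Q \<subseteq> P})"
    proof (rule card_UN_disjoint[symmetric])
      show "\<forall>y\<in>?Y. \<forall>z\<in>?Y. y \<noteq> z \<longrightarrow> {Q\<in>faces y. Q \<subseteq> P} \<inter> {Q\<in>faces z. Q \<subseteq> P} = {}"
        using flat_of_face(1) by blast
    qed auto
    also have "(\<Union>y\<in>?Y. {Q\<in>faces y. Q \<subseteq> P}) = {Q \<in> range (face c \<Phi>). Q \<subseteq> P \<and> dim0 (flat_of Q) = i}"
    proof (intro equalityI subsetI)
      fix Q assume "Q \<in> (\<Union>y\<in>?Y. {Q\<in>faces y. Q \<subseteq> P})"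
      then obtain y where "y \<in> L" "dim0 y = i" "Q \<in> faces y" "Q \<subseteq> P" by blast
      then show "Q \<in> {Q \<in> range (face c \<Phi>). Q \<subseteq> P \<and> dim0 (flat_of Q) = i}"
        using flat_of_face[of y Q] by auto
    next
      fix Q assume Q: "Q \<in> {Q \<in> range (face c \<Phi>). Q \<subseteq> P \<and> dim0 (flat_of Q) = i}"
      \<comment> \<open>Fewer positive normals mean more vanishing ones, hence a smaller span; it is
        strictly smaller because \<open>i < dim0 x\<close>.\<close>
      then have "flat_of Q \<subseteq> flat_of P" by (auto simp: flat_of_def zeros_def)
      then have "flat_of Q \<subset> x"
        using flat_of_face(1)[OF x P] Q i by auto
      then show "Q \<in> (\<Union>y\<in>?Y. {Q\<in>faces y. Q \<subseteq> P})"
        using Q face_in_faces flat_of_in_L by auto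
    qed
    finally show "(\<Sum>y\<in>?Y. card {Q\<in>faces y. Q \<subseteq> P}) = dim0 x choose i"
      using simplicial[OF P] by simp
  qed
  finally show ?thesis by (simp add: mult.commute)
qed

text \<open>The case \<open>m = 0\<close> admits the smallest flat, as the flag series does;
  \<open>m = 1\<close> excludes it, as the sum over proper flats does. The ambient space is kept out
  by \<open>flags_below\<close>.\<close>

theorem sum_flag_poly_at_1:
  assumes simplicial: "\<And>P i. P \<in> range (face c \<Phi>) \<Longrightarrow>
      card {Q \<in> range (face c \<Phi>). Q \<subseteq> P \<and> dim0 (flat_of Q) = i} = dim0 (flat_of P) choose i"
  shows "(\<Sum>F\<in>flags_below {x\<in>L. m \<le> dim0 x} l UNIV. poly (flag_poly UNIV hyps F) 1)
    = of_nat (chain_count m l (dim0 UNIV)) * poly (poincare_poly UNIV hyps) 1"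
proof -
  let ?P = "{x\<in>L. m \<le> dim0 x}"
  have step: "(\<Sum>y | y \<in> ?P \<and> y \<subset> x \<and> dim0 y = i. (of_nat (weight x y) :: rat) * of_nat (card (faces y)))
      = of_nat (dim0 x choose i) * of_nat (card (faces x))" if x: "x \<in> L" and i: "m \<le> i" "i < dim0 x" for x i
  proof -
    have "{y. y \<in> ?P \<and> y \<subset> x \<and> dim0 y = i} = {y. y \<in> L \<and> y \<subset> x \<and> dim0 y = i}"
      using i by auto
    moreover have "card {Q \<in> range (face c \<Phi>). Q \<subseteq> P \<and> dim0 (flat_of Q) = i} = dim0 x choose i"
      if P: "P \<in> faces x" for P
      using simplicial[of P i] flat_of_face[OF x P] by auto
    ultimately show ?thesis
      using sum_weight_faces[OF x i(2)] by (simp flip: of_nat_mult of_nat_sum)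
  qed
  have "(\<Sum>F\<in>flags_below ?P l UNIV. poly (flag_poly UNIV hyps F) 1)
      = (\<Sum>F\<in>flags_below ?P l UNIV. flag_weight (\<lambda>x y. of_nat (weight x y)) {} UNIV F)"
    by (intro sum.cong[OF HOL.refl] flag_poly_at_1) (auto simp: flags_below_def flags_def)
  also have "\<dots> = of_nat (chain_count m l (dim0 UNIV)) * of_nat (card (faces UNIV))"
    by (rule sum_flag_weight[where Q = L and n = dim0 and N = "\<lambda>x. of_nat (card (faces x))"])
      (use step in \<open>simp_all add: weight_empty dim0_mono UNIV_L\<close>)
  finally show ?thesis by (simp add: poincare_at_1)
qed

end

section \<open>Simple systems\<close>

lemma convex_cone_hull_insertE:
  assumes "w \<in> convex_cone hull (insert a D)"
  obtains k v where "0 \<le> k" "v \<in> convex_cone hull D" "w = k *\<^sub>R a + v"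
proof -
  have "insert a D = {a} \<union> D" by simp
  then obtain u v where uv: "u \<in> convex_cone hull {a}" "v \<in> convex_cone hull D" "w = u + v"
    using assms convex_cone_hull_Un[of "{a}" D] by auto
  from uv(1) obtain k where "0 \<le> k" "u = k *\<^sub>R a"
    unfolding convex_cone_hull_convex_hull by (auto intro: that[of 0])
  then show thesis using uv that by blast
qed

text \<open>Moving the negative coefficients of a linear relation to the other side writes one
  vector \<open>p\<close> as two nonnegative combinations without a common generator. Obtuse angles
  give p \<bullet> p \<le> 0, so both combinations vanish, and pairing them with \<open>x\<close>
  makes every coefficient zero.\<close>

lemma obtuse_independent:
  fixes D :: "'a::euclidean_space set"
  assumes D: "finite D" and pos: "\<And>d. d \<in> D \<Longrightarrow> d \<bullet> x > 0"
    and obtuse: "\<And>d e. d \<in> D \<Longrightarrow> e \<in> D \<Longrightarrow> d \<noteq> e \<Longrightarrow> d \<bullet> e \<le> 0"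
  shows "independent D"
proof
  assume "dependent D"
  then obtain u where u: "\<exists>v\<in>D. u v \<noteq> 0" "(\<Sum>v\<in>D. u v *\<^sub>R v) = 0"
    using dependent_finite[OF D] by blast
  define p where "p = (\<Sum>d\<in>D. max 0 (u d) *\<^sub>R d)"
  have "(\<Sum>d\<in>D. max 0 (u d) *\<^sub>R d) - (\<Sum>d\<in>D. max 0 (- u d) *\<^sub>R d) = (\<Sum>d\<in>D. u d *\<^sub>R d)"
    unfolding sum_subtractf[symmetric] by (intro sum.cong) (auto simp: max_def)
  then have p': "p = (\<Sum>d\<in>D. max 0 (- u d) *\<^sub>R d)"
    using u(2) by (simp add: p_def)
  have "p \<bullet> p = (\<Sum>d\<in>D. \<Sum>e\<in>D. max 0 (- u d) * max 0 (u e) * (d \<bullet> e))"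
    by (subst p', subst p_def) (simp add: inner_sum_left inner_sum_right sum_distrib_left mult.assoc inner_commute)
  also have "\<dots> \<le> 0"
  proof (intro sum_nonpos)
    fix d e assume "d \<in> D" "e \<in> D"
    then show "max 0 (- u d) * max 0 (u e) * (d \<bullet> e) \<le> 0"
      using obtuse[of d e] by (cases "d = e") (auto simp: max_def mult_nonneg_nonpos)
  qed
  finally have p0: "p = 0" by (metis inner_ge_zero inner_eq_zero_iff order_antisym)
  have zero: "f d = 0" if f: "(\<Sum>d\<in>D. f d *\<^sub>R d) = 0" "\<And>d. 0 \<le> f d" "d \<in> D" for f d
  proof -
    have "(\<Sum>d\<in>D. f d * (d \<bullet> x)) = 0"
      using arg_cong[OF f(1), of "\<lambda>v. v \<bullet> x"] by (simp add: inner_sum_left)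
    moreover have "0 \<le> f d * (d \<bullet> x)" if "d \<in> D" for d
      using f(2)[of d] pos[OF that] by simp
    ultimately have "f d * (d \<bullet> x) = 0"
      using sum_nonneg_eq_0_iff[OF D, of "\<lambda>d. f d * (d \<bullet> x)"] f(3) by blast
    then show ?thesis using pos[OF f(3)] by simp
  qed
  obtain v where v: "v \<in> D" "u v \<noteq> 0" using u(1) by blast
  have "max 0 (u v) = 0"
    using zero[of "\<lambda>d. max 0 (u d)" v] p0 v by (simp add: p_def)
  moreover have "max 0 (- u v) = 0"
    using zero[of "\<lambda>d. max 0 (- u d)" v] p0 v by (simp add: p')
  ultimately show False using v(2) by (simp add: max_def split: if_splits)
qed

text \<open>A generating set of minimal size consists of vectors with pairwise obtuse angles: otherwise
  the reflection of one generator in another shows that one of the two is redundant.\<close>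

lemma simple_system_exists:
  fixes P :: "'a::euclidean_space set"
  assumes P: "finite P" and pos: "\<And>a. a \<in> P \<Longrightarrow> a \<bullet> x > 0"
    and refl: "\<And>a b. a \<in> P \<Longrightarrow> b \<in> P \<Longrightarrow> b - (2 * (a \<bullet> b)) *\<^sub>R a \<in> P \<or> - (b - (2 * (a \<bullet> b)) *\<^sub>R a) \<in> P"
  obtains D where "D \<subseteq> P" "independent D" "P \<subseteq> convex_cone hull D"
proof -
  have "\<exists>D. (D \<subseteq> P \<and> P \<subseteq> convex_cone hull D) \<and>
      (\<forall>E. E \<subseteq> P \<and> P \<subseteq> convex_cone hull E \<longrightarrow> card D \<le> card E)"
    by (rule ex_has_least_nat[of _ P]) (simp add: hull_subset)
  then obtain D where D: "D \<subseteq> P" "P \<subseteq> convex_cone hull D"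
    and min: "\<forall>E. E \<subseteq> P \<and> P \<subseteq> convex_cone hull E \<longrightarrow> card D \<le> card E"
    by (elim exE conjE) (rule that)
  have finD: "finite D" using D(1) P by (rule finite_subset)
  have hull_pos: "v \<bullet> x \<ge> 0" if "v \<in> convex_cone hull E" "E \<subseteq> P" for v E
  proof -
    have "convex_cone hull E \<subseteq> {v. x \<bullet> v \<ge> 0}"
    proof (rule hull_minimal)
      have "0 \<le> x \<bullet> v" if "v \<in> P" for v
        using pos[OF that] by (simp add: inner_commute)
      then show "E \<subseteq> {v. x \<bullet> v \<ge> 0}" using that(2) by blast
    qed (rule convex_cone_halfspace_ge)
    then show ?thesis using that(1) by (auto simp: inner_commute)
  qed
  \<comment> \<open>Splitting off from \<open>w\<close> its multiple of \<open>a\<close> gives (1 -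
    l) a as a member of the cone over \<open>D - {a}\<close>. Pairing with \<open>x\<close> shows l
    < 1, so \<open>a\<close> itself lies in that cone and \<open>D\<close> would not be of minimal
    size.\<close>
  have not_redundant: False
    if g: "a \<in> D" "b \<in> D" "a \<noteq> b" "k > 0" "w \<in> convex_cone hull D" "a = k *\<^sub>R b + w" for a b k w
  proof -
    define E where "E = D - {a}"
    have "insert a E = D" using g(1) by (auto simp: E_def)
    then have "w \<in> convex_cone hull (insert a E)" using g(5) by simp
    then obtain l v where lv: "0 \<le> l" "v \<in> convex_cone hull E" "w = l *\<^sub>R a + v"
      by (rule convex_cone_hull_insertE)
    have EP: "E \<subseteq> P" using D(1) by (auto simp: E_def)
    have bE: "k *\<^sub>R b + v \<in> convex_cone hull E"
    proof (intro convex_cone_hull_add convex_cone_hull_mul)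
      show "b \<in> convex_cone hull E"
        using g(2,3) by (intro hull_inc) (simp add: E_def)
    qed (use g(4) lv(2) in auto)
    have eq: "(1 - l) *\<^sub>R a = k *\<^sub>R b + v"
      using g(6) lv(3) by (simp add: algebra_simps)
    have "(k *\<^sub>R b + v) \<bullet> x > 0"
      using g(2,4) D(1) pos hull_pos[OF lv(2) EP] by (auto simp: inner_simps add_pos_nonneg)
    then have "(1 - l) * (a \<bullet> x) > 0"
      unfolding eq[symmetric] by simp
    then have l: "1 - l > 0"
      using pos g(1) D(1) by (simp add: zero_less_mult_iff subset_iff) (metis less_asym)
    have "a = (1 / (1 - l)) *\<^sub>R (k *\<^sub>R b + v)"
      unfolding eq[symmetric] using l by simp
    then have "a \<in> convex_cone hull E"
      using convex_cone_hull_mul[OF bE, of "1 / (1 - l)"] l by simp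
    then have "D \<subseteq> convex_cone hull E"
      unfolding \<open>insert a E = D\<close>[symmetric] by (simp add: hull_subset)
    then have "convex_cone hull D \<subseteq> convex_cone hull E"
      by (rule hull_minimal) (rule convex_cone_convex_cone_hull)
    then have "card D \<le> card E"
      using D(2) EP min by blast
    then show False
      using g(1) finD card_gt_0_iff[of D] by (auto simp: E_def)
  qed
  have "a \<bullet> b \<le> 0" if ab: "a \<in> D" "b \<in> D" "a \<noteq> b" for a b
  proof (rule ccontr)
    define t where "t = 2 * (a \<bullet> b)"
    assume "\<not> a \<bullet> b \<le> 0"
    then have t: "t > 0" by (simp add: t_def)
    \<comment> \<open>As \<open>t\<close> is positive, either alternative writes one of
      \<open>a\<close>, \<open>b\<close> as a positive multiple of the other plus an element of the
      cone.\<close>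
    have "b - t *\<^sub>R a \<in> P \<or> - (b - t *\<^sub>R a) \<in> P"
      using refl ab D(1) unfolding t_def by blast
    then show False
    proof
      assume "b - t *\<^sub>R a \<in> P"
      then show False
        using not_redundant[of b a t "b - t *\<^sub>R a"] ab t D(2) by auto
    next
      assume *: "- (b - t *\<^sub>R a) \<in> P"
      have "(1 / t) *\<^sub>R (- (b - t *\<^sub>R a)) \<in> convex_cone hull D"
        using * D(2) t by (intro convex_cone_hull_mul) auto
      moreover have "a = (1 / t) *\<^sub>R b + (1 / t) *\<^sub>R (- (b - t *\<^sub>R a))"
        using t by (simp add: algebra_simps)
      ultimately show False
        by (intro not_redundant[OF ab, of "1 / t"]) (use t in simp)
    qed
  qed
  then have "independent D"
    using obtuse_independent[OF finD, of x] pos D(1) by blast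
  then show thesis using that D by blast
qed

lemma independent_dual:
  fixes D :: "'a::euclidean_space set"
  assumes "independent D"
  shows "\<exists>v. \<forall>d\<in>D. d \<bullet> v = f d"
proof -
  obtain g :: "'a \<Rightarrow> real" where g: "linear g" "\<forall>d\<in>D. g d = f d"
    using linear_independent_extend[OF assms, of f] by blast
  then show ?thesis
    using adjoint_works[OF g(1), of _ 1] by (intro exI[of _ "adjoint g 1"]) simp
qed

text \<open>Adding to \<open>c\<close> the dual vector of \<open>a\<close> gives a point on all
  hyperplanes of \<open>D\<close> but off that of \<open>a\<close>; hence each new normal lowers the
  dimension by exactly one.\<close>

lemma aff_dim_zeros_independent:
  fixes D :: "'a::euclidean_space set"
  assumes "independent D"
  shows "aff_dim (zeros c UNIV D) = int (DIM('a)) - int (card D)"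
proof -
  have "finite D" using assms by (rule independent_imp_finite)
  then show ?thesis using assms
  proof (induction D)
    case (insert a D)
    have ind: "independent D"
      using insert.prems by (rule independent_mono) auto
    obtain v where v: "\<forall>d\<in>insert a D. d \<bullet> v = (if d = a then 1 else 0)"
      using independent_dual[OF insert.prems, of "\<lambda>d. if d = a then 1 else 0"] by blast
    then have "c + v \<in> zeros c UNIV D" "c + v \<notin> hyp c a"
      using insert.hyps by (auto simp: zeros_def hyp_def)
    then have "\<not> zeros c UNIV D \<subseteq> hyp c a" by blast
    then have "aff_dim (zeros c UNIV D \<inter> hyp c a) = aff_dim (zeros c UNIV D) - 1"
      by (intro aff_dim_Int_hyp affine_zeros center_in_zeros) auto
    moreover have "zeros c UNIV (insert a D) = zeros c UNIV D \<inter> hyp c a"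
      by (auto simp: zeros_def hyp_def)
    ultimately show ?case
      using insert.IH[OF ind] insert.hyps by simp
  qed simp
qed

section \<open>Reflection arrangements are simplicial\<close>

text \<open>\<open>\<Phi>\<close> is a finite root system of unit vectors, not necessarily
  crystallographic. The unit length makes the displayed formula the reflection in
  \<open>a\<close>.\<close>

locale reflection_arrangement = central_arrangement c \<Phi> for c :: "'a::euclidean_space" and \<Phi> +
  assumes unit_normal: "a \<in> \<Phi> \<Longrightarrow> norm a = 1"
    and reflect_normal: "a \<in> \<Phi> \<Longrightarrow> b \<in> \<Phi> \<Longrightarrow> b - (2 * (a \<bullet> b)) *\<^sub>R a \<in> \<Phi>"
begin

text \<open>\<open>P\<close> is a face of some chamber \<open>C\<close>. For a simple system
  \<open>D\<close> of \<open>C\<close>, the map sending \<open>Q\<close> to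
  \<open>Q \<inter> D\<close> is an isomorphism from the faces of \<open>C\<close> onto the subsets
  of \<open>D\<close>, and \<open>dim0\<close> becomes cardinality; the faces below \<open>P\<close>
  go to the subsets of \<open>P \<inter> D\<close>.\<close>

theorem card_faces_below:
  assumes P: "P \<in> range (face c \<Phi>)"
  shows "card {Q \<in> range (face c \<Phi>). Q \<subseteq> P \<and> dim0 (flat_of Q) = i} = dim0 (flat_of P) choose i"
proof -
  obtain s where s: "P = face c \<Phi> s" using P by blast
  have "\<not> UNIV \<subseteq> hyp c a" if "a \<in> \<Phi>" for a
    using nonvanishing_UNIV that by (auto simp: nonvanishing_def)
  then obtain q where q: "q \<in> generic c UNIV \<Phi>"
    using generic_point_exists[of UNIV c \<Phi>] finite_normals by auto
  \<comment> \<open>Pushing a point \<open>s\<close> of the face towards a generic point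
    \<open>q\<close> gives a point \<open>x\<close> of a chamber having \<open>P\<close> as a
    face.\<close>
  obtain x where
    x1: "\<And>a. a \<in> \<Phi> \<Longrightarrow> a \<bullet> (s - c) \<noteq> 0 \<Longrightarrow> sgn (a \<bullet> (x - c)) = sgn (a \<bullet> (s - c))" and
    x2: "\<And>a. a \<in> \<Phi> \<Longrightarrow> a \<bullet> (s - c) = 0 \<Longrightarrow> sgn (a \<bullet> (x - c)) = sgn (a \<bullet> (q - c))"
    using perturbation[of UNIV c s q \<Phi>] finite_normals by auto
  define C where "C = face c \<Phi> x"
  have PC: "P \<subseteq> C"
    unfolding s C_def face_def using x1 by (metis (mono_tags, lifting) Collect_mono order_less_irrefl sgn_greater)
  have x0: "a \<bullet> (x - c) \<noteq> 0" if a: "a \<in> \<Phi>" for a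
  proof (cases "a \<bullet> (s - c) = 0")
    case True
    moreover have "a \<bullet> (q - c) \<noteq> 0" using q a by (simp add: generic_def)
    ultimately show ?thesis using x2[OF a] by (metis sgn_eq_0_iff)
  next
    case False
    then show ?thesis using x1[OF a] by (metis sgn_eq_0_iff)
  qed
  have C: "a \<in> C \<or> -a \<in> C" if "a \<in> \<Phi>" for a
    using x0[OF that] that uminus_normal by (auto simp: C_def face_def)
  have C': "-a \<notin> C" if "a \<in> C" for a
    using that by (auto simp: C_def face_def)
  have C\<Phi>: "C \<subseteq> \<Phi>" by (auto simp: C_def face_def)
  then have finC: "finite C" using finite_normals by (rule finite_subset)
  obtain D where D: "D \<subseteq> C" "independent D" "C \<subseteq> convex_cone hull D"
  proof (rule simple_system_exists[OF finC, of "x - c"])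
    fix a b assume "a \<in> C" "b \<in> C"
    then show "b - (2 * (a \<bullet> b)) *\<^sub>R a \<in> C \<or> - (b - (2 * (a \<bullet> b)) *\<^sub>R a) \<in> C"
      using reflect_normal[of a b] C C\<Phi> by blast
  qed (auto simp: C_def face_def)
  have finD: "finite D" using D(1) finC by (rule finite_subset)
  let ?F = "{Q \<in> range (face c \<Phi>). Q \<subseteq> C}"
  have nonneg: "d \<bullet> (y - c) \<ge> 0" if "d \<in> C" "face c \<Phi> y \<subseteq> C" for d y
  proof (rule ccontr)
    assume "\<not> d \<bullet> (y - c) \<ge> 0"
    then have "-d \<in> face c \<Phi> y" using that C\<Phi> uminus_normal by (auto simp: face_def)
    then show False using C'[OF that(1)] that(2) by blast
  qed
  have mono: "Q \<subseteq> Q'" if Q: "Q \<in> ?F" "Q' \<in> ?F" "Q \<inter> D \<subseteq> Q' \<inter> D" for Q Q'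
  proof -
    obtain y y' where y: "Q = face c \<Phi> y" "Q' = face c \<Phi> y'" using Q by blast
    \<comment> \<open>Closed under addition because a sum of nonnegative numbers vanishes only
      termwise. As \<open>D\<close> lies in this cone, so does \<open>C\<close>, and membership says
      that a normal in \<open>Q\<close> cannot vanish at \<open>y'\<close>.\<close>
    let ?S = "{a. a \<bullet> (y' - c) \<ge> 0 \<and> (a \<bullet> (y' - c) = 0 \<longrightarrow> a \<bullet> (y - c) \<le> 0)}"
    have "convex_cone ?S"
      unfolding convex_cone_iff by (auto simp: inner_left_distrib add_nonneg_eq_0_iff mult_nonneg_nonpos)
    moreover have "D \<subseteq> ?S"
    proof
      fix d assume d: "d \<in> D"
      then have "d \<in> C" "d \<in> \<Phi>" using D(1) C\<Phi> by auto
      then show "d \<in> ?S"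
        using nonneg[of d y'] Q y d by (auto simp: face_def)
    qed
    ultimately have "C \<subseteq> ?S"
      using D(3) hull_minimal[of D ?S convex_cone] by blast
    then show ?thesis
      using Q y by (fastforce simp: face_def)
  qed
  have flat: "flat_of Q = zeros c UNIV (D - Q)" if Q: "Q \<in> ?F" for Q
  proof
    obtain y where y: "Q = face c \<Phi> y" using Q by blast
    have "D - Q \<subseteq> {a\<in>\<Phi>. a \<notin> Q \<and> -a \<notin> Q}"
      using D(1) C\<Phi> C' Q by blast
    then show "flat_of Q \<subseteq> zeros c UNIV (D - Q)"
      by (auto simp: flat_of_def zeros_def)
    show "zeros c UNIV (D - Q) \<subseteq> flat_of Q"
    proof
      fix z assume z: "z \<in> zeros c UNIV (D - Q)"
      \<comment> \<open>The same device: a root of \<open>C\<close> vanishing at \<open>y\<close> is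
        a combination of simple roots vanishing at \<open>y\<close>, and these vanish at
        \<open>z\<close>.\<close>
      let ?S = "{a. a \<bullet> (y - c) \<ge> 0 \<and> (a \<bullet> (y - c) = 0 \<longrightarrow> a \<bullet> (z - c) = 0)}"
      have "convex_cone ?S"
        unfolding convex_cone_iff by (auto simp: inner_left_distrib add_nonneg_eq_0_iff)
      moreover have "D \<subseteq> ?S"
      proof
        fix d assume d: "d \<in> D"
        then have "d \<in> C" "d \<in> \<Phi>" using D(1) C\<Phi> by auto
        then show "d \<in> ?S"
          using nonneg[of d y] Q y d z by (auto simp: face_def zeros_def)
      qed
      ultimately have CS: "C \<subseteq> ?S"
        using D(3) hull_minimal[of D ?S convex_cone] by blast
      have "a \<bullet> (z - c) = 0" if a: "a \<in> \<Phi>" "a \<notin> Q" "-a \<notin> Q" for a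
      proof -
        have "a \<bullet> (y - c) = 0"
          using a uminus_normal[OF a(1)] by (auto simp: y face_def)
        then show ?thesis
          using C[OF a(1)] CS by auto
      qed
      then show "z \<in> flat_of Q" by (simp add: flat_of_def zeros_def)
    qed
  qed
  have empty: "{} \<in> ?F"
  proof -
    have "face c \<Phi> c = {}" by (simp add: face_def)
    then have "{} \<in> range (face c \<Phi>)" by (metis rangeI)
    then show ?thesis by simp
  qed
  have bottom: "zeros c UNIV \<Phi> = zeros c UNIV D"
    using flat[OF empty] by (simp add: flat_of_def)
  have dim: "dim0 (flat_of Q) = card (Q \<inter> D)" if Q: "Q \<in> ?F" for Q
  proof -
    have "independent (D - Q)" by (rule independent_mono[OF D(2)]) auto
    moreover have "card D = card (Q \<inter> D) + card (D - Q)"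
      using card_Int_Diff[OF finD, of Q] by (simp add: Int_commute)
    ultimately show ?thesis
      unfolding dim0_def flat[OF Q] bottom aff_dim_zeros_independent[OF D(2)]
      by (subst aff_dim_zeros_independent) simp_all
  qed
  have realize: "\<exists>Q\<in>?F. Q \<inter> D = J" if J: "J \<subseteq> D" for J
  proof -
    \<comment> \<open>A dual vector with values 1 on \<open>J\<close> and 0 on the rest of
      \<open>D\<close>: it points into the closed chamber, onto the wanted face.\<close>
    obtain v where v: "\<forall>d\<in>D. d \<bullet> v = (if d \<in> J then 1 else 0)"
      using independent_dual[OF D(2), of "\<lambda>d. if d \<in> J then 1 else 0"] by blast
    have "D \<subseteq> {a. v \<bullet> a \<ge> 0}" using v by (auto simp: inner_commute)
    then have "C \<subseteq> {a. v \<bullet> a \<ge> 0}"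
      using D(3) hull_minimal[of D "{a. v \<bullet> a \<ge> 0}" convex_cone] convex_cone_halfspace_ge by blast
    then have "a \<in> C" if "a \<in> face c \<Phi> (c + v)" for a
      using that C[of a] by (auto simp: face_def inner_commute)
    moreover have "face c \<Phi> (c + v) \<inter> D = J"
      using v J D(1) C\<Phi> by (auto simp: face_def split: if_splits)
    ultimately show ?thesis by blast
  qed
  have PF: "P \<in> ?F" using P PC by simp
  have "bij_betw (\<lambda>Q. Q \<inter> D) {Q \<in> range (face c \<Phi>). Q \<subseteq> P \<and> dim0 (flat_of Q) = i}
      {J. J \<subseteq> P \<inter> D \<and> card J = i}"
  proof (rule bij_betw_imageI)
    show "inj_on (\<lambda>Q. Q \<inter> D) {Q \<in> range (face c \<Phi>). Q \<subseteq> P \<and> dim0 (flat_of Q) = i}"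
    proof (rule inj_onI)
      fix Q Q' assume "Q \<in> {Q \<in> range (face c \<Phi>). Q \<subseteq> P \<and> dim0 (flat_of Q) = i}"
        "Q' \<in> {Q \<in> range (face c \<Phi>). Q \<subseteq> P \<and> dim0 (flat_of Q) = i}" "Q \<inter> D = Q' \<inter> D"
      then show "Q = Q'"
        using mono[of Q Q'] mono[of Q' Q] PC by blast
    qed
    show "(\<lambda>Q. Q \<inter> D) ` {Q \<in> range (face c \<Phi>). Q \<subseteq> P \<and> dim0 (flat_of Q) = i} = {J. J \<subseteq> P \<inter> D \<and> card J = i}"
    proof (intro equalityI subsetI)
      fix J assume "J \<in> (\<lambda>Q. Q \<inter> D) ` {Q \<in> range (face c \<Phi>). Q \<subseteq> P \<and> dim0 (flat_of Q) = i}"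
      then show "J \<in> {J. J \<subseteq> P \<inter> D \<and> card J = i}" using dim PC by auto
    next
      fix J assume J: "J \<in> {J. J \<subseteq> P \<inter> D \<and> card J = i}"
      then obtain Q where Q: "Q \<in> ?F" "Q \<inter> D = J" using realize[of J] by auto
      then have "Q \<subseteq> P" using mono[OF Q(1) PF] J by auto
      then show "J \<in> (\<lambda>Q. Q \<inter> D) ` {Q \<in> range (face c \<Phi>). Q \<subseteq> P \<and> dim0 (flat_of Q) = i}"
        using Q dim[OF Q(1)] J by auto
    qed
  qed
  then have "card {Q \<in> range (face c \<Phi>). Q \<subseteq> P \<and> dim0 (flat_of Q) = i} = card {J. J \<subseteq> P \<inter> D \<and> card J = i}"
    by (rule bij_betw_same_card)
  also have "\<dots> = card (P \<inter> D) choose i"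
    using finD by (intro n_subsets) simp
  finally show ?thesis using dim[OF PF] by simp
qed

end

section \<open>Surjections, Stirling numbers and Eulerian polynomials\<close>

text \<open>In a partition of n + 1 elements, \<open>i\<close> counts those outside the block of a
  distinguished element.\<close>

lemma Stirling_binomial_sum: "(\<Sum>i\<le>n. (n choose i) * Stirling i k) = Stirling (Suc n) (Suc k)"
proof (induction n arbitrary: k)
  case 0
  show ?case by (cases k) simp_all
next
  case (Suc n)
  have "(\<Sum>i\<le>Suc n. (Suc n choose i) * Stirling i k)
      = Stirling 0 k + (\<Sum>i\<le>n. (Suc n choose Suc i) * Stirling (Suc i) k)"
    by (subst sum.atMost_Suc_shift) simp
  also have "\<dots> = Stirling 0 k + (\<Sum>i\<le>n. (n choose Suc i) * Stirling (Suc i) k) + (\<Sum>i\<le>n. (n choose i) * Stirling (Suc i) k)"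
    by (simp add: sum.distrib algebra_simps)
  also have "Stirling 0 k + (\<Sum>i\<le>n. (n choose Suc i) * Stirling (Suc i) k) = (\<Sum>i\<le>Suc n. (n choose i) * Stirling i k)"
    by (simp add: sum.atMost_Suc_shift del: sum.atMost_Suc)
  also have "\<dots> = Stirling (Suc n) (Suc k)"
    using Suc.IH[of k] by simp
  also have "(\<Sum>i\<le>n. (n choose i) * Stirling (Suc i) k) = k * Stirling (Suc n) (Suc k) + Stirling (Suc n) k"
  proof (cases k)
    case (Suc j)
    have "(\<Sum>i\<le>n. (n choose i) * Stirling (Suc i) k)
        = Suc j * (\<Sum>i\<le>n. (n choose i) * Stirling i (Suc j)) + (\<Sum>i\<le>n. (n choose i) * Stirling i j)"
      by (simp add: Suc sum.distrib sum_distrib_left algebra_simps)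
    then show ?thesis using Suc.IH[of "Suc j"] Suc.IH[of j] by (simp add: Suc)
  qed simp
  finally show ?case by simp
qed

definition surjections :: "nat \<Rightarrow> nat \<Rightarrow> nat" where
  "surjections n k = fact k * Stirling n k"

text \<open>Here \<open>i\<close> is the number of elements not sent to the last value. The same
  recursion defines \<open>chain_count\<close>.\<close>

lemma surjections_Suc: "surjections n (Suc k) = (\<Sum>i<n. (n choose i) * surjections i k)"
proof -
  have "Suc k * Stirling n (Suc k) + Stirling n k = (\<Sum>i<n. (n choose i) * Stirling i k) + Stirling n k"
    using Stirling_binomial_sum[of n k] by (simp add: lessThan_Suc_atMost[symmetric])
  then have "fact k * (Suc k * Stirling n (Suc k)) = fact k * (\<Sum>i<n. (n choose i) * Stirling i k)"
    by simp
  then show ?thesis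
    by (simp add: surjections_def sum_distrib_left algebra_simps)
qed

lemma surjections_0: "surjections n 0 = 0 ^ n"
  by (cases n) (simp_all add: surjections_def)

lemma surjections_0_left: "surjections 0 k = 0 ^ k"
  by (cases k) (simp_all add: surjections_def)

lemma surjections_less: "n < k \<Longrightarrow> surjections n k = 0"
  by (simp add: surjections_def)

text \<open>The successive differences of a chain of \<open>l\<close> nonempty proper subsets are
  the \<open>l + 1\<close> blocks of an ordered partition. For \<open>n = 0\<close> the empty chain
  would be counted, although no map from the empty set is onto one element.\<close>

lemma chain_count_1: "0 < n \<Longrightarrow> chain_count (Suc 0) l n = surjections n (Suc l)"
proof (induction l arbitrary: n)
  case 0
  then show ?case by (cases n) (simp_all add: surjections_def del: Stirling.simps(4))
next
  case (Suc l)
  have "{..<n} = insert 0 {1..<n}" using Suc.prems by auto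
  then show ?case
    unfolding surjections_Suc[of n "Suc l"] by (simp add: surjections_0_left Suc.IH)
qed

text \<open>The first summand accounts for the chains that contain the empty set, which then yields
  no block, and the second for the others.\<close>

lemma chain_count_0: "chain_count 0 l n = surjections n l + surjections n (Suc l)"
proof (induction l arbitrary: n)
  case 0
  then show ?case by (cases n) (simp_all add: surjections_def del: Stirling.simps(4))
next
  case (Suc l)
  then show ?case
    unfolding surjections_Suc[of n "Suc l"] surjections_Suc[of n l]
    by (simp add: lessThan_atLeast0 sum.distrib algebra_simps)
qed

text \<open>A map into \<open>m\<close> elements is a choice of its image together with a surjection
  onto it. The flexible bound \<open>N\<close> lets the induction use one bound for all smaller
  domains.\<close>

lemma sum_surjections_binomial:
  assumes "n \<le> N"
  shows "(\<Sum>k\<le>N. surjections n k * (m choose k)) = m ^ n"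
  using assms
proof (induction m arbitrary: n N)
  case 0
  have "(\<Sum>k\<le>N. surjections n k * (0 choose k)) = (\<Sum>k\<in>{0}. surjections n k * (0 choose k))"
    by (rule sum.mono_neutral_right) auto
  then show ?case by (simp add: surjections_0)
next
  case (Suc m)
  have "(\<Sum>k\<le>Suc N. surjections n k * (Suc m choose k))
      = (\<Sum>k\<le>Suc N. surjections n k * (m choose k)) + (\<Sum>k\<le>N. surjections n (Suc k) * (m choose k))"
    unfolding sum.atMost_Suc_shift by (simp add: sum.distrib algebra_simps)
  also have "(\<Sum>k\<le>Suc N. surjections n k * (m choose k)) = m ^ n"
    using Suc by (intro Suc.IH) simp
  also have "(\<Sum>k\<le>N. surjections n (Suc k) * (m choose k))
      = (\<Sum>i<n. (n choose i) * (\<Sum>k\<le>N. surjections i k * (m choose k)))"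
    unfolding surjections_Suc sum_distrib_left sum_distrib_right
    by (subst sum.swap) (simp add: mult.assoc)
  also have "\<dots> = (\<Sum>i<n. (n choose i) * m ^ i)"
    using Suc by (intro sum.cong) auto
  also have "m ^ n + \<dots> = (\<Sum>i\<le>n. (n choose i) * m ^ i)"
    by (simp add: lessThan_Suc_atMost[symmetric])
  also have "\<dots> = Suc m ^ n"
    using binomial[of m 1 n] by simp
  finally show ?case
    using Suc.prems by (simp add: surjections_less)
qed

section \<open>Power series in T/(1-T)\<close>

abbreviation geo :: "'r::comm_ring_1 fps" where
  "geo \<equiv> fps_X * inverse_one_minus_T"

lemma one_minus_X_cancel:
  "(1 - fps_X) * f = g \<longleftrightarrow> f = inverse_one_minus_T * (g :: 'r::comm_ring_1 fps)"
proof
  assume "(1 - fps_X) * f = g"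
  then have "inverse_one_minus_T * g = ((1 - fps_X) * inverse_one_minus_T) * f"
    by (simp only: mult_ac)
  then show "f = inverse_one_minus_T * g"
    by (simp add: one_minus_T_times_inverse)
next
  assume "f = inverse_one_minus_T * g"
  then have "(1 - fps_X) * f = ((1 - fps_X) * inverse_one_minus_T) * g"
    by (simp only: mult_ac)
  then show "(1 - fps_X) * f = g"
    by (simp add: one_minus_T_times_inverse)
qed

lemma one_plus_geo: "1 + geo = inverse_one_minus_T"
proof -
  have "inverse_one_minus_T - geo = 1"
    using one_minus_T_times_inverse by (simp add: left_diff_distrib)
  then show ?thesis by (metis diff_add_cancel)
qed

text \<open>By Pascal's rule, multiplication by 1 - T turns the column of \<open>Suc l\<close> into
  the shifted column of \<open>l\<close>.\<close>

lemma fps_binomial_geo: "Abs_fps (\<lambda>m. of_nat (m choose l)) = geo ^ l * (inverse_one_minus_T :: 'r::comm_ring_1 fps)"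
proof (induction l)
  case 0
  show ?case by (simp add: inverse_one_minus_T_def)
next
  case (Suc l)
  have "(1 - fps_X) * Abs_fps (\<lambda>m. of_nat (m choose Suc l)) = fps_X * Abs_fps (\<lambda>m. of_nat (m choose l) :: 'r)"
  proof (rule fps_ext)
    fix m show "fps_nth ((1 - fps_X) * Abs_fps (\<lambda>m. of_nat (m choose Suc l))) m
        = fps_nth (fps_X * Abs_fps (\<lambda>m. of_nat (m choose l) :: 'r)) m"
      by (cases m) (simp_all add: left_diff_distrib)
  qed
  then show ?case
    unfolding one_minus_X_cancel Suc.IH by (simp add: algebra_simps)
qed

definition powers_fps :: "nat \<Rightarrow> 'r::comm_ring_1 fps" where
  "powers_fps r = Abs_fps (\<lambda>m. of_nat (Suc m ^ r))"

text \<open>Maps into \<open>Suc m\<close> elements are counted by their image; Pascal's rule then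
  merges the surjection numbers for \<open>l\<close> and \<open>Suc l\<close> into
  \<open>chain_count 0 l r\<close>, and the binomials in \<open>m\<close> sum to powers of
  \<open>geo\<close>.\<close>

lemma sum_chain_count_geo:
  assumes "r \<le> N"
  shows "(\<Sum>l\<le>N. of_nat (chain_count 0 l r) * geo ^ l) = (1 - fps_X) * (powers_fps r :: 'r::comm_ring_1 fps)"
proof -
  have "powers_fps r = (\<Sum>l\<le>N. of_nat (chain_count 0 l r) * Abs_fps (\<lambda>m. of_nat (m choose l) :: 'r))"
  proof (rule fps_ext)
    fix m
    have "Suc m ^ r = (\<Sum>k\<le>Suc N. surjections r k * (Suc m choose k))"
      using assms by (intro sum_surjections_binomial[symmetric]) simp
    also have "\<dots> = (\<Sum>k\<le>Suc N. surjections r k * (m choose k)) + (\<Sum>k\<le>N. surjections r (Suc k) * (m choose k))"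
      unfolding sum.atMost_Suc_shift by (simp add: sum.distrib algebra_simps)
    also have "\<dots> = (\<Sum>l\<le>N. chain_count 0 l r * (m choose l))"
      using assms by (simp add: chain_count_0 surjections_less sum.distrib algebra_simps)
    finally show "fps_nth (powers_fps r) m
        = fps_nth (\<Sum>l\<le>N. of_nat (chain_count 0 l r) * Abs_fps (\<lambda>m. of_nat (m choose l) :: 'r)) m"
      by (simp only: powers_fps_def fps_nth_Abs_fps of_nat_sum of_nat_mult fps_sum_nth fps_of_nat[symmetric] fps_mult_left_const_nth)
  qed
  also have "\<dots> = inverse_one_minus_T * (\<Sum>l\<le>N. of_nat (chain_count 0 l r) * geo ^ l)"
    unfolding fps_binomial_geo sum_distrib_left by (simp add: algebra_simps)
  finally have "powers_fps r = inverse_one_minus_T * (\<Sum>l\<le>N. of_nat (chain_count 0 l r) * geo ^ l :: 'r fps)" .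
  then show ?thesis
    by (rule one_minus_X_cancel[THEN iffD2, symmetric])
qed

subsection \<open>Descents and insertion\<close>

fun descents :: "nat list \<Rightarrow> nat" where
  "descents (x # y # zs) = (if y < x then 1 else 0) + descents (y # zs)"
| "descents _ = 0"

lemma descents_eq_sum: "descents xs = (\<Sum>i<length xs - 1. if xs ! Suc i < xs ! i then 1 else 0)"
  by (induction xs rule: descents.induct) (simp_all add: sum.lessThan_Suc_shift del: sum.lessThan_Suc)

lemma des_eq_descents: "des n w = descents (map w [1..<Suc n])"
proof -
  have "des n w = (\<Sum>i\<in>{1..<n}. if w (Suc i) < w i then 1 else 0)"
    unfolding des_def card_eq_sum by (subst sum.inter_filter) simp_all
  also have "\<dots> = (\<Sum>i<n - 1. if w (Suc (Suc i)) < w (Suc i) then 1 else 0)"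
    by (rule sum.reindex_bij_witness[of _ Suc "\<lambda>i. i - 1"]) auto
  also have "\<dots> = descents (map w [1..<Suc n])"
    unfolding descents_eq_sum by (intro sum.cong) (auto simp del: upt_Suc)
  finally show ?thesis .
qed

fun insertions :: "'b \<Rightarrow> 'b list \<Rightarrow> 'b list list" where
  "insertions x [] = [[x]]"
| "insertions x (y # ys) = (x # y # ys) # map ((#) y) (insertions x ys)"

lemma set_insertions: "zs \<in> set (insertions x ys) \<longleftrightarrow> (\<exists>as bs. ys = as @ bs \<and> zs = as @ x # bs)"
proof (induction ys arbitrary: zs)
  case (Cons y ys)
  show ?case
  proof
    assume "zs \<in> set (insertions x (y # ys))"
    then consider "zs = x # y # ys" | zs' where "zs = y # zs'" "zs' \<in> set (insertions x ys)" by auto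
    then show "\<exists>as bs. y # ys = as @ bs \<and> zs = as @ x # bs"
    proof cases
      case 1
      then show ?thesis by (intro exI[of _ "[]"] exI[of _ "y # ys"]) simp
    next
      case 2
      then obtain as bs where "ys = as @ bs" "zs' = as @ x # bs" using Cons.IH by blast
      then show ?thesis using 2 by (intro exI[of _ "y # as"] exI[of _ bs]) simp
    qed
  next
    assume "\<exists>as bs. y # ys = as @ bs \<and> zs = as @ x # bs"
    then obtain as bs where *: "y # ys = as @ bs" "zs = as @ x # bs" by blast
    show "zs \<in> set (insertions x (y # ys))"
    proof (cases as)
      case Nil
      then have "bs = y # ys" "zs = x # y # ys" using * by simp_all
      then show ?thesis by simp
    next
      case (Cons a as')
      then have "as' @ x # bs \<in> set (insertions x ys)" using * Cons.IH[of "as' @ x # bs"] by auto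
      then show ?thesis using * Cons by simp
    qed
  qed
qed simp

lemma distinct_insertions: "x \<notin> set ys \<Longrightarrow> distinct (insertions x ys)"
  by (induction ys) (auto simp: distinct_map)

lemma sum_permutations_of_set_insert:
  fixes f :: "'b list \<Rightarrow> 'c::comm_monoid_add"
  assumes S: "finite S" "x \<notin> S"
  shows "(\<Sum>zs\<in>permutations_of_set (insert x S). f zs)
    = (\<Sum>ys\<in>permutations_of_set S. sum_list (map f (insertions x ys)))"
proof -
  have eq: "permutations_of_set (insert x S) = (\<Union>ys\<in>permutations_of_set S. set (insertions x ys))"
  proof (intro equalityI subsetI)
    fix zs assume "zs \<in> permutations_of_set (insert x S)"
    then have zs: "set zs = insert x S" "distinct zs" by (auto simp: permutations_of_set_def)
    then obtain as bs where ab: "zs = as @ x # bs" by (metis in_set_conv_decomp insertI1)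
    then have "as @ bs \<in> permutations_of_set S" using zs S(2) by (auto simp: permutations_of_set_def)
    moreover have "zs \<in> set (insertions x (as @ bs))"
      unfolding set_insertions using ab by blast
    ultimately show "zs \<in> (\<Union>ys\<in>permutations_of_set S. set (insertions x ys))" by blast
  next
    fix zs assume "zs \<in> (\<Union>ys\<in>permutations_of_set S. set (insertions x ys))"
    then show "zs \<in> permutations_of_set (insert x S)"
      using S(2) by (auto simp: permutations_of_set_def set_insertions)
  qed
  have disj: "set (insertions x ys) \<inter> set (insertions x ys') = {}"
    if "ys \<in> permutations_of_set S" "ys' \<in> permutations_of_set S" "ys \<noteq> ys'" for ys ys'
  proof -
    have x: "x \<notin> set ys" "x \<notin> set ys'"
      using that S(2) by (auto simp: permutations_of_set_def)
    have False if zs: "zs \<in> set (insertions x ys)" "zs \<in> set (insertions x ys')" for zs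
    proof -
      obtain as bs as' bs' where *: "ys = as @ bs" "zs = as @ x # bs" "ys' = as' @ bs'" "zs = as' @ x # bs'"
        using zs unfolding set_insertions by blast
      then have "as = as' \<and> bs = bs'"
        using x append_Cons_eq_iff[of x as bs as' bs'] by simp
      then show False using * \<open>ys \<noteq> ys'\<close> by simp
    qed
    then show ?thesis by blast
  qed
  have "(\<Sum>zs\<in>permutations_of_set (insert x S). f zs)
      = (\<Sum>ys\<in>permutations_of_set S. \<Sum>zs\<in>set (insertions x ys). f zs)"
    unfolding eq by (rule sum.UNION_disjoint) (use S disj in auto)
  also have "\<dots> = (\<Sum>ys\<in>permutations_of_set S. sum_list (map f (insertions x ys)))"
  proof (rule sum.cong[OF HOL.refl])
    fix ys assume "ys \<in> permutations_of_set S"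
    then have "x \<notin> set ys" using S(2) by (auto simp: permutations_of_set_def)
    then show "(\<Sum>zs\<in>set (insertions x ys). f zs) = sum_list (map f (insertions x ys))"
      by (simp add: sum_list_distinct_conv_sum_set distinct_insertions)
  qed
  finally show ?thesis .
qed

text \<open>A letter larger than all others leaves the number of descents unchanged when it is put
  into a descent or at the end, and raises it by one elsewhere. Keeping \<open>y\<close> in front
  makes the induction possible.\<close>

lemma sum_insertions_Cons:
  fixes g :: "nat \<Rightarrow> 'c::comm_ring_1"
  assumes "\<forall>u\<in>set (y # ys). u < x"
  shows "sum_list (map (\<lambda>zs. g (descents (y # zs))) (insertions x ys)) =
    of_nat (Suc (descents (y # ys))) * g (descents (y # ys)) +
    (of_nat (length ys) - of_nat (descents (y # ys))) * g (Suc (descents (y # ys)))"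
  using assms
proof (induction ys arbitrary: y g)
  case (Cons u us)
  define b :: nat where "b = (if u < y then 1 else 0)"
  have "sum_list (map (\<lambda>zs. g (descents (y # zs))) (insertions x (u # us)))
      = g (Suc (descents (u # us))) + sum_list (map (\<lambda>zs. g (b + descents (u # zs))) (insertions x us))"
    using Cons.prems by (simp add: o_def b_def)
  also have "sum_list (map (\<lambda>zs. g (b + descents (u # zs))) (insertions x us)) =
    of_nat (Suc (descents (u # us))) * g (b + descents (u # us)) +
    (of_nat (length us) - of_nat (descents (u # us))) * g (b + Suc (descents (u # us)))"
    \<comment> \<open>The function \<open>g\<close> is arbitrary so that it can absorb the possible
      descent \<open>b\<close> between \<open>y\<close> and \<open>u\<close>.\<close>
    using Cons.prems Cons.IH[of u "\<lambda>d. g (b + d)"] by simp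
  finally show ?case
    by (auto simp: b_def algebra_simps)
qed simp

lemma sum_insertions:
  fixes g :: "nat \<Rightarrow> 'c::comm_ring_1"
  assumes "\<forall>u\<in>set ys. u < x"
  shows "sum_list (map (\<lambda>zs. g (descents zs)) (insertions x ys)) =
    of_nat (Suc (descents ys)) * g (descents ys) +
    (of_nat (length ys) - of_nat (descents ys)) * g (Suc (descents ys))"
proof (cases ys)
  case (Cons y us)
  then show ?thesis
    using assms sum_insertions_Cons[of y us x g] by (simp add: o_def algebra_simps)
qed simp

lemma bij_betw_permutes_lists:
  "bij_betw (\<lambda>w. map w [1..<Suc n]) {w. w permutes {1..n}} (permutations_of_set {1..n})"
proof -
  have inj: "inj_on (\<lambda>w. map w [1..<Suc n]) {w. w permutes {1..n}}"
  proof (rule inj_onI)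
    fix v w assume vw: "v \<in> {w. w permutes {1..n}}" "w \<in> {w. w permutes {1..n}}"
      "map v [1..<Suc n] = map w [1..<Suc n]"
    then have "v i = w i" if "i \<in> {1..n}" for i
      using that by (auto simp del: upt_Suc)
    then show "v = w"
      using vw by (intro ext) (metis mem_Collect_eq permutes_not_in)
  qed
  have sub: "(\<lambda>w. map w [1..<Suc n]) ` {w. w permutes {1..n}} \<subseteq> permutations_of_set {1..n}"
  proof
    fix xs assume "xs \<in> (\<lambda>w. map w [1..<Suc n]) ` {w. w permutes {1..n}}"
    then obtain w where w: "w permutes {1..n}" "xs = map w [1..<Suc n]" by auto
    have "set [1..<Suc n] = {1..n}" by auto
    then show "xs \<in> permutations_of_set {1..n}"
      using w permutes_image[OF w(1)] permutes_inj_on[OF w(1)]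
      by (simp add: permutations_of_set_def distinct_map del: upt_Suc)
  qed
  have card: "card ((\<lambda>w. map w [1..<Suc n]) ` {w. w permutes {1..n}}) = card (permutations_of_set {1..n})"
    unfolding card_image[OF inj] by (simp add: card_permutations)
  show ?thesis
    by (rule bij_betw_imageI[OF inj card_subset_eq[OF _ sub card]]) simp
qed

lemma fps_eulerian: "fps_of_poly (eulerian_poly n) = (\<Sum>xs\<in>permutations_of_set {1..n}. fps_X ^ descents xs)"
proof -
  have "fps_of_poly (eulerian_poly n) = (\<Sum>w | w permutes {1..n}. fps_X ^ descents (map w [1..<Suc n]))"
    unfolding eulerian_poly_def by (simp add: fps_of_poly_sum fps_of_poly_monom' des_eq_descents del: upt_Suc)
  also have "\<dots> = (\<Sum>xs\<in>permutations_of_set {1..n}. fps_X ^ descents xs)"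
    by (rule sum.reindex_bij_betw[OF bij_betw_permutes_lists])
  finally show ?thesis .
qed

text \<open>The operator T d/dT multiplies T^d by d, so the multiplicities d + 1 and n - d produced
  by inserting the largest letter become a differential recursion.\<close>

lemma fps_eulerian_Suc:
  "fps_of_poly (eulerian_poly (Suc n)) = (1 + of_nat n * fps_X) * fps_of_poly (eulerian_poly n)
     + fps_X * (1 - fps_X) * fps_deriv (fps_of_poly (eulerian_poly n))"
proof -
  let ?P = "permutations_of_set {1..n}"
  have Xd: "fps_X * fps_deriv (fps_X ^ d) = of_nat d * (fps_X :: rat fps) ^ d" for d
    unfolding fps_deriv_power fps_of_nat
    by (cases d) (simp_all add: mult.left_commute)
  have "fps_of_poly (eulerian_poly (Suc n)) = (\<Sum>ys\<in>?P. sum_list (map (\<lambda>zs. fps_X ^ descents zs) (insertions (Suc n) ys)))"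
    unfolding fps_eulerian atLeastAtMostSuc_conv[OF le_add1[of 1 n, unfolded plus_1_eq_Suc]]
    by (rule sum_permutations_of_set_insert) auto
  also have "\<dots> = (\<Sum>ys\<in>?P. (1 + of_nat n * fps_X) * fps_X ^ descents ys
      + (1 - fps_X) * (fps_X * fps_deriv (fps_X ^ descents ys)))"
  proof (rule sum.cong[OF HOL.refl])
    fix ys assume "ys \<in> ?P"
    then have ys: "set ys = {1..n}" "distinct ys" by (auto simp: permutations_of_set_def)
    then have "length ys = n" using distinct_card[of ys] by simp
    then show "sum_list (map (\<lambda>zs. fps_X ^ descents zs) (insertions (Suc n) ys))
      = (1 + of_nat n * fps_X) * fps_X ^ descents ys
        + (1 - fps_X) * (fps_X * fps_deriv (fps_X ^ descents ys) :: rat fps)"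
      using ys unfolding Xd by (subst sum_insertions) (auto simp: algebra_simps)
  qed
  also have "\<dots> = (1 + of_nat n * fps_X) * fps_of_poly (eulerian_poly n)
     + fps_X * (1 - fps_X) * fps_deriv (fps_of_poly (eulerian_poly n))"
    unfolding fps_eulerian fps_deriv_sum
    by (simp add: sum.distrib sum_subtractf sum_distrib_left algebra_simps)
  finally show ?thesis .
qed

text \<open>Carlitz's identity. The generating function of the powers satisfies the matching
  recursion, because multiplying the coefficient of T^m by m + 1 means adding T times the
  derivative.\<close>

theorem fps_eulerian_eq_powers: "fps_of_poly (eulerian_poly n) = (1 - fps_X) ^ Suc n * powers_fps n"
proof (induction n)
  case 0
  have "powers_fps 0 = (inverse_one_minus_T :: rat fps)"
    by (simp add: powers_fps_def inverse_one_minus_T_def)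
  then show ?case
    by (simp add: fps_eulerian one_minus_T_times_inverse)
next
  case (Suc n)
  let ?G = "powers_fps n :: rat fps"
  let ?U = "1 - fps_X :: rat fps"
  have G: "powers_fps (Suc n) = ?G + fps_X * fps_deriv ?G"
  proof (rule fps_ext)
    fix m show "fps_nth (powers_fps (Suc n)) m = fps_nth (?G + fps_X * fps_deriv ?G) m"
      by (cases m) (simp_all add: powers_fps_def algebra_simps)
  qed
  have "fps_deriv (?U ^ Suc n) = - (of_nat (Suc n) * ?U ^ n)"
    unfolding fps_deriv_power fps_of_nat by (simp add: algebra_simps)
  then have "fps_deriv (?U ^ Suc n * ?G) = ?U ^ Suc n * fps_deriv ?G - of_nat (Suc n) * ?U ^ n * ?G"
    by (simp only: fps_deriv_mult) (simp add: algebra_simps)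
  then have "fps_of_poly (eulerian_poly (Suc n)) = (1 + of_nat n * fps_X) * (?U ^ Suc n * ?G)
     + fps_X * ?U * (?U ^ Suc n * fps_deriv ?G - of_nat (Suc n) * ?U ^ n * ?G)"
    unfolding fps_eulerian_Suc Suc.IH by simp
  also have "\<dots> = ?U ^ Suc (Suc n) * (?G + fps_X * fps_deriv ?G)"
    by (simp add: algebra_simps)
  finally show ?case unfolding G .
qed

corollary eulerian_geo:
  assumes "r \<le> N"
  shows "fps_of_poly (eulerian_poly r) = (1 - fps_X) ^ r * (\<Sum>l\<le>N. of_nat (chain_count 0 l r) * geo ^ l)"
  unfolding fps_eulerian_eq_powers sum_chain_count_geo[OF assms] by (simp add: mult.assoc mult.left_commute)

section \<open>Chains and flags\<close>

lemma distinct_flag: "F \<in> flags P \<Longrightarrow> distinct F"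
  unfolding flags_def by (induction F) auto

lemma length_flag_le: "finite P \<Longrightarrow> F \<in> flags P \<Longrightarrow> length F \<le> card P"
  using distinct_card[OF distinct_flag, of F P] card_mono[of P "set F"] by (simp add: flags_def)

lemma finite_flags [simp]: "finite P \<Longrightarrow> finite (flags P)"
  by (rule finite_subset[of _ "{F. set F \<subseteq> P \<and> length F \<le> card P}"])
    (auto simp: length_flag_le finite_lists_length_le flags_def intro: length_flag_le[unfolded flags_def])

lemma sum_flags:
  assumes P: "finite P" "\<And>y. y \<in> P \<Longrightarrow> y \<subset> x" and N: "\<And>F. F \<in> flags P \<Longrightarrow> length F \<le> N"
  shows "(\<Sum>F\<in>flags P. f F) = (\<Sum>l\<le>N. \<Sum>F\<in>flags_below P l x. f F)"
proof -
  have "(\<Sum>F\<in>flags P. f F) = (\<Sum>l\<le>N. \<Sum>F | F \<in> flags P \<and> length F = l. f F)"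
    by (rule sum.group[symmetric]) (use P N in auto)
  moreover have "{F. F \<in> flags P \<and> length F = l} = flags_below P l x" for l
    using P(2) by (auto simp: flags_below_def flags_def)
  ultimately show ?thesis by simp
qed

lemma flags_insert_top:
  assumes "\<And>y. y \<in> P \<Longrightarrow> y \<subset> x"
  shows "flags (insert x P) = flags P \<union> (#) x ` flags P"
proof (intro equalityI subsetI)
  fix F assume F: "F \<in> flags (insert x P)"
  show "F \<in> flags P \<union> (#) x ` flags P"
  proof (cases F)
    case Nil
    then show ?thesis by (simp add: flags_def)
  next
    case (Cons y G)
    have "z \<in> P" if "z \<in> set G" for z
    proof -
      have "z \<subset> y" "z \<in> insert x P" "y \<in> insert x P"
        using that F Cons by (auto simp: flags_def)
      then show ?thesis using assms by blast
    qed
    then have G: "G \<in> flags P" using F Cons by (auto simp: flags_def)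
    then show ?thesis
      using F Cons by (cases "y = x") (auto simp: flags_def)
  qed
next
  fix F assume "F \<in> flags P \<union> (#) x ` flags P"
  then show "F \<in> flags (insert x P)"
    using assms by (fastforce simp: flags_def)
qed

text \<open>The new element is comparable with all others, so the order complex becomes a cone with
  this element as apex.\<close>

lemma sum_flags_insert_top:
  fixes z :: "'c::comm_ring_1"
  assumes "finite P" "\<And>y. y \<in> P \<Longrightarrow> y \<subset> x"
  shows "(\<Sum>F\<in>flags (insert x P). z ^ length F) = (1 + z) * (\<Sum>F\<in>flags P. z ^ length F)"
proof -
  have "x \<notin> P" using assms(2) by blast
  then have disj: "flags P \<inter> (#) x ` flags P = {}" by (auto simp: flags_def)
  have "flags (insert x P) = flags P \<union> (#) x ` flags P"
    by (rule flags_insert_top) (rule assms(2))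
  then have "(\<Sum>F\<in>flags (insert x P). z ^ length F) = (\<Sum>F\<in>flags P. z ^ length F) + (\<Sum>F\<in>(#) x ` flags P. z ^ length F)"
    using assms(1) by (simp add: sum.union_disjoint disj)
  also have "(\<Sum>F\<in>(#) x ` flags P. z ^ length F) = z * (\<Sum>F\<in>flags P. z ^ length F)"
    by (subst sum.reindex) (auto simp: inj_on_def sum_distrib_left)
  finally show ?thesis by (simp add: algebra_simps)
qed

lemma flag_eqI:
  assumes "sorted_wrt (\<lambda>x y. y \<subset> x) F" "sorted_wrt (\<lambda>x y. y \<subset> x) G" "set F = set G"
  shows "F = G"
  using assms
proof (induction F arbitrary: G)
  case (Cons x F)
  then obtain y G' where G: "G = y # G'" by (cases G) auto
  have "x = y"
  proof (rule ccontr)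
    assume "x \<noteq> y"
    then have "x \<in> set G'" "y \<in> set F" using Cons.prems(3) G by auto
    then have "x \<subset> y" "y \<subset> x" using Cons.prems(1,2) G by auto
    then show False by blast
  qed
  moreover have "x \<notin> set F" "y \<notin> set G'" using Cons.prems(1,2) G by auto
  ultimately have "set F = set G'" using Cons.prems(3) G by auto
  then show ?case
    using Cons.IH[of G'] Cons.prems G \<open>x = y\<close> by simp
qed simp

lemma flag_of_chain:
  assumes "finite C" "\<And>x y. x \<in> C \<Longrightarrow> y \<in> C \<Longrightarrow> x \<subseteq> y \<or> y \<subseteq> x"
  shows "\<exists>F. sorted_wrt (\<lambda>x y. y \<subset> x) F \<and> set F = C"
  using assms
proof (induction C rule: finite_psubset_induct)
  case (psubset C)
  show ?case
  proof (cases "C = {}")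
    case False
    then obtain x where x: "x \<in> C" "\<And>y. y \<in> C \<Longrightarrow> x \<subseteq> y \<Longrightarrow> x = y"
      using finite_has_maximal[OF psubset.hyps(1)] by blast
    then have below: "y \<subset> x" if "y \<in> C - {x}" for y
      using psubset.prems[of x y] that by blast
    obtain F where "sorted_wrt (\<lambda>x y. y \<subset> x) F" "set F = C - {x}"
      using psubset.IH[of "C - {x}"] psubset.prems x(1) by blast
    then have "sorted_wrt (\<lambda>x y. y \<subset> x) (x # F)" "set (x # F) = C"
      using below x(1) by auto
    then show ?thesis by blast
  qed simp
qed

lemma bij_betw_flags_chains:
  assumes "finite P"
  shows "bij_betw set (flags P) {C \<in> chains P. finite C}"
proof (rule bij_betw_imageI)
  show "inj_on set (flags P)"
    by (rule inj_onI) (auto simp: flags_def intro: flag_eqI)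
  show "set ` flags P = {C \<in> chains P. finite C}"
  proof (intro equalityI subsetI)
    fix C assume "C \<in> set ` flags P"
    then obtain F where F: "C = set F" "set F \<subseteq> P" "sorted_wrt (\<lambda>x y. y \<subset> x) F"
      by (auto simp: flags_def)
    from F(3) have "x \<subseteq> y \<or> y \<subseteq> x" if "x \<in> set F" "y \<in> set F" for x y
      using that by (induction F) auto
    then show "C \<in> {C \<in> chains P. finite C}"
      using F by (auto simp: chains_def chain_subset_def)
  next
    fix C assume "C \<in> {C \<in> chains P. finite C}"
    then have C: "finite C" "C \<subseteq> P" "\<And>x y. x \<in> C \<Longrightarrow> y \<in> C \<Longrightarrow> x \<subseteq> y \<or> y \<subseteq> x"
      by (auto simp: chains_def chain_subset_def)
    obtain F where "sorted_wrt (\<lambda>x y. y \<subset> x) F" "set F = C"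
      using flag_of_chain[OF C(1,3)] by blast
    then show "C \<in> set ` flags P"
      using C(2) by (intro image_eqI[of _ _ F]) (auto simp: flags_def)
  qed
qed

lemma sum_chains_flags:
  fixes z :: "'c::comm_ring_1"
  assumes "finite P"
  shows "(\<Sum>C\<in>{C \<in> chains P. finite C}. z ^ card C) = (\<Sum>F\<in>flags P. z ^ length F)"
proof -
  have "(\<Sum>C\<in>{C \<in> chains P. finite C}. z ^ card C) = (\<Sum>F\<in>flags P. z ^ card (set F))"
    by (rule sum.reindex_bij_betw[OF bij_betw_flags_chains[OF assms], symmetric])
  also have "\<dots> = (\<Sum>F\<in>flags P. z ^ length F)"
    by (intro sum.cong) (auto simp: distinct_card distinct_flag)
  finally show ?thesis .
qed

lemma sum_flags_proper_subsets:
  fixes z :: "'c::comm_ring_1"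
  assumes "0 < r" and N: "r \<le> N" "\<And>F. F \<in> flags (Pow {1..r} - {{}} - {{1..r}}) \<Longrightarrow> length F \<le> N"
  shows "(\<Sum>F\<in>flags (Pow {1..r} - {{}} - {{1..r}}). z ^ length F)
    = (\<Sum>l\<le>N. of_nat (chain_count 1 l r) * z ^ l)"
proof -
  let ?P = "Pow {1..r} - {{}} - {{1..r}}"
  let ?Q = "Pow {1..r} - {{}}"
  have one: "flag_weight (\<lambda>_ _. 1::nat) e x F = 1" for e x :: "nat set" and F
    by (induction F arbitrary: x) auto
  have "(\<Sum>F\<in>flags_below ?P l {1..r}. flag_weight (\<lambda>_ _. 1) {} {1..r} F) = of_nat (chain_count 1 l (card {1..r})) * (1::nat)" for l
  proof (rule sum_flag_weight[where Q = ?Q and N = "\<lambda>_. 1"])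
    fix x i assume x: "x \<in> ?Q" and i: "1 \<le> i" "i < card x"
    then have fin: "finite x" using finite_subset by auto
    have "{y. y \<in> ?P \<and> y \<subset> x \<and> card y = i} = {y. y \<subseteq> x \<and> card y = i}"
      using x i by auto
    then show "(\<Sum>y | y \<in> ?P \<and> y \<subset> x \<and> card y = i. 1 * 1) = of_nat (card x choose i) * (1::nat)"
      using n_subsets[OF fin, of i] by simp
  next
    fix x y assume "x \<in> ?Q" "y \<in> ?P" "y \<subset> x"
    moreover from this have "finite x" "finite y" using finite_subset by auto
    ultimately show "1 \<le> card y \<and> card y < card x"
      by (auto simp: psubset_card_mono Suc_le_eq card_gt_0_iff)
  qed (use \<open>0 < r\<close> in auto)
  then have card: "card (flags_below ?P l {1..r}) = chain_count 1 l r" for l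
    unfolding one by simp
  have "(\<Sum>F\<in>flags ?P. z ^ length F) = (\<Sum>l\<le>N. \<Sum>F\<in>flags_below ?P l {1..r}. z ^ length F)"
    by (rule sum_flags) (use N in auto)
  also have "\<dots> = (\<Sum>l\<le>N. \<Sum>F\<in>flags_below ?P l {1..r}. z ^ l)"
    by (intro sum.cong[OF HOL.refl]) (auto simp: flags_below_def)
  finally show ?thesis by (simp only: sum_constant card)
qed

text \<open>The empty set can be added to every chain of nonempty proper subsets, which gives the
  factor 1 + z. On the level of surjection numbers, the sequence is shifted by one.\<close>

lemma sum_chain_count_cone:
  fixes z :: "'c::comm_ring_1"
  assumes "0 < r" "r \<le> N"
  shows "(\<Sum>l\<le>N. of_nat (chain_count 0 l r) * z ^ l) = (1 + z) * (\<Sum>l\<le>N. of_nat (chain_count 1 l r) * z ^ l)"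
proof -
  let ?s = "\<lambda>l. of_nat (surjections r l) * z ^ l"
  have "(\<Sum>l\<le>N. ?s l) = (\<Sum>l\<le>Suc N. ?s l)"
    using assms by (simp add: surjections_less)
  also have "\<dots> = z * (\<Sum>l\<le>N. of_nat (surjections r (Suc l)) * z ^ l)"
    unfolding sum.atMost_Suc_shift using assms by (simp add: surjections_0 zero_power sum_distrib_left mult.left_commute)
  finally show ?thesis
    using assms by (simp add: chain_count_0 chain_count_1 algebra_simps sum.distrib)
qed

section \<open>Eulerian polynomials and subdivided simplices\<close>

lemma one_minus_X_nonzero: "(1 - fps_X :: rat fps) \<noteq> 0"
  by (metis fps_X_neq_one right_minus_eq)

lemma div_one_minus_X: "f / (1 - fps_X) = inverse_one_minus_T * (f :: rat fps)"
proof -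
  have "f = (1 - fps_X) * (inverse_one_minus_T * f)"
    by (simp add: mult.assoc[symmetric] one_minus_T_times_inverse)
  then have "f / (1 - fps_X) = (1 - fps_X) * (inverse_one_minus_T * f) / (1 - fps_X)"
    by (rule arg_cong)
  also have "\<dots> = inverse_one_minus_T * f"
    by (rule nonzero_mult_div_cancel_left[OF one_minus_X_nonzero])
  finally show ?thesis .
qed

text \<open>The whole vertex set is the apex over the subdivided boundary, and the apex contributes
  1 + T/(1-T) = 1/(1-T). At \<open>r = 0\<close> the boundary has no face, but its subdivision still
  has the empty chain, and the first identity would read 1/(1-T) = 1.\<close>

theorem sum_subdivided_boundary:
  assumes "0 < r"
  shows "(\<Sum>C\<in>barycentric_subdivision (simplex_boundary r). geo ^ card C) / (1 - fps_X)
    = fps_of_poly (eulerian_poly r) / (1 - fps_X :: rat fps) ^ r"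
    and "(\<Sum>C\<in>barycentric_subdivision (simplex_on r). geo ^ card C)
    = fps_of_poly (eulerian_poly r) / (1 - fps_X :: rat fps) ^ r"
proof -
  let ?P = "Pow {1..r} - {{}} - {{1..r}}"
  let ?S = "\<Sum>F\<in>flags ?P. geo ^ length F :: rat fps"
  let ?E = "fps_of_poly (eulerian_poly r) :: rat fps"
  define N where "N = max r (card ?P)"
  have N: "r \<le> N" "length F \<le> N" if "F \<in> flags ?P" for F
    using length_flag_le[OF _ that] by (auto simp: N_def)
  have rN: "r \<le> N" by (simp add: N_def)
  have unit: "(1 - fps_X :: rat fps) ^ r \<noteq> 0"
    using one_minus_X_nonzero by simp
  have "?E = (1 - fps_X) ^ r * ((1 + geo) * ?S)"
    unfolding eulerian_geo[OF rN] sum_chain_count_cone[OF assms rN]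
    by (subst sum_flags_proper_subsets[OF assms rN]) (use N in auto)
  then have E: "?E / (1 - fps_X) ^ r = inverse_one_minus_T * ?S"
    by (simp only: nonzero_mult_div_cancel_left[OF unit] one_plus_geo)
  have bd: "(\<Sum>C\<in>barycentric_subdivision (simplex_boundary r). geo ^ card C) = ?S"
  proof -
    have "simplex_boundary r - {{}} = ?P"
      by (auto simp: simplex_boundary_def simplex_on_def)
    then show ?thesis
      unfolding barycentric_subdivision_def by (simp only: sum_chains_flags finite_Diff finite_Pow_iff finite_atLeastAtMost)
  qed
  have "?S / (1 - fps_X) = inverse_one_minus_T * ?S"
    by (rule div_one_minus_X)
  then show "(\<Sum>C\<in>barycentric_subdivision (simplex_boundary r). geo ^ card C) / (1 - fps_X)
      = ?E / (1 - fps_X) ^ r"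
    unfolding bd E .
  have ins: "simplex_on r - {{}} = insert {1..r} ?P"
    using assms by (auto simp: simplex_on_def)
  show "(\<Sum>C\<in>barycentric_subdivision (simplex_on r). geo ^ card C) = ?E / (1 - fps_X) ^ r"
  proof -
    have "(\<Sum>C\<in>barycentric_subdivision (simplex_on r). geo ^ card C)
        = (\<Sum>F\<in>flags (insert {1..r} ?P). geo ^ length F :: rat fps)"
      unfolding barycentric_subdivision_def ins by (rule sum_chains_flags) simp
    also have "\<dots> = (1 + geo) * ?S"
      by (rule sum_flags_insert_top) auto
    finally show ?thesis unfolding E one_plus_geo .
  qed
qed

theorem sum_subdivided_simplex:
  "(\<Sum>C\<in>barycentric_subdivision (simplex_on r). geo ^ card C)
    = fps_of_poly (eulerian_poly r) / (1 - fps_X :: rat fps) ^ r"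
proof (cases "r = 0")
  case True
  have "barycentric_subdivision (simplex_on 0) = {{}}"
    by (auto simp: barycentric_subdivision_def simplex_on_def chains_def chain_subset_def)
  then show ?thesis
    using True by (simp add: fps_eulerian)
qed (use sum_subdivided_boundary in auto)

section \<open>Counting monomials with a given support\<close>

definition mdeg :: "('v \<Rightarrow>\<^sub>0 nat) \<Rightarrow> nat" where
  "mdeg m = (\<Sum>v\<in>Poly_Mapping.keys m. Poly_Mapping.lookup m v)"

lemma mdeg_superset:
  "finite C \<Longrightarrow> Poly_Mapping.keys m \<subseteq> C \<Longrightarrow> mdeg m = (\<Sum>v\<in>C. Poly_Mapping.lookup m v)"
  unfolding mdeg_def by (rule sum.mono_neutral_left) (auto simp: in_keys_iff)

lemma keys_add_nat:
  "Poly_Mapping.keys (a + b :: 'v \<Rightarrow>\<^sub>0 nat) = Poly_Mapping.keys a \<union> Poly_Mapping.keys b"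
  by (auto simp: in_keys_iff lookup_add)

lemma mdeg_add: "mdeg (a + b) = mdeg a + mdeg b"
proof -
  let ?C = "Poly_Mapping.keys a \<union> Poly_Mapping.keys b"
  show ?thesis
    using mdeg_superset[of ?C a] mdeg_superset[of ?C b] mdeg_superset[of ?C "a + b"]
    by (simp add: keys_add_nat lookup_add sum.distrib)
qed

lemma mdeg_single [simp]: "mdeg (Poly_Mapping.single v i) = i"
  by (cases "i = 0") (simp_all add: mdeg_def)

text \<open>Each variable in the support has an exponent of at least 1 and so contributes a factor
  T/(1-T); the induction splits off the exponent \<open>i\<close> of the variable
  \<open>v\<close>.\<close>

lemma card_monomials_support:
  assumes "finite C"
  shows "finite {m :: 'v \<Rightarrow>\<^sub>0 nat. Poly_Mapping.keys m = C \<and> mdeg m = d}"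
    and "of_nat (card {m :: 'v \<Rightarrow>\<^sub>0 nat. Poly_Mapping.keys m = C \<and> mdeg m = d}) = fps_nth (geo ^ card C :: 'r::comm_ring_1 fps) d"
proof -
  have "finite {m :: 'v \<Rightarrow>\<^sub>0 nat. Poly_Mapping.keys m = C \<and> mdeg m = d} \<and>
    of_nat (card {m :: 'v \<Rightarrow>\<^sub>0 nat. Poly_Mapping.keys m = C \<and> mdeg m = d}) = fps_nth (geo ^ card C :: 'r fps) d"
    using assms
  proof (induction C arbitrary: d)
    case empty
    have "{m :: 'v \<Rightarrow>\<^sub>0 nat. Poly_Mapping.keys m = {} \<and> mdeg m = d} = (if d = 0 then {0} else {})"
      by (auto simp: mdeg_def)
    then show ?case by simp
  next
    case (insert v C)
    let ?M = "\<lambda>C d. {m :: 'v \<Rightarrow>\<^sub>0 nat. Poly_Mapping.keys m = C \<and> mdeg m = d}"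
    let ?S = "SIGMA i:{1..d}. ?M C (d - i)"
    let ?f = "\<lambda>(i, m). m + Poly_Mapping.single v i"
    have v: "Poly_Mapping.lookup m v = 0" if "Poly_Mapping.keys m = C" for m :: "'v \<Rightarrow>\<^sub>0 nat"
      using insert.hyps(2) that by (simp add: in_keys_iff[symmetric] not_in_keys_iff_lookup_eq_zero[symmetric])
    have "bij_betw ?f ?S (?M (insert v C) d)"
    proof (rule bij_betw_imageI)
      show "inj_on ?f ?S"
      proof (rule inj_onI)
        fix p q assume pq: "p \<in> ?S" "q \<in> ?S" "?f p = ?f q"
        obtain i m j m' where ij: "p = (i, m)" "q = (j, m')" by (metis surj_pair)
        have eq: "m + Poly_Mapping.single v i = m' + Poly_Mapping.single v j" using pq(3) ij by simp
        then have "Poly_Mapping.lookup (m + Poly_Mapping.single v i) v = Poly_Mapping.lookup (m' + Poly_Mapping.single v j) v"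
          by (rule arg_cong)
        then have "i = j" using v[of m] v[of m'] pq(1,2) ij by (simp add: lookup_add)
        then show "p = q" using eq ij by simp
      qed
      show "?f ` ?S = ?M (insert v C) d"
      proof (intro equalityI subsetI)
        fix m assume "m \<in> ?f ` ?S"
        then show "m \<in> ?M (insert v C) d"
          by (auto simp: keys_add_nat mdeg_add)
      next
        fix m assume "m \<in> ?M (insert v C) d"
        then have m: "Poly_Mapping.keys m = insert v C" "mdeg m = d" by auto
        define i where "i = Poly_Mapping.lookup m v"
        define m' where "m' = m - Poly_Mapping.single v i"
        have i: "i > 0" using m(1) unfolding i_def by (metis gr0I in_keys_iff insertI1)
        have mm': "m = m' + Poly_Mapping.single v i"
          by (rule poly_mapping_eqI) (auto simp: m'_def i_def lookup_add lookup_minus lookup_single when_def)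
        have "Poly_Mapping.lookup m' v = 0"
          by (simp add: m'_def i_def lookup_minus)
        then have "v \<notin> Poly_Mapping.keys m'" by (simp add: in_keys_iff)
        moreover have "Poly_Mapping.keys m' \<union> {v} = insert v C"
          using m(1) i unfolding mm' keys_add_nat by simp
        ultimately have "Poly_Mapping.keys m' = C"
          using insert.hyps(2) by (metis Un_insert_right insert_ident sup_bot_right)
        moreover have "mdeg m' + i = d" using m(2) unfolding mm' by (simp add: mdeg_add)
        ultimately have "(i, m') \<in> ?S" using i by auto
        then show "m \<in> ?f ` ?S" using mm' by (intro image_eqI[of _ _ "(i, m')"]) auto
      qed
    qed
    moreover have "finite ?S" using insert.IH by auto
    ultimately have fin: "finite (?M (insert v C) d)" and "card (?M (insert v C) d) = card ?S"
      using bij_betw_finite[of ?f ?S "?M (insert v C) d"] bij_betw_same_card[of ?f ?S "?M (insert v C) d"] by simp_all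
    then have "of_nat (card (?M (insert v C) d)) = (\<Sum>i=1..d. of_nat (card (?M C (d - i))) :: 'r)"
      using insert.IH by (simp add: card_SigmaI)
    also have "\<dots> = (\<Sum>i=1..d. fps_nth (geo ^ card C) (d - i))"
      using insert.IH by simp
    also have "\<dots> = (\<Sum>i=0..d. fps_nth geo i * fps_nth (geo ^ card C) (d - i))"
      by (rule sum.mono_neutral_cong_left) (auto simp: inverse_one_minus_T_def)
    also have "\<dots> = fps_nth (geo ^ card (insert v C)) d"
      using insert.hyps by (simp add: fps_mult_nth)
    finally show ?case using fin by blast
  qed
  then show "finite {m :: 'v \<Rightarrow>\<^sub>0 nat. Poly_Mapping.keys m = C \<and> mdeg m = d}"
    and "of_nat (card {m :: 'v \<Rightarrow>\<^sub>0 nat. Poly_Mapping.keys m = C \<and> mdeg m = d}) = fps_nth (geo ^ card C :: 'r fps) d"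
    by auto
qed

lemma card_monomials_of_complex:
  assumes "finite D" "\<And>C. C \<in> D \<Longrightarrow> finite C"
  shows "finite {m :: 'v \<Rightarrow>\<^sub>0 nat. Poly_Mapping.keys m \<in> D \<and> mdeg m = d}"
    and "of_nat (card {m :: 'v \<Rightarrow>\<^sub>0 nat. Poly_Mapping.keys m \<in> D \<and> mdeg m = d}) = fps_nth (\<Sum>C\<in>D. geo ^ card C :: 'r::comm_ring_1 fps) d"
proof -
  have eq: "{m :: 'v \<Rightarrow>\<^sub>0 nat. Poly_Mapping.keys m \<in> D \<and> mdeg m = d} = (\<Union>C\<in>D. {m :: 'v \<Rightarrow>\<^sub>0 nat. Poly_Mapping.keys m = C \<and> mdeg m = d})"
    by auto
  show "finite {m :: 'v \<Rightarrow>\<^sub>0 nat. Poly_Mapping.keys m \<in> D \<and> mdeg m = d}"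
    unfolding eq using assms card_monomials_support(1) by blast
  have "card (\<Union>C\<in>D. {m :: 'v \<Rightarrow>\<^sub>0 nat. Poly_Mapping.keys m = C \<and> mdeg m = d}) = (\<Sum>C\<in>D. card {m :: 'v \<Rightarrow>\<^sub>0 nat. Poly_Mapping.keys m = C \<and> mdeg m = d})"
    by (rule card_UN_disjoint) (use assms card_monomials_support(1) in auto)
  then show "of_nat (card {m :: 'v \<Rightarrow>\<^sub>0 nat. Poly_Mapping.keys m \<in> D \<and> mdeg m = d}) = fps_nth (\<Sum>C\<in>D. geo ^ card C :: 'r fps) d"
    unfolding eq fps_sum_nth using assms(2) by (simp add: card_monomials_support(2))
qed

section \<open>Hilbert series of Stanley--Reisner rings\<close>

text \<open>The span of the monomials in \<open>M\<close>. The polynomial ring, its homogeneous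
  components and the Stanley-Reisner ideal all have this form, which reduces ideal membership to
  supports.\<close>

definition polys_on :: "('v \<Rightarrow>\<^sub>0 nat) set \<Rightarrow> (('v \<Rightarrow>\<^sub>0 nat) \<Rightarrow>\<^sub>0 'k::field) set" where
  "polys_on M = {p. Poly_Mapping.keys p \<subseteq> M}"

lemma polys_on_closed:
  "0 \<in> polys_on M" "p \<in> polys_on M \<Longrightarrow> q \<in> polys_on M \<Longrightarrow> p + q \<in> polys_on M"
  "p \<in> polys_on M \<Longrightarrow> - p \<in> polys_on M" "m \<in> M \<Longrightarrow> Poly_Mapping.single m c \<in> polys_on M"
  using keys_add[of p q] by (auto simp: polys_on_def)

lemma polys_on_mult:
  assumes "p \<in> polys_on M" "q \<in> polys_on N" "\<And>a b. a \<in> M \<Longrightarrow> b \<in> N \<Longrightarrow> a + b \<in> K"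
  shows "p * q \<in> polys_on K"
  using keys_mult[of p q] assms by (fastforce simp: polys_on_def)

lemma poly_eq_sum_monomials:
  "p = (\<Sum>m\<in>Poly_Mapping.keys p. Poly_Mapping.single m (Poly_Mapping.lookup p m))"
proof (rule poly_mapping_eqI)
  fix k
  have "(\<Sum>m\<in>Poly_Mapping.keys p. Poly_Mapping.lookup (Poly_Mapping.single m (Poly_Mapping.lookup p m)) k)
      = (\<Sum>m\<in>Poly_Mapping.keys p. if m = k then Poly_Mapping.lookup p k else 0)"
    by (intro sum.cong) (auto simp: lookup_single when_def)
  also have "\<dots> = Poly_Mapping.lookup p k"
    by (simp add: in_keys_iff)
  finally show "Poly_Mapping.lookup p k
      = Poly_Mapping.lookup (\<Sum>m\<in>Poly_Mapping.keys p. Poly_Mapping.single m (Poly_Mapping.lookup p m)) k"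
    by (simp add: lookup_sum)
qed

lemma poly_ring_simps [simp]:
  "mult (poly_ring X) = (*)" "one (poly_ring X) = 1" "zero (poly_ring X) = 0" "add (poly_ring X) = (+)"
  by (simp_all add: poly_ring_def)

lemma carrier_poly_ring: "carrier (poly_ring X) = polys_on {m. Poly_Mapping.keys m \<subseteq> X}"
  by (auto simp: poly_ring_def polys_on_def)

lemma cring_poly_ring: "cring (poly_ring X :: (('v \<Rightarrow>\<^sub>0 nat) \<Rightarrow>\<^sub>0 'k::field) ring)"
proof (rule cringI)
  let ?R = "poly_ring X :: (('v \<Rightarrow>\<^sub>0 nat) \<Rightarrow>\<^sub>0 'k) ring"
  show "abelian_group ?R"
  proof (rule abelian_groupI)
    fix x assume x: "x \<in> carrier ?R"
    show "\<exists>y\<in>carrier ?R. y \<oplus>\<^bsub>?R\<^esub> x = \<zero>\<^bsub>?R\<^esub>"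
      by (rule bexI[of _ "- x"]) (use x in \<open>auto simp: carrier_poly_ring polys_on_closed\<close>)
  qed (auto simp: carrier_poly_ring polys_on_closed add.assoc add.commute)
  show "comm_monoid ?R"
  proof (rule comm_monoidI)
    show "\<one>\<^bsub>?R\<^esub> \<in> carrier ?R" by (simp add: carrier_poly_ring polys_on_def)
    fix x y assume "x \<in> carrier ?R" "y \<in> carrier ?R"
    then show "x \<otimes>\<^bsub>?R\<^esub> y \<in> carrier ?R"
      unfolding carrier_poly_ring poly_ring_simps by (rule polys_on_mult) (auto simp: keys_add_nat)
  qed (simp_all add: mult.assoc mult.commute)
qed (simp add: distrib_right)

lemma prod_var: "finite s \<Longrightarrow> (\<Prod>v\<in>s. var v) = Poly_Mapping.single (\<Sum>v\<in>s. Poly_Mapping.single v 1) 1"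
  by (induction s rule: finite_induct) (simp_all add: var_def mult_single)

lemma lookup_sum_singles:
  "finite s \<Longrightarrow> Poly_Mapping.lookup (\<Sum>v\<in>s. Poly_Mapping.single v (1::nat)) u = (if u \<in> s then 1 else 0)"
  by (simp add: lookup_sum lookup_single when_def)

lemma homogeneous_iff: "homogeneous d p \<longleftrightarrow> p \<in> polys_on {m. mdeg m = d}"
  by (auto simp: homogeneous_def polys_on_def mdeg_def)

locale simplicial_complex =
  fixes D :: "'v set set" and T :: "'k::field itself"
  assumes finite_vertices: "finite (\<Union>D)"
    and empty_face: "{} \<in> D"
    and subface: "s \<in> D \<Longrightarrow> t \<subseteq> s \<Longrightarrow> t \<in> D"
begin

abbreviation R :: "(('v \<Rightarrow>\<^sub>0 nat) \<Rightarrow>\<^sub>0 'k) ring" where "R \<equiv> poly_ring (\<Union>D)"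

abbreviation I :: "(('v \<Rightarrow>\<^sub>0 nat) \<Rightarrow>\<^sub>0 'k) set" where "I \<equiv> stanley_reisner_ideal D"

sublocale R: cring R by (rule cring_poly_ring)

lemma a_inv_R: "p \<in> carrier R \<Longrightarrow> \<ominus>\<^bsub>R\<^esub> p = - p"
  by (rule R.minus_equality) (auto simp: carrier_poly_ring polys_on_closed)

definition nonfaces :: "('v \<Rightarrow>\<^sub>0 nat) set" where
  "nonfaces = {m. Poly_Mapping.keys m \<subseteq> \<Union>D \<and> Poly_Mapping.keys m \<notin> D}"

lemma ideal_nonfaces: "ideal (polys_on nonfaces) R"
proof (rule idealI)
  show "ring R" by (rule R.ring_axioms)
  have sub: "polys_on nonfaces \<subseteq> carrier R"
    by (auto simp: carrier_poly_ring polys_on_def nonfaces_def)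
  show "subgroup (polys_on nonfaces) (add_monoid R)"
  proof (rule R.add.subgroupI)
    show "polys_on nonfaces \<subseteq> carrier R" by (rule sub)
    show "polys_on nonfaces \<noteq> ({} :: (('v \<Rightarrow>\<^sub>0 nat) \<Rightarrow>\<^sub>0 'k) set)" using polys_on_closed(1) by blast
    fix p q :: "('v \<Rightarrow>\<^sub>0 nat) \<Rightarrow>\<^sub>0 'k"
    assume p: "p \<in> polys_on nonfaces"
    then show "\<ominus>\<^bsub>R\<^esub> p \<in> polys_on nonfaces" using sub by (auto simp: a_inv_R polys_on_closed)
    assume "q \<in> polys_on nonfaces"
    then show "p \<oplus>\<^bsub>R\<^esub> q \<in> polys_on nonfaces" using p by (simp add: polys_on_closed)
  qed
  have mult: "x * a \<in> polys_on nonfaces" if a: "a \<in> polys_on nonfaces" and x: "x \<in> carrier R"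
    for a x :: "('v \<Rightarrow>\<^sub>0 nat) \<Rightarrow>\<^sub>0 'k"
  proof (rule polys_on_mult[OF x[unfolded carrier_poly_ring] a])
    fix m n :: "'v \<Rightarrow>\<^sub>0 nat" assume "m \<in> {m. Poly_Mapping.keys m \<subseteq> \<Union>D}" "n \<in> nonfaces"
    then show "m + n \<in> nonfaces"
      using subface by (auto simp: nonfaces_def keys_add_nat)
  qed
  fix a x :: "('v \<Rightarrow>\<^sub>0 nat) \<Rightarrow>\<^sub>0 'k"
  assume "a \<in> polys_on nonfaces" "x \<in> carrier R"
  then show "x \<otimes>\<^bsub>R\<^esub> a \<in> polys_on nonfaces" "a \<otimes>\<^bsub>R\<^esub> x \<in> polys_on nonfaces"
    using mult by (simp_all add: mult.commute)
qed

text \<open>Nonfaces are closed under enlarging, so these polynomials form an ideal; and a monomial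
  whose support is a nonface is a multiple of the squarefree monomial on its support, which is a
  generator.\<close>

lemma stanley_reisner_ideal_eq: "I = polys_on nonfaces"
proof
  let ?G = "{\<Prod>v\<in>s. var v | s. finite s \<and> s \<subseteq> \<Union>D \<and> s \<notin> D} :: (('v \<Rightarrow>\<^sub>0 nat) \<Rightarrow>\<^sub>0 'k) set"
  have keys_s: "Poly_Mapping.keys (\<Sum>v\<in>s. Poly_Mapping.single v (1::nat)) = s" if "finite s" for s :: "'v set"
    using that by (auto simp: in_keys_iff lookup_sum_singles simp del: One_nat_def split: if_splits)
  have G: "?G \<subseteq> polys_on nonfaces"
  proof
    fix p assume "p \<in> ?G"
    then obtain s where s: "finite s" "s \<subseteq> \<Union>D" "s \<notin> D" "p = (\<Prod>v\<in>s. var v)" by blast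
    then show "p \<in> polys_on nonfaces"
      unfolding s(4) prod_var[OF s(1)]
      by (intro polys_on_closed(4)) (simp add: nonfaces_def keys_s del: One_nat_def)
  qed
  show "I \<subseteq> polys_on nonfaces"
    unfolding stanley_reisner_ideal_def by (rule R.genideal_minimal[OF ideal_nonfaces G])
  have "ideal I R"
    unfolding stanley_reisner_ideal_def
    by (rule R.genideal_ideal) (use G ideal_nonfaces in \<open>auto dest: ideal.Icarr\<close>)
  then interpret I: ideal I R .
  have GI: "?G \<subseteq> I"
    unfolding stanley_reisner_ideal_def
    by (rule R.genideal_self) (use G ideal_nonfaces in \<open>auto dest: ideal.Icarr\<close>)
  have mono: "Poly_Mapping.single m c \<in> I" if m: "m \<in> nonfaces" for m c
  proof -
    let ?s = "Poly_Mapping.keys m"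
    let ?e = "\<Sum>v\<in>?s. Poly_Mapping.single v (1::nat)"
    have "(\<Prod>v\<in>?s. var v) \<in> ?G"
      by (rule CollectI, rule exI[of _ ?s]) (use m in \<open>simp add: nonfaces_def\<close>)
    then have "(\<Prod>v\<in>?s. var v) \<in> I" using GI by blast
    moreover have "Poly_Mapping.single (m - ?e) c \<in> carrier R"
      unfolding carrier_poly_ring
      using m by (intro polys_on_closed(4)) (auto simp: nonfaces_def in_keys_iff lookup_minus)
    ultimately have "Poly_Mapping.single (m - ?e) c * (\<Prod>v\<in>?s. var v) \<in> I"
      using I.I_l_closed by simp
    moreover have "m - ?e + ?e = m"
      by (rule poly_mapping_eqI)
        (auto simp: lookup_add lookup_minus lookup_sum_singles in_keys_iff simp del: One_nat_def)
    ultimately show ?thesis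
      by (simp add: prod_var mult_single)
  qed
  have sum: "(\<Sum>m\<in>S. Poly_Mapping.single m (f m)) \<in> I" if "finite S" "S \<subseteq> nonfaces" for S f
    using that
  proof (induction S)
    case empty
    then show ?case using I.zero_closed by simp
  next
    case (insert m S)
    then show ?case using I.a_closed[OF mono] by simp
  qed
  show "polys_on nonfaces \<subseteq> I"
  proof
    fix p :: "('v \<Rightarrow>\<^sub>0 nat) \<Rightarrow>\<^sub>0 'k" assume "p \<in> polys_on nonfaces"
    then show "p \<in> I"
      using sum[of "Poly_Mapping.keys p" "Poly_Mapping.lookup p"] poly_eq_sum_monomials[of p]
      by (simp add: polys_on_def)
  qed
qed

abbreviation Q :: "(('v \<Rightarrow>\<^sub>0 nat) \<Rightarrow>\<^sub>0 'k) set ring" where "Q \<equiv> stanley_reisner_ring D"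

lemma ideal_I: "ideal I R"
  using ideal_nonfaces by (simp add: stanley_reisner_ideal_eq)

lemma hom_sr_class: "ring_hom_ring R Q (sr_class D)"
proof -
  have "ring_hom_ring R Q ((+>\<^bsub>R\<^esub>) I)"
    unfolding stanley_reisner_ring_def by (rule ideal.rcos_ring_hom_ring[OF ideal_I])
  moreover have "sr_class D = (+>\<^bsub>R\<^esub>) I" by (rule ext) (simp add: sr_class_def)
  ultimately show ?thesis by simp
qed

lemma sr_class_eq_iff:
  assumes "p \<in> carrier R" "q \<in> carrier R"
  shows "sr_class D p = sr_class D q \<longleftrightarrow> p - q \<in> I"
proof -
  have "p \<ominus>\<^bsub>R\<^esub> q = p - q"
    using assms by (simp add: a_minus_def a_inv_R)
  then show ?thesis
    using R.quotient_eq_iff_same_a_r_cos[OF ideal_I assms] by (simp add: sr_class_def)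
qed

abbreviation K :: "(('v \<Rightarrow>\<^sub>0 nat) \<Rightarrow>\<^sub>0 'k) set" where "K \<equiv> range const_poly"

lemma const_poly_in_carrier: "const_poly c \<in> carrier R"
  unfolding carrier_poly_ring const_poly_def by (rule polys_on_closed) simp

lemma subfield_K: "subfield K R"
proof (rule R.subfieldI)
  have add: "const_poly a + const_poly b = const_poly (a + b)" for a b :: 'k
    by (simp add: const_poly_def single_add)
  have mult: "const_poly a * const_poly b = (const_poly (a * b) :: ('v \<Rightarrow>\<^sub>0 nat) \<Rightarrow>\<^sub>0 'k)" for a b :: 'k
    by (simp add: const_poly_def mult_single)
  have one: "1 = (const_poly 1 :: ('v \<Rightarrow>\<^sub>0 nat) \<Rightarrow>\<^sub>0 'k)"
    by (simp add: const_poly_def)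
  show "subcring K R"
  proof (rule R.subcringI'[OF R.subringI])
    show "K \<subseteq> carrier R" using const_poly_in_carrier by blast
    show "\<one>\<^bsub>R\<^esub> \<in> K" using one by simp
    fix h assume "h \<in> K"
    then obtain a where "h = const_poly a" by blast
    then have "\<ominus>\<^bsub>R\<^esub> h = const_poly (- a)"
      using const_poly_in_carrier[of a] by (simp add: a_inv_R const_poly_def single_uminus)
    then show "\<ominus>\<^bsub>R\<^esub> h \<in> K" by simp
  next
    fix h1 h2 assume "h1 \<in> K" "h2 \<in> K"
    then show "h1 \<otimes>\<^bsub>R\<^esub> h2 \<in> K" "h1 \<oplus>\<^bsub>R\<^esub> h2 \<in> K"
      by (auto simp: add mult)
  qed
  show "Units (R\<lparr>carrier := K\<rparr>) = K - {\<zero>\<^bsub>R\<^esub>}"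
  proof (intro equalityI subsetI)
    fix x assume "x \<in> Units (R\<lparr>carrier := K\<rparr>)"
    then show "x \<in> K - {\<zero>\<^bsub>R\<^esub>}" by (auto simp: Units_def)
  next
    fix x assume x: "x \<in> K - {\<zero>\<^bsub>R\<^esub>}"
    then obtain a where a: "x = const_poly a" by blast
    with x have "a \<noteq> 0" by (auto simp: const_poly_def)
    then have "const_poly (inverse a) * x = 1" "x * const_poly (inverse a) = 1"
      by (simp_all add: a mult one)
    then show "x \<in> Units (R\<lparr>carrier := K\<rparr>)"
      using a by (auto simp: Units_def)
  qed
qed

lemma Span_monomials:
  assumes "set ms \<subseteq> {m. Poly_Mapping.keys m \<subseteq> \<Union>D}"
  shows "R.Span K (map (\<lambda>m. Poly_Mapping.single m 1) ms) = polys_on (set ms)"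
  using assms
proof (induction ms)
  case Nil
  show ?case by (auto simp: polys_on_def)
next
  case (Cons m ms)
  have *: "const_poly c * Poly_Mapping.single m 1 = Poly_Mapping.single m (c :: 'k)" for c
    by (simp add: const_poly_def mult_single)
  have "R.line_extension K (Poly_Mapping.single m 1) (polys_on (set ms)) = polys_on (set (m # ms))"
  proof (intro equalityI subsetI)
    fix p assume "p \<in> R.line_extension K (Poly_Mapping.single m 1) (polys_on (set ms))"
    then obtain c q where "q \<in> polys_on (set ms)" "p = Poly_Mapping.single m c + q"
      unfolding R.line_extension_mem_iff by (auto simp: *)
    then show "p \<in> polys_on (set (m # ms))"
      using keys_add[of "Poly_Mapping.single m c" q] by (auto simp: polys_on_def split: if_splits)
  next
    fix p :: "('v \<Rightarrow>\<^sub>0 nat) \<Rightarrow>\<^sub>0 'k" assume p: "p \<in> polys_on (set (m # ms))"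
    define q where "q = p - Poly_Mapping.single m (Poly_Mapping.lookup p m)"
    have "q \<in> polys_on (set ms)"
      using p by (auto simp: q_def polys_on_def in_keys_iff lookup_minus lookup_single when_def split: if_splits)
    moreover have "p = const_poly (Poly_Mapping.lookup p m) * Poly_Mapping.single m 1 + q"
      by (simp add: q_def *)
    ultimately show "p \<in> R.line_extension K (Poly_Mapping.single m 1) (polys_on (set ms))"
      unfolding R.line_extension_mem_iff by (metis poly_ring_simps(1,4) rangeI)
  qed
  then show ?case using Cons by simp
qed

lemma independent_monomials:
  assumes "set ms \<subseteq> {m. Poly_Mapping.keys m \<subseteq> \<Union>D}" "distinct ms"
  shows "R.independent K (map (\<lambda>m. Poly_Mapping.single m 1) ms)"
  using assms
proof (induction ms)
  case (Cons m ms)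
  have "Poly_Mapping.single m 1 \<notin> R.Span K (map (\<lambda>m. Poly_Mapping.single m 1) ms)"
    using Cons.prems by (subst Span_monomials) (auto simp: polys_on_def)
  moreover have "Poly_Mapping.single m 1 \<in> carrier R"
    unfolding carrier_poly_ring using Cons.prems by (intro polys_on_closed) auto
  ultimately show ?case
    using Cons by (simp add: R.li_Cons del: R.Span.simps)
qed (simp add: R.li_Nil)

text \<open>The classes of the degree \<open>d\<close> monomials supported on faces form a basis:
  their span meets the ideal only in 0, and every homogeneous polynomial is congruent to its part on
  these monomials.\<close>

theorem dim_graded_component:
  assumes fin: "finite {m. Poly_Mapping.keys m \<in> D \<and> mdeg m = d}"
  shows "ring.dim Q (range (\<lambda>c. sr_class D (const_poly c))) (sr_class D ` {p \<in> carrier R. homogeneous d p})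
    = card {m. Poly_Mapping.keys m \<in> D \<and> mdeg m = d}"
proof -
  interpret h: ring_hom_ring R Q "sr_class D" by (rule hom_sr_class)
  let ?M = "{m. Poly_Mapping.keys m \<in> D \<and> mdeg m = d}"
  obtain ms where ms: "set ms = ?M" "distinct ms"
    using finite_distinct_list[OF fin] by blast
  let ?Us = "map (\<lambda>m. Poly_Mapping.single m 1) ms :: (('v \<Rightarrow>\<^sub>0 nat) \<Rightarrow>\<^sub>0 'k) list"
  have msX: "set ms \<subseteq> {m. Poly_Mapping.keys m \<subseteq> \<Union>D}" using ms by blast
  have ind: "R.independent K ?Us" by (rule independent_monomials[OF msX ms(2)])
  have span: "R.Span K ?Us = polys_on ?M" using Span_monomials[OF msX] ms(1) by simp
  have sub: "polys_on ?M \<subseteq> carrier R" by (auto simp: carrier_poly_ring polys_on_def)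
  \<comment> \<open>Since the empty set is a face, 1 is not in the ideal; this is what makes the
    image of the coefficient field a field again.\<close>
  have one_zero: "\<one>\<^bsub>Q\<^esub> \<noteq> \<zero>\<^bsub>Q\<^esub>"
  proof
    assume "\<one>\<^bsub>Q\<^esub> = \<zero>\<^bsub>Q\<^esub>"
    then have "sr_class D (1 :: ('v \<Rightarrow>\<^sub>0 nat) \<Rightarrow>\<^sub>0 'k) = sr_class D 0"
      using h.hom_one h.hom_zero by simp
    then have "1 - 0 \<in> I"
      using sr_class_eq_iff[of 1 0] R.one_closed R.zero_closed by simp
    then show False
      using empty_face by (auto simp: stanley_reisner_ideal_eq polys_on_def nonfaces_def)
  qed
  have inj: "inj_on (sr_class D) (polys_on ?M :: (('v \<Rightarrow>\<^sub>0 nat) \<Rightarrow>\<^sub>0 'k) set)"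
  proof (rule inj_onI)
    fix p q :: "('v \<Rightarrow>\<^sub>0 nat) \<Rightarrow>\<^sub>0 'k"
    assume pq: "p \<in> polys_on ?M" "q \<in> polys_on ?M" "sr_class D p = sr_class D q"
    then have "p - q \<in> I" using sr_class_eq_iff[of p q] sub by blast
    moreover have "p - q \<in> polys_on ?M"
      using polys_on_closed(2)[OF pq(1) polys_on_closed(3)[OF pq(2)]] by simp
    ultimately have "Poly_Mapping.keys (p - q) \<subseteq> nonfaces \<inter> ?M"
      by (simp add: stanley_reisner_ideal_eq polys_on_def)
    also have "\<dots> = {}" by (auto simp: nonfaces_def)
    finally show "p = q" by simp
  qed
  have image: "sr_class D ` {p \<in> carrier R. homogeneous d p} = sr_class D ` polys_on ?M"
  proof (intro equalityI subsetI)
    fix x assume "x \<in> sr_class D ` {p \<in> carrier R. homogeneous d p}"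
    then obtain p where p: "p \<in> carrier R" "p \<in> polys_on {m. mdeg m = d}" "x = sr_class D p"
      by (auto simp: homogeneous_iff)
    \<comment> \<open>The part of \<open>p\<close> on faces; the remaining monomials lie in the
      ideal.\<close>
    define q where "q = (\<Sum>m\<in>Poly_Mapping.keys p \<inter> ?M. Poly_Mapping.single m (Poly_Mapping.lookup p m))"
    have lookup: "Poly_Mapping.lookup q k = (if k \<in> ?M then Poly_Mapping.lookup p k else 0)" for k
    proof -
      have "Poly_Mapping.lookup q k = (\<Sum>m\<in>Poly_Mapping.keys p \<inter> ?M. if m = k then Poly_Mapping.lookup p k else 0)"
        unfolding q_def lookup_sum by (intro sum.cong) (auto simp: lookup_single when_def)
      then show ?thesis by (auto simp: in_keys_iff)
    qed
    have q: "q \<in> polys_on ?M"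
      by (auto simp: polys_on_def in_keys_iff lookup split: if_splits)
    have "p - q \<in> I"
      using p(1,2) by (auto simp: stanley_reisner_ideal_eq carrier_poly_ring polys_on_def nonfaces_def in_keys_iff
          lookup_minus lookup subset_iff split: if_splits)
    then have "x = sr_class D q"
      using sr_class_eq_iff[of p q] p q sub by blast
    then show "x \<in> sr_class D ` polys_on ?M" using q by blast
  next
    fix x :: "(('v \<Rightarrow>\<^sub>0 nat) \<Rightarrow>\<^sub>0 'k) set" assume "x \<in> sr_class D ` polys_on ?M"
    then show "x \<in> sr_class D ` {p \<in> carrier R. homogeneous d p}"
      using sub by (auto simp: homogeneous_iff polys_on_def)
  qed
  have Us: "set ?Us \<subseteq> carrier R" by (rule R.independent_in_carrier[OF ind])
  have K: "subfield (sr_class D ` K) Q"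
    by (rule h.img_is_subfield(2)[OF subfield_K one_zero])
  have "h.S.independent (sr_class D ` K) (map (sr_class D) ?Us)"
    by (rule h.inj_hom_preserves_independent[OF subfield_K one_zero _ ind]) (simp only: span inj)
  then have "h.S.dimension (length (map (sr_class D) ?Us)) (sr_class D ` K) (h.S.Span (sr_class D ` K) (map (sr_class D) ?Us))"
    by (rule h.S.dimension_independent)
  moreover have "h.S.Span (sr_class D ` K) (map (sr_class D) ?Us) = sr_class D ` polys_on ?M"
    using h.Span_hom[OF subfieldE(3)[OF subfield_K] Us] span by simp
  ultimately have "(h.S.dim over (sr_class D ` K)) (sr_class D ` polys_on ?M) = length ms"
    using h.S.dimI[OF K] by simp
  then show ?thesis
    using ms distinct_card[OF ms(2)] by (simp add: over_def image image_image)
qed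

theorem stanley_reisner_hilbert_eq:
  "stanley_reisner_hilbert TYPE('k) D = (\<Sum>C\<in>D. geo ^ card C)"
proof (rule fps_ext)
  fix d
  have D: "finite D" by (rule finite_subset[of _ "Pow (\<Union>D)"]) (use finite_vertices in auto)
  have fin: "finite C" if "C \<in> D" for C
    using that finite_vertices by (meson Union_upper finite_subset)
  show "fps_nth (stanley_reisner_hilbert TYPE('k) D) d = fps_nth (\<Sum>C\<in>D. geo ^ card C) d"
    unfolding stanley_reisner_hilbert_def fps_nth_Abs_fps
    by (subst dim_graded_component) (rule card_monomials_of_complex[OF D fin]; assumption)+
qed

end

lemma simplicial_complex_barycentric_subdivision:
  assumes "finite (\<Union>P)"
  shows "simplicial_complex (barycentric_subdivision P)"
proof
  have "\<Union>(barycentric_subdivision P) \<subseteq> P"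
    by (auto simp: barycentric_subdivision_def chains_def)
  moreover have "finite P"
    by (rule finite_subset[of _ "Pow (\<Union>P)"]) (use assms in auto)
  ultimately show "finite (\<Union>(barycentric_subdivision P))" by (rule finite_subset)
  show "{} \<in> barycentric_subdivision P"
    by (auto simp: barycentric_subdivision_def chains_def chain_subset_def)
next
  fix s t assume s: "s \<in> barycentric_subdivision P" and t: "t \<subseteq> s"
  then have "finite t" "t \<subseteq> P - {{}}" "\<forall>x\<in>s. \<forall>y\<in>s. x \<subseteq> y \<or> y \<subseteq> x"
    using finite_subset[OF t] by (auto simp: barycentric_subdivision_def chains_def chain_subset_def)
  then show "t \<in> barycentric_subdivision P"
    using t unfolding barycentric_subdivision_def chains_def chain_subset_def by blast
qed

section \<open>Coxeter arrangements are reflection arrangements\<close>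

lemma reflection_hyperplane:
  fixes a :: "'a::euclidean_space"
  assumes a: "norm a = 1"
  shows "reflection {y. a \<bullet> y = b} x = x - (2 * (a \<bullet> x - b)) *\<^sub>R a"
proof -
  \<comment> \<open>The foot of the perpendicular; the Cauchy-Schwarz inequality shows that no point
    of the hyperplane is closer.\<close>
  let ?p = "x - (a \<bullet> x - b) *\<^sub>R a"
  have aa: "a \<bullet> a = 1" using a by (simp add: norm_eq_1)
  have "?p = closest_point {y. a \<bullet> y = b} x"
  proof (rule closest_point_unique)
    show "convex {y. a \<bullet> y = b}" by (rule convex_hyperplane)
    show "closed {y. a \<bullet> y = b}" by (rule closed_hyperplane)
    show "?p \<in> {y. a \<bullet> y = b}" by (simp add: inner_simps aa)
    show "\<forall>z\<in>{y. a \<bullet> y = b}. dist x ?p \<le> dist x z"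
    proof
      fix z assume "z \<in> {y. a \<bullet> y = b}"
      then have "\<bar>a \<bullet> x - b\<bar> = \<bar>a \<bullet> (x - z)\<bar>" by (simp add: inner_simps)
      also have "\<dots> \<le> norm a * norm (x - z)" by (rule Cauchy_Schwarz_ineq2)
      finally show "dist x ?p \<le> dist x z" by (simp add: dist_norm a)
    qed
  qed
  then show ?thesis
    by (simp add: reflection_def scaleR_2 algebra_simps flip: \<open>?p = _\<close>)
qed

lemma hyperplane_unit_normal:
  fixes H :: "'a::euclidean_space set"
  assumes "affine H" "aff_dim H = int (DIM('a)) - 1"
  obtains a b where "norm a = 1" "H = {y. a \<bullet> y = b}"
proof -
  obtain a b where ab: "a \<noteq> 0" "H = {y. a \<bullet> y = b}"
    using aff_dim_eq_hyperplane[of H] assms by (auto simp: affine_hull_eq[THEN iffD2])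
  show thesis
  proof (rule that[of "(1 / norm a) *\<^sub>R a" "b / norm a"])
    show "H = {y. ((1 / norm a) *\<^sub>R a) \<bullet> y = b / norm a}"
      using ab by (auto simp: field_simps)
  qed (use ab(1) in simp)
qed

text \<open>The centroid of an orbit of the finite reflection group is fixed by all reflections.\<close>

lemma coxeter_arrangement_central:
  fixes A :: "'a::euclidean_space set set"
  assumes A: "coxeter_arrangement A"
  obtains c where "\<And>H. H \<in> A \<Longrightarrow> c \<in> H"
proof -
  let ?B = "BijGroup (UNIV :: 'a set)"
  let ?G = "carrier (reflection_group A)"
  have arr: "affine H" "aff_dim H = int (DIM('a)) - 1" if "H \<in> A" for H
    using A that by (auto simp: coxeter_arrangement_def arrangement_def)
  have inv: "reflection H (reflection H x) = x" if H: "H \<in> A" for H x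
  proof -
    obtain a b where ab: "norm a = 1" "H = {y. a \<bullet> y = b}"
      using hyperplane_unit_normal[OF arr[OF H]] .
    then have "a \<bullet> a = 1" by (simp add: norm_eq_1)
    then show ?thesis
      unfolding ab(2) reflection_hyperplane[OF ab(1)] by (simp add: inner_simps algebra_simps)
  qed
  have bij: "bij (reflection H)" if "H \<in> A" for H
    by (rule o_bij[of "reflection H"]) (auto simp: fun_eq_iff inv[OF that])
  interpret B: group ?B by (rule group_BijGroup)
  have G: "?G = generate ?B (carrier ?B \<inter> reflection ` A)"
    by (simp add: reflection_group_def carrier_subgroup_generated)
  have refl_G: "reflection H \<in> ?G" if "H \<in> A" for H
    unfolding G using that bij by (intro generate.incl) (auto simp: BijGroup_def Bij_def extensional_def)
  have G_Bij: "?G \<subseteq> Bij UNIV"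
  proof -
    have "generate ?B (carrier ?B \<inter> reflection ` A) \<subseteq> carrier ?B"
      by (rule B.generate_incl) auto
    then show ?thesis unfolding G by (simp add: BijGroup_def)
  qed
  have comp: "g \<circ> h \<in> ?G" if "g \<in> ?G" "h \<in> ?G" for g h
  proof -
    have "g \<otimes>\<^bsub>?B\<^esub> h \<in> ?G" using that unfolding G by (rule generate.eng)
    moreover have "g \<otimes>\<^bsub>?B\<^esub> h = g \<circ> h"
      using that G_Bij by (auto simp: BijGroup_def compose_def fun_eq_iff)
    ultimately show ?thesis by simp
  qed
  \<comment> \<open>The orbit of the origin. It is taken as a set, so that each reflection permutes
    it.\<close>
  define S where "S = (\<lambda>g. g 0) ` ?G"
  have fin: "finite S" using A by (simp add: S_def coxeter_arrangement_def)
  have "\<one>\<^bsub>?B\<^esub> \<in> ?G" unfolding G by (rule generate.one)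
  then have S: "S \<noteq> {}" unfolding S_def by blast
  define c where "c = (1 / of_nat (card S)) *\<^sub>R \<Sum>S"
  have "c \<in> H" if H: "H \<in> A" for H
  proof -
    let ?s = "reflection H"
    obtain a b where ab: "norm a = 1" "H = {y. a \<bullet> y = b}"
      using hyperplane_unit_normal[OF arr[OF H]] .
    have inj: "inj_on ?s S" using bij[OF H] by (meson bij_is_inj inj_on_subset subset_UNIV)
    have "?s ` S \<subseteq> S"
    proof
      fix x assume "x \<in> ?s ` S"
      then obtain g where g: "g \<in> ?G" "x = (?s \<circ> g) 0" by (auto simp: S_def)
      then show "x \<in> S" using comp[OF refl_G[OF H] g(1)] unfolding S_def by blast
    qed
    then have "?s ` S = S" by (rule endo_inj_surj[OF fin _ inj])
    then have "\<Sum>S = (\<Sum>x\<in>S. ?s x)"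
      using sum.reindex[OF inj, of "\<lambda>x. x"] by simp
    \<comment> \<open>The sum of the reflected points equals the original sum, so the multiple of
      \<open>a\<close> must vanish, and that is the equation of the hyperplane at the
      centroid.\<close>
    also have "\<dots> = \<Sum>S - (2 * (a \<bullet> \<Sum>S - of_nat (card S) * b)) *\<^sub>R a"
      unfolding ab(2) reflection_hyperplane[OF ab(1)]
      by (simp add: sum_subtractf inner_sum_right flip: scaleR_sum_left sum_distrib_left)
    finally have "a \<bullet> \<Sum>S = of_nat (card S) * b"
      using ab(1) by auto
    then have "a \<bullet> c = b"
      using fin S by (simp add: c_def)
    then show ?thesis by (simp add: ab(2))
  qed
  then show thesis by (rule that)
qed

text \<open>The part of \<open>b\<close> orthogonal to \<open>a\<close> is a direction of the common
  hyperplane, hence orthogonal to \<open>b\<close>; so the inner product of the unit vectors has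
  square 1.\<close>

lemma unit_normals_eq:
  fixes a b :: "'a::euclidean_space"
  assumes "norm a = 1" "norm b = 1" "hyp c a = hyp c b"
  shows "b = a \<or> b = - a"
proof -
  have n: "a \<bullet> a = 1" "b \<bullet> b = 1" using assms by (simp_all add: norm_eq_1)
  have "c + (b - (a \<bullet> b) *\<^sub>R a) \<in> hyp c a" by (simp add: hyp_def inner_simps n)
  then have "b \<bullet> (b - (a \<bullet> b) *\<^sub>R a) = 0" unfolding assms(3) by (simp add: hyp_def)
  then have "(a \<bullet> b)\<^sup>2 = 1" by (simp add: inner_simps n power2_eq_square inner_commute)
  then consider "a \<bullet> b = 1" | "a \<bullet> b = - 1" by (auto simp: power2_eq_1_iff)
  then show ?thesis
  proof cases
    case 1
    then have "(b - a) \<bullet> (b - a) = 0" by (simp add: inner_simps n inner_commute)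
    then show ?thesis by simp
  next
    case 2
    then have "(b + a) \<bullet> (b + a) = 0" by (simp add: inner_simps n inner_commute)
    then show ?thesis by (simp add: eq_neg_iff_add_eq_0)
  qed
qed

text \<open>\<open>\<Phi>\<close> consists of both unit normals of every hyperplane. The reflection
  across \<open>hyp c a\<close> carries \<open>hyp c b\<close> to the hyperplane whose normal is the
  reflection of \<open>b\<close>, so stability of the arrangement becomes closure of
  \<open>\<Phi>\<close>.\<close>

lemma coxeter_arrangement_normals:
  fixes A :: "'a::euclidean_space set set"
  assumes A: "coxeter_arrangement A"
  obtains c \<Phi> where "reflection_arrangement \<Phi>" "A = hyp c ` \<Phi>"
proof -
  obtain c where c: "\<And>H. H \<in> A \<Longrightarrow> c \<in> H"
    using coxeter_arrangement_central[OF A] by blast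
  have finA: "finite A" and stable: "\<And>H K. H \<in> A \<Longrightarrow> K \<in> A \<Longrightarrow> reflection H ` K \<in> A"
    using A by (auto simp: coxeter_arrangement_def arrangement_def)
  define \<Phi> where "\<Phi> = {a. norm a = 1 \<and> hyp c a \<in> A}"
  have "\<exists>a. norm a = 1 \<and> H = hyp c a" if H: "H \<in> A" for H
  proof -
    have "affine H" "aff_dim H = int (DIM('a)) - 1"
      using A H by (auto simp: coxeter_arrangement_def arrangement_def)
    then obtain a b where ab: "norm a = 1" "H = {y. a \<bullet> y = b}"
      by (rule hyperplane_unit_normal)
    then have "H = hyp c a" using c[OF H] by (simp add: hyp_alt)
    then show ?thesis using ab by blast
  qed
  then have image: "A = hyp c ` \<Phi>" by (auto simp: \<Phi>_def)
  have "finite {a\<in>\<Phi>. hyp c a = H}" for H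
  proof (cases "{a\<in>\<Phi>. hyp c a = H} = {}")
    case False
    then obtain a where "a \<in> \<Phi>" "hyp c a = H" by blast
    then have "{a\<in>\<Phi>. hyp c a = H} \<subseteq> {a, -a}"
      using unit_normals_eq[of a _ c] by (auto simp: \<Phi>_def)
    then show ?thesis by (rule finite_subset) simp
  next
    case True
    then show ?thesis by (simp only: finite.emptyI)
  qed
  then have "finite (\<Union>H\<in>A. {a\<in>\<Phi>. hyp c a = H})"
    by (rule finite_UN_I[OF finA])
  moreover have "\<Phi> \<subseteq> (\<Union>H\<in>A. {a\<in>\<Phi>. hyp c a = H})" by (auto simp: \<Phi>_def)
  ultimately have fin: "finite \<Phi>" by (rule rev_finite_subset)
  have "reflection_arrangement \<Phi>"
  proof
    show "finite \<Phi>" by (rule fin)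
    show "0 \<notin> \<Phi>" by (simp add: \<Phi>_def)
    fix a assume a: "a \<in> \<Phi>"
    then show "- a \<in> \<Phi>" by (simp add: \<Phi>_def hyp_def)
    show na: "norm a = 1" using a by (simp add: \<Phi>_def)
    then have aa: "a \<bullet> a = 1" by (simp add: norm_eq_1)
    fix b assume b: "b \<in> \<Phi>"
    define d where "d = b - (2 * (a \<bullet> b)) *\<^sub>R a"
    let ?s = "reflection (hyp c a)"
    have bb: "b \<bullet> b = 1" using b by (simp add: \<Phi>_def norm_eq_1)
    have s: "?s y = y - (2 * (a \<bullet> (y - c))) *\<^sub>R a" for y
      unfolding hyp_alt reflection_hyperplane[OF na] by (simp add: inner_diff_right)
    have inv: "?s (?s y) = y" for y
      by (simp add: s inner_simps aa algebra_simps)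
    \<comment> \<open>\<open>d\<close> is the image of \<open>b\<close> under the linear part of the
      reflection, which is an isometry, and the reflection fixes \<open>c\<close>.\<close>
    have sd: "d \<bullet> (?s y - c) = b \<bullet> (y - c)" for y
      by (simp add: s d_def inner_simps aa inner_commute algebra_simps)
    have mem: "y \<in> hyp c e \<longleftrightarrow> e \<bullet> (y - c) = 0" for y e :: 'a by (simp add: hyp_def)
    have "hyp c d = ?s ` hyp c b"
    proof (intro equalityI subsetI)
      fix y assume "y \<in> hyp c d"
      then have "?s y \<in> hyp c b" using sd[of "?s y"] by (simp only: mem inv)
      then have "?s (?s y) \<in> ?s ` hyp c b" by (rule imageI)
      then show "y \<in> ?s ` hyp c b" by (simp only: inv)
    next
      fix y assume "y \<in> ?s ` hyp c b"
      then obtain z where "z \<in> hyp c b" "y = ?s z" by blast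
      then show "y \<in> hyp c d" using sd[of z] by (simp only: mem)
    qed
    then have "hyp c d \<in> A" using stable a b by (simp add: \<Phi>_def)
    moreover have "d \<bullet> d = 1"
      by (simp add: d_def inner_simps aa bb inner_commute algebra_simps)
    ultimately show "b - (2 * (a \<bullet> b)) *\<^sub>R a \<in> \<Phi>"
      by (simp add: \<Phi>_def d_def norm_eq_1)
  qed
  then show thesis using image by (rule that)
qed

section \<open>The coarse flag Hilbert--Poincare series at \<open>Y = 1\<close>\<close>

lemma eval_Y_fps_simps [simp]:
  "eval_Y_fps y (f * g) = eval_Y_fps y f * eval_Y_fps y g"
  "eval_Y_fps y 1 = 1" "eval_Y_fps y fps_X = fps_X"
  "eval_Y_fps y inverse_one_minus_T = inverse_one_minus_T"
  "eval_Y_fps y (fps_const p) = fps_const (poly p y)"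
  "eval_Y_fps y (fps_of_poly N) = fps_of_poly (eval_Y_poly y N)"
  by (auto simp: eval_Y_fps_def eval_Y_poly_def fps_eq_iff fps_mult_nth poly_sum inverse_one_minus_T_def
      coeff_map_poly)

lemma eval_Y_fps_power [simp]: "eval_Y_fps y (f ^ n) = eval_Y_fps y f ^ n"
  by (induction n) simp_all

lemma eval_Y_fps_sum: "eval_Y_fps y (\<Sum>i\<in>S. f i) = (\<Sum>i\<in>S. eval_Y_fps y (f i))"
  by (simp add: eval_Y_fps_def fps_eq_iff fps_sum_nth poly_sum)

lemma fps_const_sum: "fps_const (\<Sum>i\<in>S. f i) = (\<Sum>i\<in>S. fps_const (f i))"
  by (rule fps_ext) (simp add: fps_sum_nth)

lemma inverse_power: "(1 - fps_X) ^ n * (inverse_one_minus_T :: 'r::comm_ring_1 fps) ^ n = 1"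
  by (simp add: one_minus_T_times_inverse flip: power_mult_distrib)

lemma div_one_minus_X_power: "f / (1 - fps_X) ^ n = f * (inverse_one_minus_T :: rat fps) ^ n"
proof -
  have "f = (1 - fps_X) ^ n * (f * inverse_one_minus_T ^ n)"
    using inverse_power[of n, where 'r = rat] by (metis mult.left_commute mult_1_right)
  then have "f / (1 - fps_X) ^ n = (1 - fps_X) ^ n * (f * inverse_one_minus_T ^ n) / (1 - fps_X) ^ n"
    by (rule arg_cong)
  also have "\<dots> = f * inverse_one_minus_T ^ n"
    by (rule nonzero_mult_div_cancel_left) (simp add: one_minus_X_nonzero)
  finally show ?thesis .
qed

lemma mult_inverse_power_cancel:
  assumes "f * inverse_one_minus_T ^ n = g * (inverse_one_minus_T :: 'r::comm_ring_1 fps) ^ n"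
  shows "f = g"
  using arg_cong[OF assms, of "\<lambda>h. h * (1 - fps_X) ^ n"] inverse_power[of n, where 'r = 'r]
  by (simp add: mult.assoc mult.commute)

context reflection_arrangement
begin

text \<open>The intersection of all hyperplanes is the only minimal flat, so the choice in
  \<open>arr_rank\<close> is forced.\<close>

lemma arr_rank_hyps: "arr_rank UNIV hyps = dim0 UNIV"
proof -
  let ?z = "zeros c UNIV \<Phi>"
  have "(SOME x. x \<in> flats UNIV hyps \<and> (\<forall>y\<in>flats UNIV hyps. y \<subseteq> x \<longrightarrow> y = x)) = ?z"
  proof (rule some_equality)
    show "?z \<in> flats UNIV hyps \<and> (\<forall>y\<in>flats UNIV hyps. y \<subseteq> ?z \<longrightarrow> y = ?z)"
      unfolding flats_hyps using affine_zeros_normals(2) bottom_subset_L by blast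
    fix x assume "x \<in> flats UNIV hyps \<and> (\<forall>y\<in>flats UNIV hyps. y \<subseteq> x \<longrightarrow> y = x)"
    then show "x = ?z"
      unfolding flats_hyps using affine_zeros_normals(2) bottom_subset_L[of x] by blast
  qed
  then show ?thesis
    using flat_rank_zeros[of UNIV c \<Phi> \<Phi>] finite_normals by (simp add: arr_rank_def dim0_def)
qed

lemma length_flag_le_dim0:
  assumes "x \<in> L" "sorted_wrt (\<lambda>x y. y \<subset> x) (x # F)" "set F \<subseteq> L"
  shows "length F \<le> dim0 x"
  using assms
proof (induction F arbitrary: x)
  case (Cons y F)
  then have "length F \<le> dim0 y" "dim0 y < dim0 x" by (auto intro: dim0_mono)
  then show ?case by simp
qed simp

lemma poincare_nonzero: "poly (poincare_poly UNIV hyps) 1 \<noteq> 0"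
proof -
  have "faces UNIV \<noteq> {}"
  proof -
    have "generic c UNIV (nonvanishing UNIV) \<noteq> {}"
      by (rule generic_point_exists) (auto simp: nonvanishing_def finite_normals)
    then show ?thesis by (simp add: faces_def regions_def)
  qed
  then show ?thesis by (simp add: poincare_at_1 card_gt_0_iff)
qed

lemma sum_flags_at_1:
  "(\<Sum>F\<in>flags_below {x\<in>L. m \<le> dim0 x} l UNIV. poly (flag_poly UNIV hyps F) 1)
    = of_nat (chain_count m l (dim0 UNIV)) * poly (poincare_poly UNIV hyps) 1"
  by (rule sum_flag_poly_at_1) (rule card_faces_below)

lemma flags_above_bottom_length:
  assumes "F \<in> flags (flats_above_bottom UNIV hyps)"
  shows "length F \<le> dim0 UNIV"
  by (rule length_flag_le_dim0) (use assms UNIV_L in \<open>auto simp: flags_def flats_above_bottom_def flats_hyps\<close>)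

lemma finite_flats_above_bottom: "finite (flats_above_bottom UNIV hyps)"
  by (simp add: flats_above_bottom_def flats_hyps)

lemma eval_cfHP:
  "eval_Y_fps 1 (cfHP UNIV hyps) = fps_const (poly (poincare_poly UNIV hyps) 1) *
    (fps_of_poly (eulerian_poly (dim0 UNIV)) / (1 - fps_X) ^ dim0 UNIV)"
proof -
  let ?r = "dim0 UNIV" and ?P = "flats_above_bottom UNIV hyps" and ?N = "poly (poincare_poly UNIV hyps) 1"
  \<comment> \<open>The strict bound by \<open>UNIV\<close> already excludes the ambient space, so
    removing it from the flats changes nothing.\<close>
  have below: "flags_below ?P l UNIV = flags_below {x\<in>L. 0 \<le> dim0 x} l UNIV" for l
    by (auto simp: flags_below_def flags_def flats_above_bottom_def flats_hyps)
  have "eval_Y_fps 1 (cfHP UNIV hyps) = (\<Sum>F\<in>flags ?P. fps_const (poly (flag_poly UNIV hyps F) 1) * geo ^ length F)"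
    by (simp add: cfHP_def eval_Y_fps_sum)
  also have "\<dots> = (\<Sum>l\<le>?r. \<Sum>F\<in>flags_below ?P l UNIV. fps_const (poly (flag_poly UNIV hyps F) 1) * geo ^ length F)"
    by (rule sum_flags)
      (simp_all add: finite_flats_above_bottom flags_above_bottom_length, auto simp: flats_above_bottom_def)
  also have "\<dots> = (\<Sum>l\<le>?r. fps_const (\<Sum>F\<in>flags_below ?P l UNIV. poly (flag_poly UNIV hyps F) 1) * geo ^ l)"
    unfolding fps_const_sum sum_distrib_right
    by (intro sum.cong[OF HOL.refl]) (auto simp: flags_below_def)
  also have "\<dots> = fps_const ?N * (\<Sum>l\<le>?r. of_nat (chain_count 0 l ?r) * geo ^ l)"
    unfolding below sum_flags_at_1 sum_distrib_left fps_const_mult[symmetric] fps_of_nat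
    by (simp only: mult_ac)
  also have "(\<Sum>l\<le>?r. of_nat (chain_count 0 l ?r) * geo ^ l) = fps_of_poly (eulerian_poly ?r) / (1 - fps_X :: rat fps) ^ ?r"
    unfolding eulerian_geo[OF order.refl]
    by (rule nonzero_mult_div_cancel_left[symmetric]) (simp add: one_minus_X_nonzero)
  finally show ?thesis .
qed

text \<open>A flag has at most as many members as the rank, so (1-T)^rank is a common denominator.
  Together with \<open>mult_inverse_power_cancel\<close> this makes the description in
  \<open>cfHP_numerator\<close> well defined.\<close>

lemma cfHP_numerator_exists:
  "\<exists>N. cfHP UNIV hyps = fps_of_poly N * inverse_one_minus_T ^ dim0 UNIV"
proof -
  let ?r = "dim0 UNIV" and ?F = "flags (flats_above_bottom UNIV hyps)"
  define N where "N = (\<Sum>F\<in>?F. Polynomial.smult (flag_poly UNIV hyps F)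
    ([:0, 1:] ^ length F * [:1, -1:] ^ (?r - length F)))"
  have X: "fps_of_poly [:0, 1:] = (fps_X :: rat poly fps)" "fps_of_poly [:1, -1:] = (1 - fps_X :: rat poly fps)"
    by (simp_all add: fps_of_poly_pCons flip: fps_const_neg)
  have "cfHP UNIV hyps = (\<Sum>F\<in>?F. fps_const (flag_poly UNIV hyps F) *
      (fps_X ^ length F * (1 - fps_X) ^ (?r - length F))) * inverse_one_minus_T ^ ?r"
    unfolding cfHP_def sum_distrib_right
  proof (rule sum.cong[OF HOL.refl])
    fix F assume "F \<in> ?F"
    then have "?r = (?r - length F) + length F" using flags_above_bottom_length by simp
    then have "(inverse_one_minus_T :: rat poly fps) ^ ?r = inverse_one_minus_T ^ (?r - length F) * inverse_one_minus_T ^ length F"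
      by (metis power_add)
    then have "(1 - fps_X) ^ (?r - length F) * (inverse_one_minus_T :: rat poly fps) ^ ?r = inverse_one_minus_T ^ length F"
      using inverse_power[of "?r - length F", where 'r = "rat poly"] by (simp add: mult.assoc[symmetric])
    then show "fps_const (flag_poly UNIV hyps F) * geo ^ length F = fps_const (flag_poly UNIV hyps F) *
      (fps_X ^ length F * (1 - fps_X) ^ (?r - length F)) * inverse_one_minus_T ^ ?r"
      by (simp add: power_mult_distrib mult.assoc)
  qed
  also have "\<dots> = fps_of_poly N * inverse_one_minus_T ^ ?r"
    by (simp add: N_def fps_of_poly_sum fps_of_poly_smult fps_of_poly_mult fps_of_poly_power X)
  finally show ?thesis by blast
qed

lemma eval_cfHP_numerator:
  "eval_Y_poly 1 (cfHP_numerator UNIV hyps)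
    = Polynomial.smult (poly (poincare_poly UNIV hyps) 1) (eulerian_poly (dim0 UNIV))"
proof -
  let ?r = "dim0 UNIV"
  obtain N where N: "cfHP UNIV hyps = fps_of_poly N * inverse_one_minus_T ^ ?r"
    using cfHP_numerator_exists by blast
  have "cfHP_numerator UNIV hyps = N"
    unfolding cfHP_numerator_def arr_rank_hyps
  proof (rule the_equality)
    fix M assume "cfHP UNIV hyps = fps_of_poly M * inverse_one_minus_T ^ ?r"
    then have "fps_of_poly M * inverse_one_minus_T ^ ?r = fps_of_poly N * inverse_one_minus_T ^ ?r"
      unfolding N by (rule HOL.sym)
    then have "fps_of_poly M = fps_of_poly N"
      by (rule mult_inverse_power_cancel)
    then show "M = N" by simp
  qed (rule N)
  moreover have "fps_of_poly (eval_Y_poly 1 N)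
      = fps_of_poly (Polynomial.smult (poly (poincare_poly UNIV hyps) 1) (eulerian_poly ?r))"
  proof (rule mult_inverse_power_cancel)
    show "fps_of_poly (eval_Y_poly 1 N) * inverse_one_minus_T ^ ?r
        = fps_of_poly (Polynomial.smult (poly (poincare_poly UNIV hyps) 1) (eulerian_poly ?r)) * inverse_one_minus_T ^ ?r"
      using eval_cfHP unfolding N div_one_minus_X_power by (simp add: fps_of_poly_smult mult.assoc)
  qed
  ultimately show ?thesis by simp
qed

lemma sum_proper_flags:
  assumes "k \<in> {1..dim0 UNIV}"
  shows "(\<Sum>F | F \<in> flags (proper_flats UNIV hyps) \<and> length F = k - 1. poly (flag_poly UNIV hyps F) 1)
    = fact k * of_nat (Stirling (dim0 UNIV) k) * poly (poincare_poly UNIV hyps) 1"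
proof -
  have "\<Inter>hyps = zeros c UNIV \<Phi>" by (auto simp: zeros_def hyp_def)
  then have "x \<in> proper_flats UNIV hyps \<longleftrightarrow> x \<in> {x\<in>L. 1 \<le> dim0 x} - {UNIV}" for x
    using dim0_eq_0[of x] by (cases "x \<in> L") (auto simp add: proper_flats_def flats_hyps Suc_le_eq neq0_conv[symmetric] simp del: neq0_conv)
  then have "proper_flats UNIV hyps = {x\<in>L. 1 \<le> dim0 x} - {UNIV}" by blast
  then have "{F. F \<in> flags (proper_flats UNIV hyps) \<and> length F = k - 1}
      = flags_below {x\<in>L. 1 \<le> dim0 x} (k - 1) UNIV"
    by (auto simp: flags_below_def flags_def)
  \<comment> \<open>A chain of k - 1 nonempty proper subsets corresponds to k ordered blocks; the
    range of k forces positive rank.\<close>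
  moreover have "chain_count 1 (k - 1) (dim0 UNIV) = fact k * Stirling (dim0 UNIV) k"
    using assms chain_count_1[of "dim0 UNIV" "k - 1"] by (simp add: surjections_def)
  ultimately show ?thesis by (simp add: sum_flags_at_1)
qed

end

theorem theorem4:
  fixes A :: "'a::euclidean_space set set" and r :: nat
  assumes "coxeter_arrangement A"
    and "\<not> (\<exists>W B. irreducible_factor UNIV A W B \<and>
               equivalent_arrangements W B UNIV E8_arrangement)"
    and "r = arr_rank UNIV A"
  shows "eval_Y_fps 1 (cfHP UNIV A) / fps_const (poly (poincare_poly UNIV A) 1)
           = fps_of_poly (eulerian_poly r) / (1 - fps_X) ^ r
       \<and> fps_of_poly (eulerian_poly r) / (1 - fps_X) ^ r
           = stanley_reisner_hilbert TYPE('f::field) (barycentric_subdivision (simplex_on r))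
       \<and> (1 \<le> r \<longrightarrow> fps_of_poly (eulerian_poly r) / (1 - fps_X) ^ r
           = stanley_reisner_hilbert TYPE('f) (barycentric_subdivision (simplex_boundary r))
               / (1 - fps_X))
       \<and> eval_Y_poly 1 (cfHP_numerator UNIV A)
           = Polynomial.smult (poly (poincare_poly UNIV A) 1) (eulerian_poly r)
       \<and> (\<forall>k\<in>{1..r}. (\<Sum>F | F \<in> flags (proper_flats UNIV A) \<and> length F = k - 1.
              poly (flag_poly UNIV A F) 1 / poly (poincare_poly UNIV A) 1)
           = fact k * of_nat (Stirling r k))"
proof -
  obtain c \<Phi> where *: "reflection_arrangement \<Phi>" and A: "A = hyp c ` \<Phi>"
    using coxeter_arrangement_normals[OF assms(1)] by blast
  interpret reflection_arrangement c \<Phi> by (rule *)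
  have r: "r = dim0 UNIV" using assms(3) arr_rank_hyps A by simp
  let ?N = "poly (poincare_poly UNIV A) 1"
  have N: "?N \<noteq> 0" using poincare_nonzero A by simp
  have fin: "finite (\<Union>(simplex_on r))" "finite (\<Union>(simplex_boundary r))"
    by (rule finite_subset[of _ "{1..r}"]; auto simp: simplex_on_def simplex_boundary_def)+
  have hilb: "stanley_reisner_hilbert TYPE('f) (barycentric_subdivision P) = (\<Sum>C\<in>barycentric_subdivision P. geo ^ card C)"
    if "finite (\<Union>P)" for P :: "nat set set"
    by (rule simplicial_complex.stanley_reisner_hilbert_eq[OF simplicial_complex_barycentric_subdivision[OF that]])
  show ?thesis
  proof (intro conjI impI ballI)
    show "eval_Y_fps 1 (cfHP UNIV A) / fps_const ?N = fps_of_poly (eulerian_poly r) / (1 - fps_X) ^ r"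
      using eval_cfHP N unfolding A r by (metis fps_const_eq_0_iff nonzero_mult_div_cancel_left)
    show "fps_of_poly (eulerian_poly r) / (1 - fps_X) ^ r
        = stanley_reisner_hilbert TYPE('f) (barycentric_subdivision (simplex_on r))"
      unfolding hilb[OF fin(1)] by (rule sum_subdivided_simplex[symmetric])
    show "fps_of_poly (eulerian_poly r) / (1 - fps_X) ^ r
        = stanley_reisner_hilbert TYPE('f) (barycentric_subdivision (simplex_boundary r)) / (1 - fps_X)"
      if "1 \<le> r"
      unfolding hilb[OF fin(2)] by (rule sum_subdivided_boundary(1)[symmetric]) (use that in simp)
    show "eval_Y_poly 1 (cfHP_numerator UNIV A) = Polynomial.smult ?N (eulerian_poly r)"
      unfolding A r by (rule eval_cfHP_numerator)
    show "(\<Sum>F | F \<in> flags (proper_flats UNIV A) \<and> length F = k - 1. poly (flag_poly UNIV A F) 1 / ?N)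
        = fact k * of_nat (Stirling r k)" if "k \<in> {1..r}" for k
      using sum_proper_flags[of k] that N unfolding A r by (simp flip: sum_divide_distrib)
  qed
qed

end
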